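(* Let $E$ be a compact Polish space, $\alpha$ an a priori probability measure on $E$, and $\Phi:E\times E\to\mathbb{R}$ a bounded pair interaction potential. Let $(w_i)_{i\in\mathbb{N}}$ be weights in $E'=(0,\infty)$ for which there is a random variable $W$ with law $P$ such that, as $N\to\infty$, (i) $W_N\to W$ in distribution and (ii) $\mathbb{E}[W_N^2]=\frac1N\sum_{i=1}^N w_i^2\to\mathbb{E}[W^2]<\infty$. Then the annealed pressure exists in the thermodynamic limit $N\to\infty$ and is given by $$\psi(\Phi,P,\alpha)=\lim_{N\to\infty}\frac1N\log Q_N^w\,\alpha^{N}\Bigl(e^{\sum_{(i,j)\in E_N}\Phi(\sigma_i,\sigma_j)}\Bigr)=\sup_{\nu\in\mathcal{M}_1(E\times E'):\ \nu(dw)=P(dw)}\Bigl(\nu\otimes\nu(U)-\int P(dw)\,S(\nu^w\mid\alpha)\Bigr)<\infty,$$ where $U(\sigma,\sigma',w,w')=\frac{ww'}{2\,\mathbb{E}[W]}e^{\Phi(\sigma,\sigma')}$.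
   Context: Generalized random graph: given weights $w_1,\dots,w_N\in(0,\infty)$, put $l_N=\sum_{i=1}^N w_i$. The graph has vertex set $[N]=\{1,\dots,N\}$, and an edge between $i$ and $j$ ($i\ne j$) is present, independently of all other edges, with probability $p_{ij}=\frac{w_iw_j}{l_N+w_iw_j}$. Its law (and expectation) is $Q_N^w$ and its random edge set is $E_N$ (each edge counted once). $W_N=w_{V_N}$, where $V_N$ is uniform on $[N]$. $\alpha^{N}(\cdot)$ denotes integration of $\sigma=(\sigma_1,\dots,\sigma_N)$ with respect to the $N$-fold product of $\alpha$. $\mathcal{M}_1(X)$ is the set of Borel probability measures on $X$. For $\nu\in\mathcal{M}_1(E\times E')$, $\nu(dw)$ is its marginal on $E'$ and $\nu^w$ the conditional distribution of $\sigma$ given $w$. $\nu\otimes\nu(U)=\int\int U(\sigma,\sigma',w,w')\,\nu(d\sigma,dw)\,\nu(d\sigma',dw')$. $S(\rho\mid\alpha)=\int\rho(d\sigma)\log\frac{d\rho}{d\alpha}(\sigma)$ is relative entropy ($+\infty$ if $\rho\not\ll\alpha$).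
   Formalization: The printed formula fails for Φ=0 (left side 0, right side E[W]/2); the proved version subtracts E[W]/2 from the supremum (equivalently U carries e^Φ−1), and takes Φ symmetric and Borel measurable so that the edge sum and the integrals are well defined. *)

theory Defs
  imports "HOL-Probability.Probability"
begin

text \<open>
  The potential edges among the vertices \<open>{1..N}\<close>: each unordered pair is represented once, by its
  increasing enumeration.
\<close>

definition vertex_pairs :: "nat \<Rightarrow> (nat \<times> nat) set" where
  "vertex_pairs N = {(i, j). 1 \<le> i \<and> i < j \<and> j \<le> N}"

definition edge_prob :: "(nat \<Rightarrow> real) \<Rightarrow> nat \<Rightarrow> nat \<Rightarrow> nat \<Rightarrow> real" where
  "edge_prob w N i j = w i * w j / ((\<Sum>k=1..N. w k) + w i * w j)"

definition generalized_random_graph :: "(nat \<Rightarrow> real) \<Rightarrow> nat \<Rightarrow> (nat \<times> nat) set pmf" where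
  "generalized_random_graph w N =
     map_pmf (\<lambda>present. {e \<in> vertex_pairs N. present e})
       (Pi_pmf (vertex_pairs N) False (\<lambda>(i, j). bernoulli_pmf (edge_prob w N i j)))"

definition annealed_partition ::
    "('a :: topological_space \<Rightarrow> 'a \<Rightarrow> real) \<Rightarrow> 'a measure \<Rightarrow> (nat \<Rightarrow> real) \<Rightarrow> nat \<Rightarrow> real" where
  "annealed_partition \<Phi> \<alpha> w N =
     measure_pmf.expectation (generalized_random_graph w N)
       (\<lambda>G. \<integral>\<sigma>. exp (\<Sum>(i, j)\<in>G. \<Phi> (\<sigma> i) (\<sigma> j)) \<partial>(PiM {1..N} (\<lambda>_. \<alpha>)))"

definition annealed_pressure ::
    "('a :: topological_space \<Rightarrow> 'a \<Rightarrow> real) \<Rightarrow> 'a measure \<Rightarrow> (nat \<Rightarrow> real) \<Rightarrow> nat \<Rightarrow> real" where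
  "annealed_pressure \<Phi> \<alpha> w N = ln (annealed_partition \<Phi> \<alpha> w N) / real N"

text \<open>The law of \<open>w V\<close>, where \<open>V\<close> is uniform on \<open>{1..N}\<close>.\<close>

definition empirical_weight_law :: "(nat \<Rightarrow> real) \<Rightarrow> nat \<Rightarrow> real measure" where
  "empirical_weight_law w N = distr (measure_pmf (pmf_of_set {1..N})) borel w"

text \<open>
  Relative entropy \<open>S(\<rho> | \<alpha>)\<close> of probability measures. \<^const>\<open>KL_divergence\<close> is a Bochner integral and
  hence \<open>0\<close> when the entropy density is not integrable. The negative part of
  \<open>\<integral> log (d\<rho>/d\<alpha>) d\<rho>\<close> is always finite, so non-integrability means that the integral is \<open>\<infinity>\<close>.
\<close>

definition relative_entropy :: "'a measure \<Rightarrow> 'a measure \<Rightarrow> ennreal" where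
  "relative_entropy \<rho> \<alpha> =
     (if absolutely_continuous \<alpha> \<rho> \<and> integrable \<rho> (entropy_density (exp 1) \<alpha> \<rho>)
      then ennreal (KL_divergence (exp 1) \<alpha> \<rho>) else \<infinity>)"

text \<open>
  Measures on \<open>E \<times> (0,\<infinity>)\<close> are represented as measures on \<open>E \<times> \<real>\<close>; in the theorem the second marginal
  is concentrated on \<open>(0,\<infinity>)\<close>.
\<close>

definition weight_marginal :: "('a :: second_countable_topology \<times> real) measure \<Rightarrow> real measure" where
  "weight_marginal \<nu> = distr \<nu> borel snd"

definition regular_conditional_law ::
    "('a :: second_countable_topology \<times> real) measure \<Rightarrow> (real \<Rightarrow> 'a measure) \<Rightarrow> bool" where
  "regular_conditional_law \<nu> \<kappa> \<longleftrightarrow>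
     \<kappa> \<in> borel \<rightarrow>\<^sub>M prob_algebra borel \<and>
     (\<forall>A\<in>sets borel. \<forall>B\<in>sets borel.
        emeasure \<nu> (A \<times> B) = (\<integral>\<^sup>+x\<in>B. emeasure (\<kappa> x) A \<partial>weight_marginal \<nu>))"

text \<open>
  \<open>\<integral> S(\<nu>\<^sup>w | \<alpha>) \<nu>(dw)\<close>. On a Polish space a regular conditional law exists and any two versions agree
  almost everywhere, so the infimum is over a one-element set; it only serves to select the common value
  without choosing a version.
\<close>

definition mean_conditional_entropy ::
    "'a :: second_countable_topology measure \<Rightarrow> ('a \<times> real) measure \<Rightarrow> ennreal" where
  "mean_conditional_entropy \<alpha> \<nu> =
     Inf {\<integral>\<^sup>+x. relative_entropy (\<kappa> x) \<alpha> \<partial>weight_marginal \<nu> | \<kappa>. regular_conditional_law \<nu> \<kappa>}"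

definition tensor_integral ::
    "('a \<Rightarrow> 'a \<Rightarrow> real \<Rightarrow> real \<Rightarrow> real) \<Rightarrow> ('a \<times> real) measure \<Rightarrow> real" where
  "tensor_integral U \<nu> = (\<integral>(s, x). (\<integral>(s', x'). U s s' x x' \<partial>\<nu>) \<partial>\<nu>)"

text \<open>
  The annealed graph average is \<open>\<Prod>i<j. (1 + p i j * (exp (\<Phi> (\<sigma> i) (\<sigma> j)) - 1))\<close>, whose limiting energy density
  involves \<open>exp \<Phi> - 1\<close> rather than the \<open>exp \<Phi>\<close> of \<open>U\<close>. For every \<open>\<nu>\<close> with second marginal \<open>P\<close> the difference
  of the two energies is the constant \<open>m / 2\<close>, where \<open>m\<close> is the mean of \<open>P\<close>; this constant therefore has
  to be subtracted from the supremum over \<open>\<nu>\<close>.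
\<close>

definition interaction_U ::
    "real \<Rightarrow> ('a \<Rightarrow> 'a \<Rightarrow> real) \<Rightarrow> 'a \<Rightarrow> 'a \<Rightarrow> real \<Rightarrow> real \<Rightarrow> real" where
  "interaction_U m \<Phi> s s' x x' = x * x' / (2 * m) * exp (\<Phi> s s')"

end

theory Submission
  imports Defs
begin

text \<open>
  Put \<open>y\<^sub>i\<^sub>j = w\<^sub>i w\<^sub>j / l\<^sub>N\<close> and \<open>V = e\<^sup>\<Phi>\<close>. Integrating out the edges, an edge contributes the factor
  \<open>1 + p\<^sub>i\<^sub>j (V - 1) = (1 + y\<^sub>i\<^sub>j V) / (1 + y\<^sub>i\<^sub>j)\<close>, which is the exponential of \<open>y\<^sub>i\<^sub>j (V - 1)\<close> up to
  \<open>O(y\<^sub>i\<^sub>j\<^sup>2)\<close>. The second moment condition bounds the sum of the \<open>y\<^sub>i\<^sub>j\<^sup>2\<close>, so only the mean-field energy,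
  the sum of the \<open>y\<^sub>i\<^sub>j V(\<sigma>\<^sub>i, \<sigma>\<^sub>j)\<close>, matters; the sum of the \<open>y\<^sub>i\<^sub>j\<close> is \<open>N E[W] / 2 + o(N)\<close> and produces the
  constant \<open>E[W] / 2\<close>. Uniform integrability allows us to replace the weights by finitely many values, one for each
  class of weights.

  The lower bound is Gibbs' variational inequality for product measures whose factors have a bounded density
  depending only on the class. Such densities approximate the conditional laws of an arbitrary competitor; the entropy is
  controlled by the Donsker-Varadhan inequality, without any convexity of the energy.

  For the upper bound, \<open>V\<close> is only measurable, hence is approximated in \<open>L\<^sup>1(\<alpha> \<otimes> \<alpha>)\<close> by its averages over the cells of a
  finite partition of the spin space. The error has small exponential moments: the pairs split into \<open>N\<close> matchings
  \<open>i + j = r\<close> modulo \<open>N\<close>, the terms of one matching are independent, and Jensen recombines the matchings.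
  For the averaged interaction it remains to count, class by class, the spins in each cell: there are only
  polynomially many types. The averages make the energy of a density that is constant on the cells exact, so no second
  error appears in the variational formula.
\<close>

section \<open>Product measures\<close>

text \<open>A step kernel approximates a merely measurable \<open>V\<close> in the mean only, so on
  single configurations the two energies can differ by order N. Smallness in the mean says little on
  the exponential scale by itself; but the difference is bounded, hence the exponential of any fixed
  multiple of it has integral close to 1 once the partition is fine enough, and the bad
  configurations become exponentially negligible. The unbounded weights, in contrast, are replaced
  at a cost that is uniform in the configuration, because the error of a class value is dominated by
  \<delta> (1 + x^2). With class values in place of the weights, the energy sees a competitor only
  through the averages of its conditional laws over the classes, and the entropy of these averages
  is at most the mean entropy. This is why densities depending on the class alone suffice, although
  the conditional law may vary inside a class.\<close>

lemma product_prob_spaceI: "(\<And>i. prob_space (M i)) \<Longrightarrow> product_prob_space M"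
  by (simp add: product_prob_space_def product_sigma_finite_def product_prob_space_axioms_def
      prob_space_imp_sigma_finite)

text \<open>A pair energy is a sum of functions of two coordinates, so its expectation under a
  product measure needs two-dimensional marginals only. The preimage of a rectangle is a box whose
  factors other than \<open>i\<close> and \<open>j\<close> are full and have mass 1.\<close>

lemma (in product_prob_space) distr_PiM_pair:
  assumes I: "finite I" "i \<in> I" "j \<in> I" "i \<noteq> j"
  shows "distr (PiM I M) (M i \<Otimes>\<^sub>M M j) (\<lambda>\<sigma>. (\<sigma> i, \<sigma> j)) = M i \<Otimes>\<^sub>M M j"
proof -
  interpret PI: prob_space "PiM I M" by (rule prob_space_PiM) (rule prob_space)
  have [measurable]: "(\<lambda>\<sigma>. (\<sigma> i, \<sigma> j)) \<in> PiM I M \<rightarrow>\<^sub>M M i \<Otimes>\<^sub>M M j"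
    using I by measurable
  have "M i \<Otimes>\<^sub>M M j = distr (PiM I M) (M i \<Otimes>\<^sub>M M j) (\<lambda>\<sigma>. (\<sigma> i, \<sigma> j))"
  proof (rule pair_measure_eqI)
    fix A B assume AB[measurable]: "A \<in> sets (M i)" "B \<in> sets (M j)"
    let ?X = "\<lambda>k. if k = i then A else if k = j then B else space (M k)"
    have "\<sigma> \<in> (\<lambda>\<sigma>. (\<sigma> i, \<sigma> j)) -` (A \<times> B) \<inter> space (PiM I M) \<longleftrightarrow> \<sigma> \<in> Pi\<^sub>E I ?X" for \<sigma>
    proof -
      have "\<sigma> \<in> Pi\<^sub>E I ?X \<longleftrightarrow> \<sigma> \<in> extensional I \<and> \<sigma> i \<in> A \<and> \<sigma> j \<in> B \<and> (\<forall>k\<in>I - {i, j}. \<sigma> k \<in> space (M k))"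
        using I unfolding PiE_iff by (smt (verit) DiffE DiffI insert_iff empty_iff)
      moreover have "\<sigma> \<in> space (PiM I M) \<longleftrightarrow> \<sigma> \<in> extensional I \<and> \<sigma> i \<in> space (M i) \<and> \<sigma> j \<in> space (M j) \<and> (\<forall>k\<in>I - {i, j}. \<sigma> k \<in> space (M k))"
        using I unfolding space_PiM PiE_iff by blast
      ultimately show ?thesis
        using sets.sets_into_space[OF AB(1)] sets.sets_into_space[OF AB(2)] by auto
    qed
    then have "(\<lambda>\<sigma>. (\<sigma> i, \<sigma> j)) -` (A \<times> B) \<inter> space (PiM I M) = Pi\<^sub>E I ?X" by blast
    then have "emeasure (distr (PiM I M) (M i \<Otimes>\<^sub>M M j) (\<lambda>\<sigma>. (\<sigma> i, \<sigma> j))) (A \<times> B) = emeasure (PiM I M) (Pi\<^sub>E I ?X)"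
      by (subst emeasure_distr) auto
    also have "\<dots> = (\<Prod>k\<in>I. emeasure (M k) (?X k))"
      using I by (intro emeasure_PiM) auto
    also have "\<dots> = (\<Prod>k\<in>{i, j}. emeasure (M k) (?X k))"
      using I by (intro prod.mono_neutral_right) (auto simp: M.emeasure_space_1)
    also have "\<dots> = emeasure (M i) A * emeasure (M j) B"
      using I by simp
    finally show "emeasure (M i) A * emeasure (M j) B = emeasure (distr (PiM I M) (M i \<Otimes>\<^sub>M M j) (\<lambda>\<sigma>. (\<sigma> i, \<sigma> j))) (A \<times> B)" ..
  qed (simp_all add: M.sigma_finite_measure_axioms)
  then show ?thesis ..
qed

text \<open>On extensional functions the indicator of a box is a product over the coordinates, so
  both measures agree on boxes by Fubini. This supplies the density of the trial measure in Gibbs'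
  inequality.\<close>

lemma PiM_density:
  fixes g :: "'i \<Rightarrow> 'a \<Rightarrow> ennreal"
  assumes I: "finite I" and M: "\<And>i. prob_space (M i)"
    and g: "\<And>i. g i \<in> borel_measurable (M i)" "\<And>i. (\<integral>\<^sup>+x. g i x \<partial>M i) = 1"
  shows "density (PiM I M) (\<lambda>\<sigma>. \<Prod>i\<in>I. g i (\<sigma> i)) = PiM I (\<lambda>i. density (M i) (g i))"
proof -
  interpret A: product_prob_space M by (rule product_prob_spaceI) (rule M)
  have "prob_space (density (M i) (g i))" for i
    using g[of i] by (intro prob_spaceI) (simp add: emeasure_density cong: nn_integral_cong)
  then interpret B: product_prob_space "\<lambda>i. density (M i) (g i)" by (rule product_prob_spaceI)
  note g(1)[measurable]
  have gm[measurable]: "(\<lambda>\<sigma>. \<Prod>i\<in>I. g i (\<sigma> i)) \<in> borel_measurable (PiM I M)"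
    by measurable
  show ?thesis
  proof (rule B.PiM_eqI)
    show "sets (density (PiM I M) (\<lambda>\<sigma>. \<Prod>i\<in>I. g i (\<sigma> i))) = sets (PiM I (\<lambda>i. density (M i) (g i)))"
      by (simp cong: sets_PiM_cong)
    fix X assume "\<And>i. i \<in> I \<Longrightarrow> X i \<in> sets (density (M i) (g i))"
    then have X: "\<And>i. i \<in> I \<Longrightarrow> X i \<in> sets (M i)" by simp
    have "Pi\<^sub>E I X \<in> sets (PiM I M)" using I X by (intro sets_PiM_I_finite) auto
    then have "emeasure (density (PiM I M) (\<lambda>\<sigma>. \<Prod>i\<in>I. g i (\<sigma> i))) (Pi\<^sub>E I X) =
      (\<integral>\<^sup>+\<sigma>. (\<Prod>i\<in>I. g i (\<sigma> i)) * indicator (Pi\<^sub>E I X) \<sigma> \<partial>PiM I M)"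
      by (simp add: emeasure_density)
    also have "\<dots> = (\<integral>\<^sup>+\<sigma>. (\<Prod>i\<in>I. g i (\<sigma> i) * indicator (X i) (\<sigma> i)) \<partial>PiM I M)"
    proof (rule nn_integral_cong)
      fix \<sigma> assume "\<sigma> \<in> space (PiM I M)"
      then have "\<sigma> \<in> extensional I" by (simp add: space_PiM PiE_def)
      then show "(\<Prod>i\<in>I. g i (\<sigma> i)) * indicator (Pi\<^sub>E I X) \<sigma> = (\<Prod>i\<in>I. g i (\<sigma> i) * indicator (X i) (\<sigma> i))"
        using I by (auto simp: indicator_def PiE_iff prod.distrib prod_zero_iff)
    qed
    also have "\<dots> = (\<Prod>i\<in>I. \<integral>\<^sup>+x. g i x * indicator (X i) x \<partial>M i)"
      using I X by (intro A.product_nn_integral_prod) auto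
    also have "\<dots> = (\<Prod>i\<in>I. emeasure (density (M i) (g i)) (X i))"
      using X by (intro prod.cong refl) (simp add: emeasure_density)
    finally show "emeasure (density (PiM I M) (\<lambda>\<sigma>. \<Prod>i\<in>I. g i (\<sigma> i))) (Pi\<^sub>E I X) = (\<Prod>i\<in>I. emeasure (density (M i) (g i)) (X i))" .
  qed (rule I)
qed

text \<open>Gibbs' variational inequality, by Jensen under the product density.\<close>

lemma exp_integral_PiM_ge:
  fixes g :: "'i \<Rightarrow> 'a \<Rightarrow> real" and F :: "('i \<Rightarrow> 'a) \<Rightarrow> real"
  assumes I: "finite I" and M: "prob_space M"
    and g[measurable]: "\<And>i. g i \<in> borel_measurable M"
    and gb: "\<And>i x. a \<le> g i x" "0 < a" "\<And>i x. g i x \<le> b"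
    and g1: "\<And>i. (\<integral>x. g i x \<partial>M) = 1"
    and F[measurable]: "F \<in> borel_measurable (PiM I (\<lambda>_. M))" and FK: "\<And>\<sigma>. \<bar>F \<sigma>\<bar> \<le> K"
  shows "(\<integral>\<sigma>. exp (F \<sigma>) \<partial>PiM I (\<lambda>_. M)) \<ge>
     exp ((\<integral>\<sigma>. F \<sigma> \<partial>PiM I (\<lambda>i. density M (g i))) - (\<Sum>i\<in>I. \<integral>x. g i x * ln (g i x) \<partial>M))"
proof -
  interpret M: prob_space M by fact
  have gpos: "0 < g i x" for i x using gb(1)[of i x] gb(2) by linarith
  have gi: "integrable M (g i)" for i
    using gb(3) gpos by (intro M.integrable_const_bound[where B=b]) (auto simp: less_imp_le)
  have g1': "(\<integral>\<^sup>+x. ennreal (g i x) \<partial>M) = 1" for i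
    using gi g1 gpos by (subst nn_integral_eq_integral) (auto simp: less_imp_le)
  have prD: "prob_space (density M (g i))" for i
    using g1'[of i] by (intro prob_spaceI) (simp add: emeasure_density cong: nn_integral_cong)
  interpret DP: prob_space "PiM I (\<lambda>i. density M (g i))" by (rule prob_space_PiM) (rule prD)
  interpret MP: prob_space "PiM I (\<lambda>_. M)" by (rule prob_space_PiM) (rule M)
  have eq: "PiM I (\<lambda>i. density M (g i)) = density (PiM I (\<lambda>_. M)) (\<lambda>\<sigma>. ennreal (\<Prod>i\<in>I. g i (\<sigma> i)))"
    using PiM_density[OF I, of "\<lambda>_. M" "\<lambda>i x. ennreal (g i x)"] M g1' gpos by (simp add: prod_ennreal less_imp_le)
  have sts: "sets (PiM I (\<lambda>i. density M (g i))) = sets (PiM I (\<lambda>_. M))"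
    by (simp cong: sets_PiM_cong)
  define L where "L \<sigma> = (\<Sum>i\<in>I. ln (g i (\<sigma> i)))" for \<sigma>
  have [measurable]: "L \<in> borel_measurable (PiM I (\<lambda>_. M))" unfolding L_def by measurable
  have lnb: "\<bar>ln (g i x)\<bar> \<le> \<bar>ln a\<bar> + \<bar>ln b\<bar>" for i x
    using gpos[of i x] gb(1)[of i x] gb(2) gb(3)[of i x]
    by (smt (verit) ln_le_cancel_iff)
  have Lb: "\<bar>L \<sigma>\<bar> \<le> card I * (\<bar>ln a\<bar> + \<bar>ln b\<bar>)" for \<sigma>
  proof -
    have "\<bar>L \<sigma>\<bar> \<le> (\<Sum>i\<in>I. \<bar>ln (g i (\<sigma> i))\<bar>)" unfolding L_def by (rule sum_abs)
    also have "\<dots> \<le> (\<Sum>i\<in>I. \<bar>ln a\<bar> + \<bar>ln b\<bar>)" by (intro sum_mono lnb)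
    finally show ?thesis by simp
  qed
  have mD: "f \<in> borel_measurable (PiM I (\<lambda>i. density M (g i)))" if "f \<in> borel_measurable (PiM I (\<lambda>_. M))" for f :: "_ \<Rightarrow> real"
    using that by (simp add: measurable_cong_sets[OF sts])
  have FiD: "integrable (PiM I (\<lambda>i. density M (g i))) F"
    using FK by (intro DP.integrable_const_bound[where B=K]) (auto intro!: mD)
  have LiD: "integrable (PiM I (\<lambda>i. density M (g i))) L"
    using Lb by (intro DP.integrable_const_bound[where B="card I * (\<bar>ln a\<bar> + \<bar>ln b\<bar>)"]) (auto intro!: mD)
  have lnD: "integrable (density M (g i)) (\<lambda>x. ln (g i x))" for i
  proof -
    interpret D': prob_space "density M (g i)" by (rule prD)
    show ?thesis using lnb by (intro D'.integrable_const_bound[where B="\<bar>ln a\<bar> + \<bar>ln b\<bar>"]) auto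
  qed
  interpret D: product_prob_space "\<lambda>i. density M (g i)" by (rule product_prob_spaceI) (rule prD)
  have comp: "integrable (PiM I (\<lambda>i. density M (g i))) (\<lambda>\<sigma>. ln (g i (\<sigma> i))) \<and>
     (\<integral>\<sigma>. ln (g i (\<sigma> i)) \<partial>PiM I (\<lambda>i. density M (g i))) = (\<integral>x. g i x * ln (g i x) \<partial>M)" if i: "i \<in> I" for i
  proof -
    have d: "distr (PiM I (\<lambda>i. density M (g i))) (density M (g i)) (\<lambda>\<sigma>. \<sigma> i) = density M (g i)"
      using D.PiM_component[OF i] .
    have "integrable (distr (PiM I (\<lambda>i. density M (g i))) (density M (g i)) (\<lambda>\<sigma>. \<sigma> i)) (\<lambda>x. ln (g i x))"
      unfolding d by (rule lnD)
    then have 1: "integrable (PiM I (\<lambda>i. density M (g i))) (\<lambda>\<sigma>. ln (g i (\<sigma> i)))"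
      using i by (subst (asm) integrable_distr_eq) (auto intro!: measurable_component_singleton)
    have "(\<integral>x. ln (g i x) \<partial>distr (PiM I (\<lambda>i. density M (g i))) (density M (g i)) (\<lambda>\<sigma>. \<sigma> i)) = (\<integral>\<sigma>. ln (g i (\<sigma> i)) \<partial>PiM I (\<lambda>i. density M (g i)))"
      using i by (subst integral_distr) (auto intro!: measurable_component_singleton)
    moreover have "(\<integral>x. ln (g i x) \<partial>density M (g i)) = (\<integral>x. g i x * ln (g i x) \<partial>M)"
      using gpos by (subst integral_density) (auto simp: less_imp_le)
    ultimately show ?thesis using 1 unfolding d by simp
  qed
  have "exp (DP.expectation (\<lambda>\<sigma>. F \<sigma> - L \<sigma>)) \<le> DP.expectation (\<lambda>\<sigma>. exp (F \<sigma> - L \<sigma>))"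
  proof (rule DP.jensens_inequality[where I=UNIV])
    show "integrable (PiM I (\<lambda>i. density M (g i))) (\<lambda>\<sigma>. exp (F \<sigma> - L \<sigma>))"
    proof (rule DP.integrable_const_bound[where B="exp (K + card I * (\<bar>ln a\<bar> + \<bar>ln b\<bar>))"])
      show "AE \<sigma> in PiM I (\<lambda>i. density M (g i)). norm (exp (F \<sigma> - L \<sigma>)) \<le> exp (K + card I * (\<bar>ln a\<bar> + \<bar>ln b\<bar>))"
        by (rule AE_I2) (use FK Lb in \<open>smt (verit) exp_le_cancel_iff real_norm_def exp_gt_zero\<close>)
    qed (auto intro!: mD)
  qed (auto intro!: FiD LiD exp_convex)
  \<comment> \<open>The density of the tilted measure is \<open>exp (L \<sigma>)\<close>; it cancels
    \<open>exp (- L \<sigma>)\<close> and leaves the original integral.\<close>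
  also have "DP.expectation (\<lambda>\<sigma>. exp (F \<sigma> - L \<sigma>)) = (\<integral>\<sigma>. (\<Prod>i\<in>I. g i (\<sigma> i)) * exp (F \<sigma> - L \<sigma>) \<partial>PiM I (\<lambda>_. M))"
    unfolding eq by (subst integral_density) (auto intro!: prod_nonneg simp: gpos less_imp_le)
  also have "\<dots> = (\<integral>\<sigma>. exp (F \<sigma>) \<partial>PiM I (\<lambda>_. M))"
    using gpos I by (intro Bochner_Integration.integral_cong) (auto simp: L_def exp_diff exp_sum less_imp_neq[symmetric])
  also have "DP.expectation (\<lambda>\<sigma>. F \<sigma> - L \<sigma>) = DP.expectation F - DP.expectation L"
    using FiD LiD by simp
  also have "DP.expectation L = (\<Sum>i\<in>I. \<integral>x. g i x * ln (g i x) \<partial>M)"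
    unfolding L_def using comp by (subst Bochner_Integration.integral_sum) auto
  finally show ?thesis .
qed

text \<open>Disjoint edges depend on disjoint sets of coordinates, so their factors are independent.
  The induction integrates out the two endpoints of one edge; since the remaining edges live on
  \<open>I - {i, j}\<close>, the index set has to be general in the induction hypothesis.\<close>

lemma (in product_prob_space) nn_integral_PiM_matching:
  fixes u :: "'a \<Rightarrow> 'a \<Rightarrow> ennreal"
  assumes MN: "\<And>i. M i = N" and u[measurable]: "case_prod u \<in> borel_measurable (N \<Otimes>\<^sub>M N)"
  assumes "finite T" "finite I" "T \<subseteq> I \<times> I" "\<And>i j. (i, j) \<in> T \<Longrightarrow> i \<noteq> j"
    "\<And>e f. e \<in> T \<Longrightarrow> f \<in> T \<Longrightarrow> e \<noteq> f \<Longrightarrow> {fst e, snd e} \<inter> {fst f, snd f} = {}"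
  shows "(\<integral>\<^sup>+\<sigma>. (\<Prod>(i, j)\<in>T. u (\<sigma> i) (\<sigma> j)) \<partial>PiM I M) = (\<integral>\<^sup>+z. u (fst z) (snd z) \<partial>(N \<Otimes>\<^sub>M N)) ^ card T"
  using assms(3-)
proof (induction T arbitrary: I rule: finite_induct)
  case empty
  interpret PI: prob_space "PiM I M" by (rule prob_space_PiM) (rule prob_space)
  show ?case by (simp add: PI.emeasure_space_1)
next
  case (insert e T)
  obtain i j where e: "e = (i, j)" by (cases e)
  let ?J = "I - {i, j}"
  have ij: "i \<noteq> j" "i \<in> I" "j \<in> I" using insert.prems(2) insert.prems(3)[of i j] e by auto
  have TJ: "T \<subseteq> ?J \<times> ?J"
  proof
    fix f assume f: "f \<in> T"
    with insert.hyps have "f \<noteq> e" by auto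
    then have "{fst e, snd e} \<inter> {fst f, snd f} = {}" by (intro insert.prems(4)) (use f in simp_all)
    moreover have "f \<in> I \<times> I" using insert.prems(2) f by blast
    ultimately show "f \<in> ?J \<times> ?J" unfolding e by (cases f) simp
  qed
  have IJ: "?J \<union> {i, j} = I" using ij by auto
  have um: "(\<lambda>\<sigma>. u (\<sigma> k) (\<sigma> l)) \<in> borel_measurable (PiM I' M)" if "k \<in> I'" "l \<in> I'" for k l I'
  proof -
    have "(\<lambda>\<sigma>. (\<sigma> k, \<sigma> l)) \<in> PiM I' M \<rightarrow>\<^sub>M N \<Otimes>\<^sub>M N"
      using that MN by (intro measurable_Pair) (metis measurable_component_singleton)+
    from measurable_compose[OF this u] show ?thesis by simp
  qed
  have "(\<integral>\<^sup>+\<sigma>. (\<Prod>(i, j)\<in>insert e T. u (\<sigma> i) (\<sigma> j)) \<partial>PiM I M) = (\<integral>\<^sup>+\<sigma>. u (\<sigma> i) (\<sigma> j) * (\<Prod>(i, j)\<in>T. u (\<sigma> i) (\<sigma> j)) \<partial>PiM (?J \<union> {i, j}) M)"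
    unfolding IJ using insert.hyps by (simp add: e)
  also have "\<dots> = (\<integral>\<^sup>+x. \<integral>\<^sup>+y. u (merge ?J {i, j} (x, y) i) (merge ?J {i, j} (x, y) j) * (\<Prod>(k, l)\<in>T. u (merge ?J {i, j} (x, y) k) (merge ?J {i, j} (x, y) l)) \<partial>PiM {i, j} M \<partial>PiM ?J M)"
  proof (rule product_nn_integral_fold)
    show "(\<lambda>\<sigma>. u (\<sigma> i) (\<sigma> j) * (\<Prod>(i, j)\<in>T. u (\<sigma> i) (\<sigma> j))) \<in> borel_measurable (Pi\<^sub>M (?J \<union> {i, j}) M)"
      unfolding split_beta
      using TJ by (intro borel_measurable_times_ennreal borel_measurable_prod_ennreal um) auto
  qed (use insert.prems in auto)
  also have "\<dots> = (\<integral>\<^sup>+x. \<integral>\<^sup>+y. u (y i) (y j) * (\<Prod>(k, l)\<in>T. u (x k) (x l)) \<partial>PiM {i, j} M \<partial>PiM ?J M)"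
  proof (intro nn_integral_cong arg_cong2[where f="(*)"] prod.cong refl)
    fix x y f assume "f \<in> T"
    with TJ have "f \<in> ?J \<times> ?J" by blast
    then show "(case f of (k, l) \<Rightarrow> u (merge ?J {i, j} (x, y) k) (merge ?J {i, j} (x, y) l)) = (case f of (k, l) \<Rightarrow> u (x k) (x l))"
      by (cases f) (simp add: merge_def)
  qed (auto simp: merge_def)
  also have "\<dots> = (\<integral>\<^sup>+x. (\<integral>\<^sup>+y. u (y i) (y j) \<partial>PiM {i, j} M) * (\<Prod>(k, l)\<in>T. u (x k) (x l)) \<partial>PiM ?J M)"
    by (intro nn_integral_cong nn_integral_multc um) auto
  also have "\<dots> = (\<integral>\<^sup>+y. u (y i) (y j) \<partial>PiM {i, j} M) * (\<integral>\<^sup>+x. (\<Prod>(k, l)\<in>T. u (x k) (x l)) \<partial>PiM ?J M)"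
    unfolding split_beta using TJ by (intro nn_integral_cmult borel_measurable_prod_ennreal um) auto
  also have "(\<integral>\<^sup>+y. u (y i) (y j) \<partial>PiM {i, j} M) = (\<integral>\<^sup>+z. u (fst z) (snd z) \<partial>(N \<Otimes>\<^sub>M N))"
    using product_nn_integral_pair[of u i j] ij MN by simp
  also have "(\<integral>\<^sup>+x. (\<Prod>(k, l)\<in>T. u (x k) (x l)) \<partial>PiM ?J M) = (\<integral>\<^sup>+z. u (fst z) (snd z) \<partial>(N \<Otimes>\<^sub>M N)) ^ card T"
    by (rule insert.IH) (use insert.prems(1,3,4) TJ in \<open>simp_all add: subset_eq\<close>)
  finally show ?case using insert.hyps by simp
qed

section \<open>The annealed partition function\<close>

definition pair_energy :: "(nat \<Rightarrow> real) \<Rightarrow> ('a \<Rightarrow> 'a \<Rightarrow> real) \<Rightarrow> nat \<Rightarrow> (nat \<Rightarrow> 'a) \<Rightarrow> real" where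
  "pair_energy c V N \<sigma> = (\<Sum>(i, j)\<in>vertex_pairs N. c i * c j * V (\<sigma> i) (\<sigma> j))"

lemma vertex_pairs_subset: "vertex_pairs N \<subseteq> {1..N} \<times> {1..N}"
  by (auto simp: vertex_pairs_def)

lemma finite_vertex_pairs [simp]: "finite (vertex_pairs N)"
  by (rule finite_subset[OF vertex_pairs_subset]) simp

text \<open>The full square is the disjoint union of the increasing pairs, their mirror images and
  the diagonal.\<close>

lemma sum_vertex_pairs:
  fixes f :: "nat \<Rightarrow> nat \<Rightarrow> real"
  assumes "\<And>i j. f i j = f j i"
  shows "(\<Sum>(i, j)\<in>vertex_pairs N. f i j) = ((\<Sum>i=1..N. \<Sum>j=1..N. f i j) - (\<Sum>i=1..N. f i i)) / 2"
proof -
  let ?D = "(\<lambda>i. (i, i)) ` {1..N}"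
  let ?R = "prod.swap ` vertex_pairs N"
  have eq: "{1..N} \<times> {1..N} = (vertex_pairs N \<union> ?R) \<union> ?D"
    by (auto simp: vertex_pairs_def image_iff)
  have "(\<Sum>i=1..N. \<Sum>j=1..N. f i j) = (\<Sum>(i, j)\<in>{1..N} \<times> {1..N}. f i j)"
    by (simp add: sum.cartesian_product)
  also have "\<dots> = (\<Sum>(i, j)\<in>vertex_pairs N \<union> ?R. f i j) + (\<Sum>(i, j)\<in>?D. f i j)"
    unfolding eq by (rule sum.union_disjoint) (simp, simp, auto simp: vertex_pairs_def)
  also have "(\<Sum>(i, j)\<in>vertex_pairs N \<union> ?R. f i j) = (\<Sum>(i, j)\<in>vertex_pairs N. f i j) + (\<Sum>(i, j)\<in>?R. f i j)"
    by (rule sum.union_disjoint) (simp, simp, auto simp: vertex_pairs_def)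
  also have "(\<Sum>(i, j)\<in>?R. f i j) = (\<Sum>(i, j)\<in>vertex_pairs N. f i j)"
    by (subst sum.reindex) (auto intro!: sum.cong inj_onI simp: assms)
  also have "(\<Sum>(i, j)\<in>?D. f i j) = (\<Sum>i=1..N. f i i)"
    by (subst sum.reindex) (auto intro!: inj_onI)
  finally show ?thesis by simp
qed

lemma pair_energy_nonneg:
  "(\<And>i. 1 \<le> i \<Longrightarrow> 0 \<le> c i) \<Longrightarrow> (\<And>s s'. 0 \<le> V s s') \<Longrightarrow> 0 \<le> pair_energy c V N \<sigma>"
  unfolding pair_energy_def by (intro sum_nonneg) (auto simp: vertex_pairs_def)

lemma pair_energy_double_sum:
  assumes "\<And>s s'. V s s' = V s' s"
  shows "pair_energy c V N \<sigma> =
    ((\<Sum>i=1..N. \<Sum>j=1..N. c i * c j * V (\<sigma> i) (\<sigma> j)) - (\<Sum>i=1..N. (c i)\<^sup>2 * V (\<sigma> i) (\<sigma> i))) / 2"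
  unfolding pair_energy_def
  by (subst sum_vertex_pairs) (use assms in \<open>auto simp: power2_eq_square mult.commute\<close>)

lemma measurable_pair_component:
  fixes V :: "'a::second_countable_topology \<Rightarrow> 'a \<Rightarrow> 'b::topological_space"
  assumes "sets \<alpha> = sets borel" "case_prod V \<in> borel_measurable borel" "i \<in> I" "j \<in> I"
  shows "(\<lambda>\<sigma>. V (\<sigma> i) (\<sigma> j)) \<in> borel_measurable (PiM I (\<lambda>_. \<alpha>))"
proof -
  have "(\<lambda>\<sigma>. \<sigma> k) \<in> PiM I (\<lambda>_. \<alpha>) \<rightarrow>\<^sub>M borel" if "k \<in> I" for k
    using measurable_component_singleton[OF that, of "\<lambda>_. \<alpha>"] assms(1) by (simp cong: measurable_cong_sets)
  then have "(\<lambda>\<sigma>. (\<sigma> i, \<sigma> j)) \<in> PiM I (\<lambda>_. \<alpha>) \<rightarrow>\<^sub>M borel"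
    using assms by (intro borel_measurable_Pair) auto
  from measurable_compose[OF this assms(2)] show ?thesis by simp
qed

lemma measurable_pair_energy:
  fixes V :: "'a::second_countable_topology \<Rightarrow> 'a \<Rightarrow> real"
  assumes "sets \<alpha> = sets borel" "case_prod V \<in> borel_measurable borel"
  shows "pair_energy c V N \<in> borel_measurable (PiM {1..N} (\<lambda>_. \<alpha>))"
  unfolding pair_energy_def split_beta
  using vertex_pairs_subset[of N]
  by (intro borel_measurable_sum borel_measurable_times borel_measurable_const measurable_pair_component assms) auto

text \<open>For fixed \<sigma> the graph average is an expectation of a product of functions of
  independent Bernoulli variables, one per pair. It can be exchanged with the spin integral because
  all edge configurations lie in the finite set \<open>PiE_dflt\<close>, so that the average is a
  finite sum.\<close>

lemma annealed_partition_eq: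
  fixes \<Phi> :: "'a::second_countable_topology \<Rightarrow> 'a \<Rightarrow> real"
  assumes \<alpha>: "prob_space \<alpha>" "sets \<alpha> = sets borel"
    and \<Phi>: "case_prod \<Phi> \<in> borel_measurable borel" "\<And>s s'. \<bar>\<Phi> s s'\<bar> \<le> K"
    and w: "\<And>i. 1 \<le> i \<Longrightarrow> 0 < w i"
  shows "annealed_partition \<Phi> \<alpha> w N =
    (\<integral>\<sigma>. (\<Prod>(i, j)\<in>vertex_pairs N. 1 + edge_prob w N i j * (exp (\<Phi> (\<sigma> i) (\<sigma> j)) - 1)) \<partial>PiM {1..N} (\<lambda>_. \<alpha>))"
proof -
  interpret PI: prob_space "PiM {1..N} (\<lambda>_. \<alpha>)" by (rule prob_space_PiM) (rule \<alpha>)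
  let ?vp = "vertex_pairs N"
  let ?Q = "Pi_pmf ?vp False (\<lambda>(i, j). bernoulli_pmf (edge_prob w N i j))"
  let ?h = "\<lambda>f \<sigma>. (\<Prod>(i, j)\<in>?vp. if f (i, j) then exp (\<Phi> (\<sigma> i) (\<sigma> j)) else 1)"
  let ?S = "PiE_dflt ?vp False (\<lambda>_. UNIV)"
  have S1: "finite ?S" by (rule finite_PiE_dflt) auto
  have S2: "set_pmf ?Q \<subseteq> ?S"
    using set_Pi_pmf_subset[of ?vp False "\<lambda>(i, j). bernoulli_pmf (edge_prob w N i j)"]
    by (auto simp: PiE_dflt_def)
  note S = S1 S2
  have exp_eq: "exp (\<Sum>(i, j)\<in>{e \<in> ?vp. f e}. \<Phi> (\<sigma> i) (\<sigma> j)) = ?h f \<sigma>" for f \<sigma>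
  proof -
    have "exp (\<Sum>(i, j)\<in>{e \<in> ?vp. f e}. \<Phi> (\<sigma> i) (\<sigma> j)) = (\<Prod>e\<in>{e \<in> ?vp. f e}. exp (\<Phi> (\<sigma> (fst e)) (\<sigma> (snd e))))"
      by (simp add: exp_sum split_beta)
    also have "\<dots> = (\<Prod>e\<in>?vp. if f e then exp (\<Phi> (\<sigma> (fst e)) (\<sigma> (snd e))) else 1)"
      by (rule prod.inter_filter) simp
    finally show ?thesis by (simp add: split_beta)
  qed
  have hm: "?h f \<in> borel_measurable (PiM {1..N} (\<lambda>_. \<alpha>))" for f
    unfolding split_beta
  proof (intro borel_measurable_prod)
    fix e assume "e \<in> ?vp"
    then have "fst e \<in> {1..N}" "snd e \<in> {1..N}" by (auto simp: vertex_pairs_def)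
    then have "(\<lambda>\<sigma>. exp (\<Phi> (\<sigma> (fst e)) (\<sigma> (snd e)))) \<in> borel_measurable (PiM {1..N} (\<lambda>_. \<alpha>))"
      by (intro borel_measurable_exp[THEN measurable_compose[rotated]] measurable_pair_component \<alpha> \<Phi>)
    then show "(\<lambda>\<sigma>. if f (fst e, snd e) then exp (\<Phi> (\<sigma> (fst e)) (\<sigma> (snd e))) else 1) \<in> borel_measurable (PiM {1..N} (\<lambda>_. \<alpha>))"
      by (cases "f (fst e, snd e)") simp_all
  qed
  have hb: "\<bar>?h f \<sigma>\<bar> \<le> exp K ^ card ?vp" for f \<sigma>
  proof -
    have K: "0 \<le> K" using \<Phi>(2)[of undefined undefined] by linarith
    have "\<bar>?h f \<sigma>\<bar> = (\<Prod>e\<in>?vp. \<bar>if f e then exp (\<Phi> (\<sigma> (fst e)) (\<sigma> (snd e))) else 1\<bar>)"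
      by (simp add: abs_prod split_beta)
    also have "\<dots> \<le> (\<Prod>e\<in>?vp. exp K)"
      using \<Phi>(2) K by (intro prod_mono) (auto intro: order_trans[OF abs_ge_self])
    finally show ?thesis by simp
  qed
  have hi: "integrable (PiM {1..N} (\<lambda>_. \<alpha>)) (?h f)" for f
    using hb by (intro PI.integrable_const_bound[where B="exp K ^ card ?vp"] hm AE_I2) auto
  have p01: "edge_prob w N i j \<in> {0..1}" if "(i, j) \<in> ?vp" for i j
  proof -
    have "0 < w i" "0 < w j" using that w by (auto simp: vertex_pairs_def)
    moreover have "0 \<le> (\<Sum>k=1..N. w k)" by (rule sum_nonneg) (use w in \<open>auto simp: less_imp_le\<close>)
    moreover from \<open>0 < w i\<close> \<open>0 < w j\<close> have "0 < w i * w j" by simp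
    ultimately have "0 < (\<Sum>k=1..N. w k) + w i * w j" "0 < w i * w j" by linarith+
    with \<open>0 \<le> (\<Sum>k=1..N. w k)\<close> show ?thesis by (simp add: edge_prob_def)
  qed
  have "annealed_partition \<Phi> \<alpha> w N = measure_pmf.expectation ?Q (\<lambda>f. \<integral>\<sigma>. ?h f \<sigma> \<partial>PiM {1..N} (\<lambda>_. \<alpha>))"
    unfolding annealed_partition_def generalized_random_graph_def by (simp add: exp_eq)
  also have "\<dots> = (\<Sum>f\<in>?S. pmf ?Q f *\<^sub>R (\<integral>\<sigma>. ?h f \<sigma> \<partial>PiM {1..N} (\<lambda>_. \<alpha>)))"
    using S by (intro integral_measure_pmf) auto
  also have "\<dots> = (\<integral>\<sigma>. (\<Sum>f\<in>?S. pmf ?Q f *\<^sub>R ?h f \<sigma>) \<partial>PiM {1..N} (\<lambda>_. \<alpha>))"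
    using hi by (subst Bochner_Integration.integral_sum) auto
  also have "\<dots> = (\<integral>\<sigma>. measure_pmf.expectation ?Q (\<lambda>f. ?h f \<sigma>) \<partial>PiM {1..N} (\<lambda>_. \<alpha>))"
    using S by (intro Bochner_Integration.integral_cong refl integral_measure_pmf[symmetric]) auto
  also have "\<dots> = (\<integral>\<sigma>. (\<Prod>(i, j)\<in>?vp. 1 + edge_prob w N i j * (exp (\<Phi> (\<sigma> i) (\<sigma> j)) - 1)) \<partial>PiM {1..N} (\<lambda>_. \<alpha>))"
  proof (intro Bochner_Integration.integral_cong refl)
    fix \<sigma>
    have "measure_pmf.expectation ?Q (\<lambda>f. ?h f \<sigma>) =
      measure_pmf.expectation ?Q (\<lambda>f. \<Prod>e\<in>?vp. if f e then exp (\<Phi> (\<sigma> (fst e)) (\<sigma> (snd e))) else 1)"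
      by (simp add: split_beta)
    also have "\<dots> = (\<Prod>e\<in>?vp. measure_pmf.expectation ((\<lambda>(i, j). bernoulli_pmf (edge_prob w N i j)) e)
        (\<lambda>x. if x then exp (\<Phi> (\<sigma> (fst e)) (\<sigma> (snd e))) else 1))"
      by (rule expectation_prod_Pi_pmf[where f="\<lambda>e x. if x then exp (\<Phi> (\<sigma> (fst e)) (\<sigma> (snd e))) else 1"])
         (auto intro!: integrable_measure_pmf_finite)
    also have "\<dots> = (\<Prod>e\<in>?vp. 1 + edge_prob w N (fst e) (snd e) * (exp (\<Phi> (\<sigma> (fst e)) (\<sigma> (snd e))) - 1))"
    proof (intro prod.cong refl)
      fix e assume "e \<in> ?vp"
      then have "edge_prob w N (fst e) (snd e) \<in> {0..1}" using p01[of "fst e" "snd e"] by simp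
      then show "measure_pmf.expectation ((\<lambda>(i, j). bernoulli_pmf (edge_prob w N i j)) e)
        (\<lambda>x. if x then exp (\<Phi> (\<sigma> (fst e)) (\<sigma> (snd e))) else 1) = 1 + edge_prob w N (fst e) (snd e) * (exp (\<Phi> (\<sigma> (fst e)) (\<sigma> (snd e))) - 1)"
        by (simp add: split_beta algebra_simps)
    qed
    finally show "measure_pmf.expectation ?Q (\<lambda>f. ?h f \<sigma>) = (\<Prod>(i, j)\<in>?vp. 1 + edge_prob w N i j * (exp (\<Phi> (\<sigma> i) (\<sigma> j)) - 1))"
      by (simp add: split_beta)
  qed
  finally show ?thesis .
qed

text \<open>Put t = p (V - 1). As 1 + t is a convex combination of 1 and V, it is at least exp (-
  K). The elementary bounds on ln give an error of at most t^2 / (1 + t) against t, which accounts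
  for exp (3 K): two factors exp K from t^2 and one from 1 / (1 + t). Replacing p by y costs (y - p)
  |V - 1| with y - p \<le> y^2; the factor 2 collects both errors.\<close>

lemma ln_one_plus_edge_bound:
  fixes y V K :: real
  assumes y: "0 \<le> y" and V: "exp (- K) \<le> V" "V \<le> exp K" and K: "0 \<le> K"
  defines "p \<equiv> y / (1 + y)"
  shows "0 < 1 + p * (V - 1)" "\<bar>ln (1 + p * (V - 1)) - y * (V - 1)\<bar> \<le> 2 * exp (3 * K) * y\<^sup>2"
proof -
  define t where "t = p * (V - 1)"
  have p: "0 \<le> p" "p \<le> y" "p \<le> 1" "y - p \<le> y\<^sup>2"
    using y by (auto simp: p_def field_simps power2_eq_square)
  have e1: "1 \<le> exp K" "exp (- K) \<le> 1" "0 < exp (- K)" using K by auto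
  have "p * (1 - V) \<le> 1 - exp (-K)"
  proof (cases "V \<le> 1")
    case True
    then have "p * (1 - V) \<le> 1 * (1 - V)" using p by (intro mult_right_mono) auto
    then show ?thesis using V by simp
  next
    case False
    then have "p * (1 - V) \<le> 0" using p by (intro mult_nonneg_nonpos) auto
    then show ?thesis using e1 by linarith
  qed
  then have t1: "exp (- K) \<le> 1 + t" by (simp add: t_def algebra_simps)
  with e1 show pos: "0 < 1 + p * (V - 1)" unfolding t_def by linarith
  have V1: "\<bar>V - 1\<bar> \<le> exp K" using V e1 by linarith
  have up: "ln (1 + t) \<le> t" using pos ln_le_minus_one[of "1 + t"] by (simp add: t_def)
  have "ln (inverse (1 + t)) \<le> inverse (1 + t) - 1" using pos by (intro ln_le_minus_one) (simp add: t_def)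
  then have lo: "1 - inverse (1 + t) \<le> ln (1 + t)" using pos by (simp add: t_def ln_inverse)
  have "t - (1 - inverse (1 + t)) = t\<^sup>2 * inverse (1 + t)"
    using pos by (simp add: t_def[symmetric] field_simps power2_eq_square)
  also have "\<dots> \<le> t\<^sup>2 * exp K"
  proof (rule mult_left_mono)
    have "inverse (1 + t) \<le> inverse (exp (- K))" using t1 by (intro le_imp_inverse_le) auto
    then show "inverse (1 + t) \<le> exp K" by (simp add: exp_minus)
  qed simp
  also have "t\<^sup>2 \<le> (y * exp K)\<^sup>2"
  proof -
    have "\<bar>t\<bar> \<le> y * exp K" unfolding t_def abs_mult using p V1 y by (intro mult_mono) auto
    then show ?thesis using abs_le_square_iff[of t "y * exp K"] y by simp
  qed
  also have "(y * exp K)\<^sup>2 * exp K = y\<^sup>2 * exp (3 * K)"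
    by (simp add: power_mult_distrib exp_add[symmetric] power2_eq_square mult.assoc)
  finally have 1: "\<bar>ln (1 + t) - t\<bar> \<le> y\<^sup>2 * exp (3 * K)" using up lo by simp
  have "\<bar>t - y * (V - 1)\<bar> = (y - p) * \<bar>V - 1\<bar>"
  proof -
    have "t - y * (V - 1) = (p - y) * (V - 1)" by (simp add: t_def algebra_simps)
    then show ?thesis using p by (simp add: abs_mult)
  qed
  also have "\<dots> \<le> y\<^sup>2 * exp K" using p V1 by (intro mult_mono) auto
  also have "\<dots> \<le> y\<^sup>2 * exp (3 * K)" using K by (intro mult_left_mono) auto
  finally show "\<bar>ln (1 + p * (V - 1)) - y * (V - 1)\<bar> \<le> 2 * exp (3 * K) * y\<^sup>2"
    using 1 unfolding t_def[symmetric] mult.assoc mult.commute[of "exp (3 * K)"] by linarith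
qed

text \<open>The errors of the single edges add up to a multiple of the sum of the squared y, which
  is at most (q / l)^2. This quotient stays bounded as N grows, so after division by N the error is
  of order 1 / N. The subtracted term is the exact sum of y over the pairs: half of the full double
  sum l, less the diagonal contribution q / l.\<close>

lemma annealed_pressure_approx:
  fixes \<Phi> :: "'a::second_countable_topology \<Rightarrow> 'a \<Rightarrow> real"
  assumes \<alpha>: "prob_space \<alpha>" "sets \<alpha> = sets borel"
    and \<Phi>: "case_prod \<Phi> \<in> borel_measurable borel" "\<And>s s'. \<bar>\<Phi> s s'\<bar> \<le> K"
    and w: "\<And>i. 1 \<le> i \<Longrightarrow> 0 < w i" and N: "1 \<le> N"
  defines "l \<equiv> \<Sum>k=1..N. w k" and "q \<equiv> \<Sum>k=1..N. (w k)\<^sup>2"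
  shows "\<bar>annealed_pressure \<Phi> \<alpha> w N -
      (ln (\<integral>\<sigma>. exp (pair_energy w (\<lambda>s s'. exp (\<Phi> s s')) N \<sigma> / l) \<partial>PiM {1..N} (\<lambda>_. \<alpha>)) / N - (l / 2 - q / (2 * l)) / N)\<bar>
    \<le> 2 * exp (3 * K) * (q / l)\<^sup>2 / N"
proof -
  interpret PI: prob_space "PiM {1..N} (\<lambda>_. \<alpha>)" by (rule prob_space_PiM) (rule \<alpha>)
  let ?vp = "vertex_pairs N"
  define V where "V s s' = exp (\<Phi> s s')" for s s'
  define y where "y i j = w i * w j / l" for i j
  define Z where "Z \<sigma> = (\<Prod>(i, j)\<in>?vp. 1 + edge_prob w N i j * (V (\<sigma> i) (\<sigma> j) - 1))" for \<sigma>
  define R where "R = 2 * exp (3 * K) * (q / l)\<^sup>2"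
  define T where "T = l / 2 - q / (2 * l)"
  define E where "E \<sigma> = pair_energy w V N \<sigma> / l" for \<sigma>
  have K: "0 \<le> K" using \<Phi>(2)[of undefined undefined] by linarith
  have l: "0 < l" unfolding l_def using N w by (intro sum_pos) auto
  have Vb: "exp (- K) \<le> V s s'" "V s s' \<le> exp K" for s s'
    using \<Phi>(2)[of s s'] by (auto simp: V_def)
  have [measurable]: "case_prod V \<in> borel_measurable borel"
    using measurable_compose[OF \<Phi>(1) borel_measurable_exp] by (simp add: V_def split_beta')
  have y0: "0 \<le> y i j" if "(i, j) \<in> ?vp" for i j
    using that w[of i] w[of j] l by (auto simp: y_def vertex_pairs_def)
  have p: "edge_prob w N i j = y i j / (1 + y i j)" if "(i, j) \<in> ?vp" for i j
  proof -
    have "y i j / (1 + y i j) = (w i * w j / l) / ((l + w i * w j) / l)"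
      using l by (simp add: y_def field_simps)
    also have "\<dots> = w i * w j / (l + w i * w j)" using l by simp
    finally show ?thesis by (simp add: edge_prob_def l_def)
  qed
  have y2: "(\<Sum>(i, j)\<in>?vp. (y i j)\<^sup>2) \<le> (q / l)\<^sup>2"
  proof -
    have "(\<Sum>(i, j)\<in>?vp. (y i j)\<^sup>2) \<le> (\<Sum>(i, j)\<in>{1..N} \<times> {1..N}. (y i j)\<^sup>2)"
      using vertex_pairs_subset by (intro sum_mono2) auto
    also have "\<dots> = (\<Sum>i=1..N. \<Sum>j=1..N. (w i)\<^sup>2 * (w j)\<^sup>2 / l\<^sup>2)"
      by (simp add: sum.cartesian_product y_def power_mult_distrib power_divide)
    also have "\<dots> = (q / l)\<^sup>2"
      by (simp add: q_def power_divide power2_eq_square sum_product sum_divide_distrib)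
    finally show ?thesis .
  qed
  have T: "(\<Sum>(i, j)\<in>?vp. y i j) = T"
  proof -
    have "(\<Sum>(i, j)\<in>?vp. y i j) = ((\<Sum>i=1..N. \<Sum>j=1..N. w i * w j / l) - (\<Sum>i=1..N. w i * w i / l)) / 2"
      unfolding y_def by (rule sum_vertex_pairs) (simp add: mult.commute)
    also have "(\<Sum>i=1..N. \<Sum>j=1..N. w i * w j / l) = l"
      using l by (simp add: sum_divide_distrib[symmetric] sum_product[symmetric] l_def)
    also have "(\<Sum>i=1..N. w i * w i / l) = q / l"
      by (simp add: sum_divide_distrib[symmetric] q_def power2_eq_square)
    finally show ?thesis by (simp add: T_def field_simps)
  qed
  have pos: "0 < 1 + edge_prob w N i j * (V s s' - 1)" if "(i, j) \<in> ?vp" for i j s s'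
    using ln_one_plus_edge_bound(1)[OF y0[OF that] Vb K] p[OF that] by simp
  have main: "0 < Z \<sigma>" "\<bar>ln (Z \<sigma>) - (E \<sigma> - T)\<bar> \<le> R" for \<sigma>
  proof -
    show "0 < Z \<sigma>" unfolding Z_def using pos by (intro prod_pos) auto
    have "ln (Z \<sigma>) = (\<Sum>(i, j)\<in>?vp. ln (1 + edge_prob w N i j * (V (\<sigma> i) (\<sigma> j) - 1)))"
      unfolding Z_def
    proof (subst ln_prod)
      show "(case e of (i, j) \<Rightarrow> 1 + edge_prob w N i j * (V (\<sigma> i) (\<sigma> j) - 1)) \<noteq> 0" if "e \<in> ?vp" for e
        using pos[of "fst e" "snd e" "\<sigma> (fst e)" "\<sigma> (snd e)"] that by (simp add: split_beta)
    qed (simp_all add: split_beta)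
    moreover have "E \<sigma> - T = (\<Sum>(i, j)\<in>?vp. y i j * (V (\<sigma> i) (\<sigma> j) - 1))"
      unfolding T[symmetric] by (simp add: E_def pair_energy_def y_def sum_divide_distrib sum_subtractf[symmetric] split_beta algebra_simps diff_divide_distrib)
    ultimately have "ln (Z \<sigma>) - (E \<sigma> - T) = (\<Sum>(i, j)\<in>?vp. ln (1 + edge_prob w N i j * (V (\<sigma> i) (\<sigma> j) - 1)) - y i j * (V (\<sigma> i) (\<sigma> j) - 1))"
      by (simp add: sum_subtractf split_beta)
    also have "\<bar>\<dots>\<bar> \<le> (\<Sum>(i, j)\<in>?vp. 2 * exp (3 * K) * (y i j)\<^sup>2)"
    proof (rule order_trans[OF sum_abs], rule sum_mono, clarify)
      fix i j assume ij: "(i, j) \<in> ?vp"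
      show "\<bar>ln (1 + edge_prob w N i j * (V (\<sigma> i) (\<sigma> j) - 1)) - y i j * (V (\<sigma> i) (\<sigma> j) - 1)\<bar> \<le> 2 * exp (3 * K) * (y i j)\<^sup>2"
        using ln_one_plus_edge_bound(2)[OF y0[OF ij] Vb K] p[OF ij] by simp
    qed
    also have "\<dots> = 2 * exp (3 * K) * (\<Sum>(i, j)\<in>?vp. (y i j)\<^sup>2)"
      by (simp add: sum_distrib_left split_beta)
    also have "\<dots> \<le> R" unfolding R_def by (intro mult_left_mono y2) simp
    finally show "\<bar>ln (Z \<sigma>) - (E \<sigma> - T)\<bar> \<le> R" .
  qed
  have E0: "0 \<le> E \<sigma>" "E \<sigma> \<le> T * exp K" for \<sigma>
  proof -
    show "0 \<le> E \<sigma>" unfolding E_def using l w by (intro divide_nonneg_pos pair_energy_nonneg) (auto simp: V_def less_imp_le)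
    have "E \<sigma> = (\<Sum>(i, j)\<in>?vp. y i j * V (\<sigma> i) (\<sigma> j))"
      by (simp add: E_def pair_energy_def y_def sum_divide_distrib split_beta)
    also have "\<dots> \<le> (\<Sum>(i, j)\<in>?vp. y i j * exp K)"
      using y0 Vb by (intro sum_mono) (auto intro!: mult_left_mono)
    finally show "E \<sigma> \<le> T * exp K" unfolding T[symmetric] by (simp add: sum_distrib_right split_beta)
  qed
  have Em: "E \<in> borel_measurable (PiM {1..N} (\<lambda>_. \<alpha>))"
    unfolding E_def by (intro borel_measurable_divide borel_measurable_const measurable_pair_energy \<alpha>) fact
  have Zm: "Z \<in> borel_measurable (PiM {1..N} (\<lambda>_. \<alpha>))"
    unfolding Z_def split_beta
    using vertex_pairs_subset[of N]
    by (intro borel_measurable_prod borel_measurable_add borel_measurable_times borel_measurable_diff borel_measurable_const measurable_pair_component \<alpha>) auto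
  have iE: "integrable (PiM {1..N} (\<lambda>_. \<alpha>)) (\<lambda>\<sigma>. exp (E \<sigma>))"
    using E0 Em by (intro PI.integrable_const_bound[where B="exp (T * exp K)"]) auto
  have Zb: "exp (- T - R) * exp (E \<sigma>) \<le> Z \<sigma>" "Z \<sigma> \<le> exp (R - T) * exp (E \<sigma>)" for \<sigma>
  proof -
    have "exp (- T - R + E \<sigma>) \<le> exp (ln (Z \<sigma>))" "exp (ln (Z \<sigma>)) \<le> exp (R - T + E \<sigma>)"
      using main(2)[of \<sigma>] by (auto simp: abs_le_iff)
    then show "exp (- T - R) * exp (E \<sigma>) \<le> Z \<sigma>" "Z \<sigma> \<le> exp (R - T) * exp (E \<sigma>)"
      using main(1)[of \<sigma>] by (simp_all add: exp_add)
  qed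
  have iZ: "integrable (PiM {1..N} (\<lambda>_. \<alpha>)) Z"
  proof (rule Bochner_Integration.integrable_bound[of _ "\<lambda>\<sigma>. exp (R - T) * exp (E \<sigma>)"])
    show "AE \<sigma> in PiM {1..N} (\<lambda>_. \<alpha>). norm (Z \<sigma>) \<le> norm (exp (R - T) * exp (E \<sigma>))"
      using Zb(2) main(1) by (intro AE_I2) (simp add: abs_of_pos)
  qed (use iE Zm in auto)
  let ?IE = "\<integral>\<sigma>. exp (E \<sigma>) \<partial>PiM {1..N} (\<lambda>_. \<alpha>)" and ?IZ = "\<integral>\<sigma>. Z \<sigma> \<partial>PiM {1..N} (\<lambda>_. \<alpha>)"
  have "1 \<le> ?IE"
  proof -
    have "(\<integral>\<sigma>. 1 \<partial>PiM {1..N} (\<lambda>_. \<alpha>)) \<le> ?IE" by (intro integral_mono PI.integrable_const iE) (use E0 in simp_all)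
    then show ?thesis by (simp add: PI.prob_space del: One_nat_def)
  qed
  then have IE: "0 < ?IE" by linarith
  have "(\<integral>\<sigma>. exp (- T - R) * exp (E \<sigma>) \<partial>PiM {1..N} (\<lambda>_. \<alpha>)) \<le> ?IZ"
      "?IZ \<le> (\<integral>\<sigma>. exp (R - T) * exp (E \<sigma>) \<partial>PiM {1..N} (\<lambda>_. \<alpha>))"
    by (intro integral_mono integrable_mult_right iE iZ Zb)+
  then have "exp (- T - R) * ?IE \<le> ?IZ" "?IZ \<le> exp (R - T) * ?IE"
    by (simp_all only: integral_mult_right_zero)
  then have "ln (exp (- T - R) * ?IE) \<le> ln ?IZ" "ln ?IZ \<le> ln (exp (R - T) * ?IE)"
    using IE by (smt (verit) exp_gt_zero ln_le_cancel_iff mult_pos_pos)+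
  then have "\<bar>ln ?IZ - (ln ?IE - T)\<bar> \<le> R"
    using IE by (simp add: ln_mult abs_le_iff)
  then have "\<bar>ln ?IZ - (ln ?IE - T)\<bar> / N \<le> R / N" by (intro divide_right_mono) auto
  moreover have "\<bar>ln ?IZ - (ln ?IE - T)\<bar> / N = \<bar>ln ?IZ / N - (ln ?IE / N - T / N)\<bar>"
    using N by (simp add: diff_divide_distrib[symmetric])
  moreover have "annealed_pressure \<Phi> \<alpha> w N = ln ?IZ / N"
    unfolding annealed_pressure_def Z_def V_def using annealed_partition_eq[OF \<alpha> \<Phi> w] by simp
  ultimately show ?thesis unfolding E_def T_def R_def V_def by simp
qed

section \<open>Relative entropy\<close>

text \<open>If the entropy is finite, let D be the density of \<rho> and c the integral of exp g
  under \<alpha>. The bound ln x \<le> x - 1 at x = exp g / (D c), integrated against \<rho>, gives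
  the claim, since exp g / D has \<rho>-integral at most c.\<close>

lemma donsker_varadhan_relative_entropy:
  assumes \<alpha>: "prob_space \<alpha>" and \<rho>: "prob_space \<rho>" and sets: "sets \<rho> = sets \<alpha>"
    and g[measurable]: "g \<in> borel_measurable \<alpha>" and gK: "\<And>x. \<bar>g x\<bar> \<le> (K::real)"
  shows "ennreal ((\<integral>x. g x \<partial>\<rho>) - ln (\<integral>x. exp (g x) \<partial>\<alpha>)) \<le> relative_entropy \<rho> \<alpha>"
proof (cases "absolutely_continuous \<alpha> \<rho> \<and> integrable \<rho> (entropy_density (exp 1) \<alpha> \<rho>)")
  case False
  then have "relative_entropy \<rho> \<alpha> = \<infinity>" unfolding relative_entropy_def by (rule if_not_P)
  then show ?thesis by simp
next
  case True
  interpret A: prob_space \<alpha> by fact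
  interpret R: prob_space \<rho> by fact
  define D where "D x = enn2real (RN_deriv \<alpha> \<rho> x)" for x
  have [measurable]: "D \<in> borel_measurable \<alpha>" unfolding D_def by measurable
  have D0: "0 \<le> D x" for x by (simp add: D_def)
  have "AE x in \<alpha>. RN_deriv \<alpha> \<rho> x \<noteq> \<infinity>"
    using True sets by (intro A.RN_deriv_finite R.sigma_finite_measure_axioms) auto
  then have "AE x in \<alpha>. RN_deriv \<alpha> \<rho> x = ennreal (D x)"
    by eventually_elim (simp add: D_def less_top)
  then have "density \<alpha> (RN_deriv \<alpha> \<rho>) = density \<alpha> (\<lambda>x. ennreal (D x))"
    by (intro density_cong) auto
  then have \<rho>D: "\<rho> = density \<alpha> (\<lambda>x. ennreal (D x))"
    using True sets A.density_RN_deriv[of \<rho>] by simp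
  have mR: "f \<in> borel_measurable \<rho>" if "f \<in> borel_measurable \<alpha>" for f :: "_ \<Rightarrow> real"
    using that sets by (simp cong: measurable_cong_sets)
  have pos: "AE x in \<rho>. 0 < D x"
    by (subst \<rho>D) (auto simp: AE_density)
  have ent: "entropy_density (exp 1) \<alpha> \<rho> = (\<lambda>x. ln (D x))"
    by (auto simp: entropy_density_def D_def log_def)
  have ieg: "integrable \<alpha> (\<lambda>x. exp (g x))"
  proof (rule A.integrable_const_bound[where B="exp K"])
    show "AE x in \<alpha>. norm (exp (g x)) \<le> exp K" using gK by (intro AE_I2) (auto simp: abs_le_iff)
  qed simp
  define c where "c = (\<integral>x. exp (g x) \<partial>\<alpha>)"
  have c: "0 < c"
  proof -
    have "(\<integral>x. exp (- K) \<partial>\<alpha>) \<le> c" unfolding c_def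
    proof (rule integral_mono)
      show "exp (- K) \<le> exp (g x)" for x using gK[of x] by (simp add: abs_le_iff)
    qed (use ieg in auto)
    then show ?thesis by (simp add: A.prob_space less_le_trans[OF exp_gt_zero])
  qed
  have iq': "integrable \<alpha> (\<lambda>x. D x * (exp (g x) / D x))"
    by (rule Bochner_Integration.integrable_bound[OF ieg]) auto
  then have iq: "integrable \<rho> (\<lambda>x. exp (g x) / D x)"
    by (subst \<rho>D, subst integrable_real_density) (auto simp: D0)
  have "(\<integral>x. exp (g x) / D x \<partial>\<rho>) = (\<integral>x. D x * (exp (g x) / D x) \<partial>\<alpha>)"
    by (subst \<rho>D, subst integral_real_density) (auto simp: D0)
  \<comment> \<open>Only an inequality: where \<open>D\<close> vanishes the integrand is 0 instead
    of \<open>exp (g x)\<close>.\<close>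
  also have "\<dots> \<le> c" unfolding c_def by (rule integral_mono[OF iq' ieg]) auto
  finally have q: "(\<integral>x. exp (g x) / D x \<partial>\<rho>) \<le> c" .
  have ig: "integrable \<rho> g" using gK by (intro R.integrable_const_bound[where B=K] mR) auto
  have il: "integrable \<rho> (\<lambda>x. ln (D x))" using True by (simp add: ent)
  have "(\<integral>x. g x - ln (D x) \<partial>\<rho>) \<le> (\<integral>x. (exp (g x) / D x) / c - 1 + ln c \<partial>\<rho>)"
  proof (rule integral_mono_AE)
    show "AE x in \<rho>. g x - ln (D x) \<le> (exp (g x) / D x) / c - 1 + ln c"
      using pos
    proof eventually_elim
      case (elim x)
      have "ln ((exp (g x) / D x) / c) \<le> (exp (g x) / D x) / c - 1"
        using elim c by (intro ln_le_minus_one) auto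
      then show ?case using elim c by (simp add: ln_div ln_mult)
    qed
  qed (intro Bochner_Integration.integrable_add Bochner_Integration.integrable_diff integrable_divide_zero R.integrable_const ig il iq)+
  also have "\<dots> = (\<integral>x. (exp (g x) / D x) / c \<partial>\<rho>) - 1 + ln c"
    using integrable_divide_zero[of c, OF iq] by (simp add: R.prob_space)
  also have "(\<integral>x. (exp (g x) / D x) / c \<partial>\<rho>) = (\<integral>x. exp (g x) / D x \<partial>\<rho>) / c"
    by (rule integral_divide_zero)
  also have "(\<integral>x. exp (g x) / D x \<partial>\<rho>) / c - 1 + ln c \<le> ln c" using q c by simp
  finally have "(\<integral>x. g x \<partial>\<rho>) - ln c \<le> (\<integral>x. ln (D x) \<partial>\<rho>)" using ig il by simp
  then show ?thesis
    using True by (auto simp: relative_entropy_def KL_divergence_def ent c_def intro!: ennreal_leI)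
qed

section \<open>Discretization of the weights\<close>

lemma cdf_empirical_weight_law:
  "1 \<le> N \<Longrightarrow> cdf (empirical_weight_law w N) x = card {i \<in> {1..N}. w i \<le> x} / N"
  unfolding cdf_def empirical_weight_law_def
  by (subst measure_distr) (auto simp: measure_pmf_of_set Int_def vimage_def)

text \<open>The class \<open>b x\<close> of a weight \<open>x\<close> is the index of the cell of a grid of continuity points of the limiting
  distribution function; \<open>c\<close> is the left end of the cell, and \<open>0\<close> for the unbounded last cell.\<close>

lemma weight_discretization:
  fixes w :: "nat \<Rightarrow> real"
  assumes P: "real_distribution P" and pos: "AE x in P. 0 < x"
    and conv: "weak_conv_m (empirical_weight_law w) P" and \<delta>: "0 < \<delta>"
  obtains B :: nat and b :: "real \<Rightarrow> nat" and c :: "nat \<Rightarrow> real" where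
    "b \<in> borel \<rightarrow>\<^sub>M count_space UNIV" "\<And>x. b x \<le> B" "\<And>k. 0 \<le> c k"
    "\<And>x. 0 < x \<Longrightarrow> c (b x) \<le> x" "\<And>x. 0 < x \<Longrightarrow> x - c (b x) \<le> \<delta> * (1 + x\<^sup>2)"
    "\<And>k. (\<lambda>N. card {i \<in> {1..N}. b (w i) = k} / N) \<longlonglongrightarrow> measure P {x. b x = k}"
proof -
  interpret P: real_distribution P by fact
  have "mono (cdf P)" by (auto intro!: monoI P.cdf_nondecreasing)
  then have cd: "countable {x. \<not> isCont (cdf P) x}" by (rule mono_ctble_discont)
  \<comment> \<open>A monotone function has only countably many discontinuities, so each interval of
    length \<delta> / 2 contains a continuity point, and consecutive points are less than \<delta>
    apart.\<close>
  have "\<exists>t. real k * \<delta> / 2 < t \<and> t < real (Suc k) * \<delta> / 2 \<and> isCont (cdf P) t" for k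
  proof -
    have "uncountable {real k * \<delta> / 2<..<real (Suc k) * \<delta> / 2}"
      using \<delta> by (subst uncountable_open_interval) (simp add: field_simps)
    then have "\<not> {real k * \<delta> / 2<..<real (Suc k) * \<delta> / 2} \<subseteq> {x. \<not> isCont (cdf P) x}"
      using cd countable_subset by blast
    then show ?thesis by auto
  qed
  then obtain s where s: "\<And>k. real k * \<delta> / 2 < s k \<and> s k < real (Suc k) * \<delta> / 2 \<and> isCont (cdf P) (s k)"
    by metis
  \<comment> \<open>The value at index 0 is reset to 0 so that every positive weight lies above the
    left end of its cell. Continuity is used at the points \<open>t (Suc k)\<close> only.\<close>
  define t where "t k = (if k = 0 then 0 else s k)" for k
  \<comment> \<open>The last cell begins beyond 1 / \<delta>. There x \<le> \<delta> x^2, so that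
    even the class value 0 respects the error bound.\<close>
  obtain B where B: "real B * \<delta> / 2 \<ge> 1 / \<delta>" "0 < B"
  proof -
    obtain B where "real B \<ge> 2 / \<delta>\<^sup>2" using real_arch_simple by blast
    moreover have "0 < 2 / \<delta>\<^sup>2" using \<delta> by simp
    ultimately have "real B * \<delta> / 2 \<ge> 1 / \<delta>" "0 < B"
      using \<delta> by (auto simp: field_simps power2_eq_square intro: Nat.gr0I)
    then show ?thesis by (rule that)
  qed
  have tlo: "real k * \<delta> / 2 \<le> t k" and thi: "t k \<le> real (Suc k) * \<delta> / 2" for k
    using s[of k] \<delta> by (auto simp: t_def less_imp_le)
  have tmono: "t k \<le> t l" if "k \<le> l" for k l
  proof (cases "k = l")
    case False
    then have "real (Suc k) \<le> real l" using that by simp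
    then have "real (Suc k) * \<delta> / 2 \<le> real l * \<delta> / 2" using \<delta> by simp
    then show ?thesis using thi[of k] tlo[of l] by linarith
  qed simp
  define b where "b x = (LEAST k. k = B \<or> x \<le> t (Suc k))" for x
  define c where "c k = (if k < B then t k else 0)" for k
  have bm: "b \<in> borel \<rightarrow>\<^sub>M count_space UNIV"
    unfolding b_def by (rule measurable_Least) simp
  have bB: "b x \<le> B" for x unfolding b_def by (rule Least_le) simp
  have ble: "b x \<le> k \<longleftrightarrow> x \<le> t (Suc k)" if "k < B" for x k
  proof
    assume k: "b x \<le> k"
    have "b x = B \<or> x \<le> t (Suc (b x))" unfolding b_def by (rule LeastI[where k=B]) simp
    then show "x \<le> t (Suc k)" using k that tmono[of "Suc (b x)" "Suc k"] by auto
  next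
    assume "x \<le> t (Suc k)" then show "b x \<le> k" unfolding b_def by (intro Least_le) simp
  qed
  have tb: "t (b x) < x" if "0 < x" for x
  proof (cases "b x")
    case (Suc k)
    then have "k < B" using bB[of x] by simp
    then show ?thesis using ble[of k x] Suc by simp
  qed (use that in \<open>simp add: t_def\<close>)
  \<comment> \<open>The frequency of an initial union of classes is a value of the empirical
    distribution function at a continuity point; single classes follow by subtraction.\<close>
  have cum: "(\<lambda>N. card {i \<in> {1..N}. b (w i) \<le> k} / N) \<longlonglongrightarrow> measure P {x. b x \<le> k}" for k
  proof (cases "k < B")
    case True
    have "isCont (cdf P) (t (Suc k))" using s by (simp add: t_def)
    then have "(\<lambda>N. cdf (empirical_weight_law w N) (t (Suc k))) \<longlonglongrightarrow> cdf P (t (Suc k))"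
      using conv by (simp add: weak_conv_m_def weak_conv_def)
    moreover have "\<forall>\<^sub>F N in sequentially. cdf (empirical_weight_law w N) (t (Suc k)) = card {i \<in> {1..N}. b (w i) \<le> k} / N"
      using eventually_ge_at_top[of "1::nat"] by eventually_elim (simp add: cdf_empirical_weight_law ble[OF True])
    ultimately have "(\<lambda>N. card {i \<in> {1..N}. b (w i) \<le> k} / N) \<longlonglongrightarrow> cdf P (t (Suc k))"
      by (rule Lim_transform_eventually)
    then show ?thesis by (simp add: cdf_def ble[OF True] atMost_def)
  next
    case False
    then have le: "b x \<le> k" for x using bB[of x] by linarith
    have "(\<lambda>N. 1::real) \<longlonglongrightarrow> 1" by simp
    moreover have "\<forall>\<^sub>F N in sequentially. 1 = card {i \<in> {1..N}. b (w i) \<le> k} / N"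
      using eventually_ge_at_top[of "1::nat"]
    proof eventually_elim
      case (elim N)
      have "{i \<in> {1..N}. b (w i) \<le> k} = {1..N}" using le by auto
      then show ?case using elim by simp
    qed
    ultimately have "(\<lambda>N. card {i \<in> {1..N}. b (w i) \<le> k} / N) \<longlonglongrightarrow> 1"
      by (rule Lim_transform_eventually)
    then show ?thesis using P.prob_space by (simp add: le)
  qed
  have freq: "(\<lambda>N. card {i \<in> {1..N}. b (w i) = k} / N) \<longlonglongrightarrow> measure P {x. b x = k}" for k
  proof (cases k)
    case 0
    then show ?thesis using cum[of 0] by simp
  next
    case (Suc j)
    have ms: "{x. b x \<le> i} \<in> sets P" for i
      using measurable_sets[OF bm, of "{..i}"] by (simp add: vimage_def)
    have "card {i \<in> {1..N}. b (w i) = k} = card {i \<in> {1..N}. b (w i) \<le> k} - card {i \<in> {1..N}. b (w i) \<le> j}"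
      and "card {i \<in> {1..N}. b (w i) \<le> j} \<le> card {i \<in> {1..N}. b (w i) \<le> k}" for N
    proof -
      have eq: "{i \<in> {1..N}. b (w i) = k} = {i \<in> {1..N}. b (w i) \<le> k} - {i \<in> {1..N}. b (w i) \<le> j}"
        using Suc by auto
      show "card {i \<in> {1..N}. b (w i) = k} = card {i \<in> {1..N}. b (w i) \<le> k} - card {i \<in> {1..N}. b (w i) \<le> j}"
        unfolding eq by (rule card_Diff_subset) (use Suc in auto)
      show "card {i \<in> {1..N}. b (w i) \<le> j} \<le> card {i \<in> {1..N}. b (w i) \<le> k}"
        using Suc by (intro card_mono) auto
    qed
    then have "real (card {i \<in> {1..N}. b (w i) = k}) / N = card {i \<in> {1..N}. b (w i) \<le> k} / N - card {i \<in> {1..N}. b (w i) \<le> j} / N" for N :: nat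
      by (simp add: of_nat_diff diff_divide_distrib)
    moreover have "measure P {x. b x = k} = measure P {x. b x \<le> k} - measure P {x. b x \<le> j}"
    proof -
      have eq: "{x. b x = k} = {x. b x \<le> k} - {x. b x \<le> j}" using Suc by auto
      show ?thesis unfolding eq by (rule P.finite_measure_Diff) (use Suc ms in auto)
    qed
    ultimately show ?thesis using tendsto_diff[OF cum[of k] cum[of j]] by simp
  qed
  show ?thesis
  proof (rule that[of b B c])
    show "0 \<le> c k" for k using tmono[of 0 k] by (simp add: c_def t_def)
    fix x :: real assume x: "0 < x"
    show "c (b x) \<le> x" using tb[OF x] x by (simp add: c_def)
    show "x - c (b x) \<le> \<delta> * (1 + x\<^sup>2)"
    proof (cases "b x < B")
      case True
      then have "x \<le> t (Suc (b x))" using ble[of "b x" x] by simp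
      moreover have "t (Suc (b x)) \<le> t (b x) + \<delta>"
        using thi[of "Suc (b x)"] tlo[of "b x"] by (simp add: field_simps)
      moreover have "0 \<le> \<delta> * x\<^sup>2" using \<delta> by simp
      ultimately show ?thesis using True by (simp add: c_def algebra_simps)
    next
      case False
      then have "b x = B" using bB[of x] by simp
      then have "1 / \<delta> \<le> x" using tb[OF x] tlo[of B] B(1) by simp
      then have "1 \<le> \<delta> * x" using \<delta> by (simp add: field_simps)
      then have "x * 1 \<le> x * (\<delta> * x)" using x by (intro mult_left_mono) auto
      then show ?thesis using False \<delta> by (simp add: c_def power2_eq_square algebra_simps)
    qed
  qed (fact bm bB freq)+
qed

section \<open>Approximation of the interaction by cell averages\<close>

text \<open>The factor 1 / N is exactly the weight of one residue class in Jensen's inequality, so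
  each matching enters with its full sum \<open>S r\<close>. Because f \<ge> 0, the integral for a
  single pair is at least 1, and the crude bound N on the number of edges of a matching is good
  enough.\<close>

lemma nn_integral_exp_pair_sum_le:
  fixes f :: "'a \<Rightarrow> 'a \<Rightarrow> real"
  assumes \<alpha>: "prob_space \<alpha>" and f[measurable]: "case_prod f \<in> borel_measurable (\<alpha> \<Otimes>\<^sub>M \<alpha>)"
    and f0: "\<And>x y. 0 \<le> f x y" and N: "1 \<le> N"
  shows "(\<integral>\<^sup>+\<sigma>. ennreal (exp ((\<Sum>(i, j)\<in>vertex_pairs N. f (\<sigma> i) (\<sigma> j)) / N)) \<partial>PiM {1..N} (\<lambda>_. \<alpha>))
    \<le> (\<integral>\<^sup>+z. ennreal (exp (f (fst z) (snd z))) \<partial>(\<alpha> \<Otimes>\<^sub>M \<alpha>)) ^ N"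
proof -
  interpret A: prob_space \<alpha> by fact
  interpret AA: pair_prob_space \<alpha> \<alpha> ..
  interpret PP: product_prob_space "\<lambda>_::nat. \<alpha>" "{1..N}" by (rule product_prob_spaceI) (rule \<alpha>)
  define T where "T r = {(i, j) \<in> vertex_pairs N. (i + j) mod N = r}" for r
  define S where "S r \<sigma> = (\<Sum>(i, j)\<in>T r. f (\<sigma> i) (\<sigma> j))" for r and \<sigma> :: "nat \<Rightarrow> 'a"
  let ?e = "\<integral>\<^sup>+z. ennreal (exp (f (fst z) (snd z))) \<partial>(\<alpha> \<Otimes>\<^sub>M \<alpha>)"
  have vp: "vertex_pairs N \<subseteq> {1..N} \<times> {1..N}" by (auto simp: vertex_pairs_def)
  then have fvp: "finite (vertex_pairs N)" by (rule finite_subset) simp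
  have Tsub: "T r \<subseteq> vertex_pairs N" for r by (auto simp: T_def)
  then have fT: "finite (T r)" for r using fvp finite_subset by blast
  have um: "(\<lambda>\<sigma>. f (\<sigma> i) (\<sigma> j)) \<in> borel_measurable (PiM {1..N} (\<lambda>_. \<alpha>))" if "(i, j) \<in> vertex_pairs N" for i j
  proof -
    have "(\<lambda>\<sigma>. (\<sigma> i, \<sigma> j)) \<in> PiM {1..N} (\<lambda>_. \<alpha>) \<rightarrow>\<^sub>M \<alpha> \<Otimes>\<^sub>M \<alpha>"
      using that by (intro measurable_Pair measurable_component_singleton) (auto simp: vertex_pairs_def)
    from measurable_compose[OF this f] show ?thesis by simp
  qed
  have Sm: "S r \<in> borel_measurable (PiM {1..N} (\<lambda>_. \<alpha>))" for r
    unfolding S_def split_beta using Tsub[of r] by (intro borel_measurable_sum um) auto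
  \<comment> \<open>One endpoint and the residue determine the other endpoint in
    \<open>{1..N}\<close>; this is what makes a residue class a matching.\<close>
  have inj: "j = j'" if "(i + j) mod N = (i + j') mod N" "j \<in> {1..N}" "j' \<in> {1..N}" for i j j' :: nat
  proof -
    have *: "k = l" if "(i + k) mod N = (i + l) mod N" "k \<in> {1..N}" "l \<in> {1..N}" "l \<le> k" for k l
    proof -
      have "N dvd (i + k) - (i + l)" using that mod_eq_dvd_iff_nat[of "i + l" "i + k" N] by simp
      then have "N dvd k - l" by simp
      moreover have "k - l < N" using that by auto
      ultimately have "k - l = 0" using nat_dvd_not_less by blast
      then show ?thesis using that by simp
    qed
    show ?thesis
    proof (cases "j \<le> j'")
      case True
      then show ?thesis using *[of j' j] that by simp
    next
      case False
      then show ?thesis using *[of j j'] that by simp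
    qed
  qed
  have matching: "{fst e, snd e} \<inter> {fst g, snd g} = {}" if "e \<in> T r" "g \<in> T r" "e \<noteq> g" for e g :: "nat \<times> nat" and r
  proof (rule ccontr)
    obtain i j k l where eg: "e = (i, j)" "g = (k, l)" by (cases e, cases g)
    have v: "1 \<le> i" "i < j" "j \<le> N" "1 \<le> k" "k < l" "l \<le> N" "(i + j) mod N = (k + l) mod N"
      using that by (auto simp: T_def eg vertex_pairs_def)
    assume "\<not> ?thesis"
    then have "i = k \<or> i = l \<or> j = k \<or> j = l" by (auto simp: eg)
    then show False
    proof (elim disjE)
      assume "i = k" then have "j = l" using inj[of i j l] v by simp
      with \<open>i = k\<close> that(3) eg show False by simp
    next
      assume "i = l" then have "j = k" using inj[of i j k] v by (simp add: add.commute)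
      with \<open>i = l\<close> v show False by simp
    next
      assume "j = k" then have "i = l" using inj[of j i l] v by (simp add: add.commute)
      with \<open>j = k\<close> v show False by simp
    next
      assume "j = l" then have "i = k" using inj[of j i k] v by (simp add: add.commute)
      with \<open>j = l\<close> that(3) eg show False by simp
    qed
  qed
  have card: "card (T r) \<le> N" for r
  proof -
    have "inj_on fst (T r)"
    proof (rule inj_onI, rule ccontr)
      fix e g assume *: "e \<in> T r" "g \<in> T r" "fst e = fst g" "e \<noteq> g"
      from matching[OF this(1,2,4)] this(3) show False by simp
    qed
    then have "card (T r) = card (fst ` T r)" by (simp add: card_image)
    also have "\<dots> \<le> card {1..N}" using Tsub[of r] vp by (intro card_mono) auto
    finally show ?thesis by simp
  qed
  have split: "(\<Sum>(i, j)\<in>vertex_pairs N. f (\<sigma> i) (\<sigma> j)) = (\<Sum>r<N. S r \<sigma>)" for \<sigma>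
  proof -
    have "vertex_pairs N = (\<Union>r\<in>{..<N}. T r)" using N by (auto simp: T_def)
    moreover have "(\<Sum>(i, j)\<in>(\<Union>r\<in>{..<N}. T r). f (\<sigma> i) (\<sigma> j)) = (\<Sum>r<N. \<Sum>(i, j)\<in>T r. f (\<sigma> i) (\<sigma> j))"
      using fT by (intro sum.UNION_disjoint) (auto simp: T_def)
    ultimately show ?thesis by (simp add: S_def)
  qed
  have e1: "1 \<le> ?e"
  proof -
    have "(\<integral>\<^sup>+z. 1 \<partial>(\<alpha> \<Otimes>\<^sub>M \<alpha>)) \<le> ?e" by (intro nn_integral_mono) (simp add: f0 ennreal_leI flip: ennreal_1)
    then show ?thesis by (simp add: AA.emeasure_space_1)
  qed
  have each: "(\<integral>\<^sup>+\<sigma>. ennreal (exp (S r \<sigma>)) \<partial>PiM {1..N} (\<lambda>_. \<alpha>)) \<le> ?e ^ N" for r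
  proof -
    have "(\<integral>\<^sup>+\<sigma>. ennreal (exp (S r \<sigma>)) \<partial>PiM {1..N} (\<lambda>_. \<alpha>)) =
      (\<integral>\<^sup>+\<sigma>. (\<Prod>(i, j)\<in>T r. ennreal (exp (f (\<sigma> i) (\<sigma> j)))) \<partial>PiM {1..N} (\<lambda>_. \<alpha>))"
      by (intro nn_integral_cong) (simp add: S_def exp_sum fT split_beta prod_ennreal)
    also have "\<dots> = ?e ^ card (T r)"
    proof (rule PP.nn_integral_PiM_matching)
      show "(\<lambda>(x, y). ennreal (exp (f x y))) \<in> borel_measurable (\<alpha> \<Otimes>\<^sub>M \<alpha>)" by measurable
      show "T r \<subseteq> {1..N} \<times> {1..N}" using Tsub vp by blast
      show "i \<noteq> j" if "(i, j) \<in> T r" for i j using that by (auto simp: T_def vertex_pairs_def)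
    qed (use fT matching in auto)
    also have "\<dots> \<le> ?e ^ N" using e1 card by (rule power_increasing[rotated])
    finally show ?thesis .
  qed
  have "(\<integral>\<^sup>+\<sigma>. ennreal (exp ((\<Sum>(i, j)\<in>vertex_pairs N. f (\<sigma> i) (\<sigma> j)) / N)) \<partial>PiM {1..N} (\<lambda>_. \<alpha>))
     \<le> (\<integral>\<^sup>+\<sigma>. (\<Sum>r<N. ennreal (1 / N) * ennreal (exp (S r \<sigma>))) \<partial>PiM {1..N} (\<lambda>_. \<alpha>))"
  proof (rule nn_integral_mono)
    fix \<sigma>
    have "exp (\<Sum>r<N. (1 / N) *\<^sub>R S r \<sigma>) \<le> (\<Sum>r<N. (1 / N) * exp (S r \<sigma>))"
      using N by (intro convex_on_sum[OF _ _ exp_convex]) (auto simp: lessThan_empty_iff)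
    then show "ennreal (exp ((\<Sum>(i, j)\<in>vertex_pairs N. f (\<sigma> i) (\<sigma> j)) / N)) \<le> (\<Sum>r<N. ennreal (1 / N) * ennreal (exp (S r \<sigma>)))"
      by (simp add: split sum_divide_distrib ennreal_mult'[symmetric] sum_ennreal ennreal_leI)
  qed
  also have "\<dots> = (\<Sum>r<N. ennreal (1 / N) * (\<integral>\<^sup>+\<sigma>. ennreal (exp (S r \<sigma>)) \<partial>PiM {1..N} (\<lambda>_. \<alpha>)))"
    using Sm by (subst nn_integral_sum) (auto simp: nn_integral_cmult)
  also have "\<dots> \<le> (\<Sum>r<N. ennreal (1 / N) * ?e ^ N)"
    by (intro sum_mono mult_left_mono each) auto
  also have "\<dots> = (\<Sum>r<N. ennreal (1 / N)) * ?e ^ N" by (rule sum_distrib_right[symmetric])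
  also have "(\<Sum>r<N. ennreal (1 / N)) = 1" using N by (subst sum_ennreal) auto
  finally show ?thesis by simp
qed

section \<open>Density of step kernels over finite partitions in L1 of the product measure\<close>

definition step_approximable :: "'a measure \<Rightarrow> ('a \<times> 'a \<Rightarrow> real) \<Rightarrow> bool" where
  "step_approximable M f \<longleftrightarrow> (\<forall>\<epsilon>>0. \<exists>(p :: 'a \<Rightarrow> nat) G. p \<in> M \<rightarrow>\<^sub>M count_space UNIV \<and> finite (range p) \<and>
     (\<integral>\<^sup>+z. ennreal \<bar>f z - G (p (fst z)) (p (snd z))\<bar> \<partial>(M \<Otimes>\<^sub>M M)) \<le> ennreal \<epsilon>)"

lemma measurable_step:
  fixes G :: "nat \<Rightarrow> nat \<Rightarrow> real"
  assumes [measurable]: "p \<in> M \<rightarrow>\<^sub>M count_space UNIV"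
  shows "(\<lambda>z. G (p (fst z)) (p (snd z))) \<in> borel_measurable (M \<Otimes>\<^sub>M M)"
  by measurable

text \<open>Closedness under limits in L1. It also serves to exchange a kernel for one that agrees
  with it on the space of the measure only.\<close>

lemma step_approximable_trans:
  assumes "f \<in> borel_measurable (M \<Otimes>\<^sub>M M)"
    and "\<And>\<epsilon>. 0 < \<epsilon> \<Longrightarrow> \<exists>g. g \<in> borel_measurable (M \<Otimes>\<^sub>M M) \<and> step_approximable M g \<and> (\<integral>\<^sup>+z. ennreal \<bar>f z - g z\<bar> \<partial>(M \<Otimes>\<^sub>M M)) \<le> ennreal \<epsilon>"
  shows "step_approximable M f"
  unfolding step_approximable_def
proof (intro allI impI)
  fix \<epsilon> :: real assume "0 < \<epsilon>"
  then have e: "0 < \<epsilon> / 2" by simp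
  obtain g where g: "g \<in> borel_measurable (M \<Otimes>\<^sub>M M)" "step_approximable M g" "(\<integral>\<^sup>+z. ennreal \<bar>f z - g z\<bar> \<partial>(M \<Otimes>\<^sub>M M)) \<le> ennreal (\<epsilon> / 2)"
    using assms(2)[OF e] by blast
  then obtain p :: "'a \<Rightarrow> nat" and G where p[measurable]: "p \<in> M \<rightarrow>\<^sub>M count_space UNIV" and fin: "finite (range p)"
    and G: "(\<integral>\<^sup>+z. ennreal \<bar>g z - G (p (fst z)) (p (snd z))\<bar> \<partial>(M \<Otimes>\<^sub>M M)) \<le> ennreal (\<epsilon> / 2)"
    using e unfolding step_approximable_def by blast
  note [measurable] = assms(1) g(1) measurable_step[OF p, of G]
  have "(\<integral>\<^sup>+z. ennreal \<bar>f z - G (p (fst z)) (p (snd z))\<bar> \<partial>(M \<Otimes>\<^sub>M M))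
    \<le> (\<integral>\<^sup>+z. ennreal \<bar>f z - g z\<bar> + ennreal \<bar>g z - G (p (fst z)) (p (snd z))\<bar> \<partial>(M \<Otimes>\<^sub>M M))"
    by (intro nn_integral_mono) (simp flip: ennreal_plus add: ennreal_leI)
  also have "\<dots> = (\<integral>\<^sup>+z. ennreal \<bar>f z - g z\<bar> \<partial>(M \<Otimes>\<^sub>M M)) + (\<integral>\<^sup>+z. ennreal \<bar>g z - G (p (fst z)) (p (snd z))\<bar> \<partial>(M \<Otimes>\<^sub>M M))"
    by (rule nn_integral_add) measurable
  also have "\<dots> \<le> ennreal (\<epsilon> / 2) + ennreal (\<epsilon> / 2)" by (intro add_mono g(3) G)
  also have "\<dots> = ennreal \<epsilon>" using \<open>0 < \<epsilon>\<close> by (simp flip: ennreal_plus)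
  finally show "\<exists>(p :: 'a \<Rightarrow> nat) G. p \<in> M \<rightarrow>\<^sub>M count_space UNIV \<and> finite (range p) \<and>
     (\<integral>\<^sup>+z. ennreal \<bar>f z - G (p (fst z)) (p (snd z))\<bar> \<partial>(M \<Otimes>\<^sub>M M)) \<le> ennreal \<epsilon>"
    using p fin by blast
qed

lemma step_approximable_step:
  assumes "p \<in> M \<rightarrow>\<^sub>M count_space UNIV" "finite (range p)" "\<And>z. f z = G (p (fst z)) ((p :: 'a \<Rightarrow> nat) (snd z))"
  shows "step_approximable M f"
  unfolding step_approximable_def using assms by (intro allI impI exI[of _ p] exI[of _ G]) auto

text \<open>The pair of labels, coded as one number, labels the common refinement of the two
  partitions, and both step kernels are step kernels for it. The summand 1 in \<open>c\<close> keeps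
  the tolerance well defined when both coefficients vanish.\<close>

lemma step_approximable_add:
  assumes fm: "f \<in> borel_measurable (M \<Otimes>\<^sub>M M)" "g \<in> borel_measurable (M \<Otimes>\<^sub>M M)"
    and "step_approximable M f" "step_approximable M g"
  shows "step_approximable M (\<lambda>z. a * f z + b * g z)"
  unfolding step_approximable_def
proof (intro allI impI)
  fix \<epsilon> :: real assume e: "0 < \<epsilon>"
  define c where "c = 1 + \<bar>a\<bar> + \<bar>b\<bar>"
  have c: "0 < c" by (simp add: c_def add_pos_nonneg)
  then have e': "0 < \<epsilon> / c" using e by simp
  obtain p :: "'a \<Rightarrow> nat" and G where p[measurable]: "p \<in> M \<rightarrow>\<^sub>M count_space UNIV" and finp: "finite (range p)"
    and G: "(\<integral>\<^sup>+z. ennreal \<bar>f z - G (p (fst z)) (p (snd z))\<bar> \<partial>(M \<Otimes>\<^sub>M M)) \<le> ennreal (\<epsilon> / c)"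
    using assms(3) e' unfolding step_approximable_def by blast
  obtain q :: "'a \<Rightarrow> nat" and H where q[measurable]: "q \<in> M \<rightarrow>\<^sub>M count_space UNIV" and finq: "finite (range q)"
    and H: "(\<integral>\<^sup>+z. ennreal \<bar>g z - H (q (fst z)) (q (snd z))\<bar> \<partial>(M \<Otimes>\<^sub>M M)) \<le> ennreal (\<epsilon> / c)"
    using assms(4) e' unfolding step_approximable_def by blast
  note [measurable] = fm measurable_step[OF p, of G] measurable_step[OF q, of H]
  let ?r = "\<lambda>x. prod_encode (p x, q x)"
  let ?K = "\<lambda>k l. a * G (fst (prod_decode k)) (fst (prod_decode l)) + b * H (snd (prod_decode k)) (snd (prod_decode l))"
  have rm: "?r \<in> M \<rightarrow>\<^sub>M count_space UNIV" by measurable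
  have rf: "finite (range ?r)"
    by (rule finite_subset[of _ "prod_encode ` (range p \<times> range q)"]) (use finp finq in auto)
  have "(\<integral>\<^sup>+z. ennreal \<bar>a * f z + b * g z - ?K (?r (fst z)) (?r (snd z))\<bar> \<partial>(M \<Otimes>\<^sub>M M))
    \<le> (\<integral>\<^sup>+z. ennreal \<bar>a\<bar> * ennreal \<bar>f z - G (p (fst z)) (p (snd z))\<bar> + ennreal \<bar>b\<bar> * ennreal \<bar>g z - H (q (fst z)) (q (snd z))\<bar> \<partial>(M \<Otimes>\<^sub>M M))"
  proof (intro nn_integral_mono)
    fix z
    have "\<bar>a * f z + b * g z - ?K (?r (fst z)) (?r (snd z))\<bar> = \<bar>a * (f z - G (p (fst z)) (p (snd z))) + b * (g z - H (q (fst z)) (q (snd z)))\<bar>"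
      by (simp add: algebra_simps)
    also have "\<dots> \<le> \<bar>a\<bar> * \<bar>f z - G (p (fst z)) (p (snd z))\<bar> + \<bar>b\<bar> * \<bar>g z - H (q (fst z)) (q (snd z))\<bar>"
      by (metis abs_mult abs_triangle_ineq)
    finally show "ennreal \<bar>a * f z + b * g z - ?K (?r (fst z)) (?r (snd z))\<bar> \<le>
      ennreal \<bar>a\<bar> * ennreal \<bar>f z - G (p (fst z)) (p (snd z))\<bar> + ennreal \<bar>b\<bar> * ennreal \<bar>g z - H (q (fst z)) (q (snd z))\<bar>"
      by (simp add: ennreal_leI flip: ennreal_plus ennreal_mult)
  qed
  also have "\<dots> = ennreal \<bar>a\<bar> * (\<integral>\<^sup>+z. ennreal \<bar>f z - G (p (fst z)) (p (snd z))\<bar> \<partial>(M \<Otimes>\<^sub>M M)) +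
      ennreal \<bar>b\<bar> * (\<integral>\<^sup>+z. ennreal \<bar>g z - H (q (fst z)) (q (snd z))\<bar> \<partial>(M \<Otimes>\<^sub>M M))"
    by (simp add: nn_integral_add nn_integral_cmult)
  also have "\<dots> \<le> ennreal \<bar>a\<bar> * ennreal (\<epsilon> / c) + ennreal \<bar>b\<bar> * ennreal (\<epsilon> / c)"
    by (intro add_mono mult_left_mono G H) auto
  also have "\<dots> = (ennreal \<bar>a\<bar> + ennreal \<bar>b\<bar>) * ennreal (\<epsilon> / c)" by (rule distrib_right[symmetric])
  also have "\<dots> = ennreal ((\<bar>a\<bar> + \<bar>b\<bar>) * (\<epsilon> / c))"
    using e' by (subst ennreal_mult) auto
  also have "\<dots> \<le> ennreal \<epsilon>"
    using e c by (intro ennreal_leI) (simp add: field_simps c_def)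
  finally show "\<exists>(p :: 'a \<Rightarrow> nat) G. p \<in> M \<rightarrow>\<^sub>M count_space UNIV \<and> finite (range p) \<and>
     (\<integral>\<^sup>+z. ennreal \<bar>a * f z + b * g z - G (p (fst z)) (p (snd z))\<bar> \<partial>(M \<Otimes>\<^sub>M M)) \<le> ennreal \<epsilon>"
    using rm rf by (intro exI[of _ ?r] exI[of _ ?K] conjI)
qed

lemma step_approximable_zero: "step_approximable M (\<lambda>_. 0)"
  by (rule step_approximable_step[where p="\<lambda>_. 0" and G="\<lambda>_ _. 0"]) auto

lemma step_approximable_sum:
  assumes "finite I" "\<And>i. i \<in> I \<Longrightarrow> f i \<in> borel_measurable (M \<Otimes>\<^sub>M M)" "\<And>i. i \<in> I \<Longrightarrow> step_approximable M (f i)"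
  shows "step_approximable M (\<lambda>z. \<Sum>i\<in>I. c * f i z)"
  using assms
proof (induction I rule: finite_induct)
  case empty
  then show ?case using step_approximable_zero by simp
next
  case (insert i I)
  have "step_approximable M (\<lambda>z. c * f i z + 1 * (\<Sum>i\<in>I. c * f i z))"
    using insert by (intro step_approximable_add borel_measurable_sum borel_measurable_times) auto
  then show ?case using insert.hyps by simp
qed

text \<open>Dynkin's argument: rectangles generate the product sets and are stable under
  intersection, complements are linear combinations, and for a disjoint union the finite partial
  unions converge in measure. Disjointness turns the indicator of a partial union into a finite
  sum.\<close>

lemma step_approximable_indicator:
  assumes M: "prob_space M" and A: "A \<in> sets (M \<Otimes>\<^sub>M M)"
  shows "step_approximable M (indicator A)"
proof -
  interpret M: prob_space M by fact
  interpret MM: pair_prob_space M M ..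
  let ?S = "{a \<times> b | a b. a \<in> sets M \<and> b \<in> sets M}"
  have A': "A \<in> sigma_sets (space M \<times> space M) ?S" using A by (simp add: sets_pair_measure)
  have sts: "sigma_sets (space M \<times> space M) ?S = sets (M \<Otimes>\<^sub>M M)" by (simp add: sets_pair_measure)
  have "?S \<subseteq> Pow (space M \<times> space M)" by (rule pair_measure_closed)
  from Int_stable_pair_measure_generator this A' show ?thesis
  proof (induction rule: sigma_sets_induct_disjoint)
    case (basic X)
    then obtain a b where X: "X = a \<times> b" and [measurable]: "a \<in> sets M" "b \<in> sets M" by auto
    \<comment> \<open>One label records both memberships: it is odd exactly on \<open>a\<close>, and
      at least 2 exactly on \<open>b\<close>.\<close>
    let ?p = "\<lambda>x. of_bool (x \<in> a) + 2 * of_bool (x \<in> b) :: nat"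
    have "?p \<in> M \<rightarrow>\<^sub>M count_space UNIV" by measurable
    moreover have "finite (range ?p)" by (rule finite_subset[of _ "{..3}"]) auto
    moreover have "indicator X z = (\<lambda>k l. if odd k \<and> 2 \<le> l then 1 else 0) (?p (fst z)) (?p (snd z))" for z
      by (cases z) (auto simp: X indicator_def)
    ultimately show ?case by (rule step_approximable_step)
  next
    case empty
    then show ?case using step_approximable_zero by (simp add: indicator_def)
  next
    case (compl X)
    then have [measurable]: "X \<in> sets (M \<Otimes>\<^sub>M M)" by (simp add: sts)
    have 1: "step_approximable M (\<lambda>_. 1)"
      by (rule step_approximable_step[where p="\<lambda>_. 0" and G="\<lambda>_ _. 1"]) auto
    have X: "step_approximable M (\<lambda>z. 1 * 1 + (- 1) * indicator X z)"
      by (rule step_approximable_add[OF _ _ 1 compl(2)]) auto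
    have eq: "(\<integral>\<^sup>+z. ennreal \<bar>indicator (space M \<times> space M - X) z - (1 * 1 + (- 1) * indicator X z)\<bar> \<partial>(M \<Otimes>\<^sub>M M)) = (\<integral>\<^sup>+z. 0 \<partial>(M \<Otimes>\<^sub>M M))"
      by (rule nn_integral_cong) (auto simp: indicator_def space_pair_measure)
    show ?case
    proof (rule step_approximable_trans)
      have "space M \<times> space M - X \<in> sets (M \<Otimes>\<^sub>M M)"
        using sets.compl_sets[of X "M \<Otimes>\<^sub>M M"] by (simp add: space_pair_measure)
      then show "indicator (space M \<times> space M - X) \<in> borel_measurable (M \<Otimes>\<^sub>M M)" by simp
    qed (use X eq in \<open>intro exI[of _ "\<lambda>z. 1 * 1 + (- 1) * indicator X z"], auto\<close>)
  next
    case (union X)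
    then have [measurable]: "X i \<in> sets (M \<Otimes>\<^sub>M M)" for i by (auto simp: sts)
    show ?case
    proof (rule step_approximable_trans)
      fix \<epsilon> :: real assume e: "0 < \<epsilon>"
      have "(\<lambda>n. measure (M \<Otimes>\<^sub>M M) (\<Union>i<n. X i)) \<longlonglongrightarrow> measure (M \<Otimes>\<^sub>M M) (\<Union>n. \<Union>i<n. X i)"
        by (rule MM.finite_Lim_measure_incseq) (auto intro!: incseq_SucI simp: lessThan_Suc)
      moreover have "(\<Union>n. \<Union>i<n. X i) = (\<Union>i. X i)" by auto
      ultimately have "\<forall>\<^sub>F n in sequentially. dist (measure (M \<Otimes>\<^sub>M M) (\<Union>i<n. X i)) (measure (M \<Otimes>\<^sub>M M) (\<Union>i. X i)) < \<epsilon>"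
        using e by (simp add: tendsto_iff)
      then obtain n where n: "\<bar>measure (M \<Otimes>\<^sub>M M) (\<Union>i<n. X i) - measure (M \<Otimes>\<^sub>M M) (\<Union>i. X i)\<bar> < \<epsilon>"
        by (auto simp: eventually_sequentially dist_real_def)
      have "step_approximable M (\<lambda>z. \<Sum>i\<in>{..<n}. 1 * indicator (X i) z)"
        using union by (intro step_approximable_sum) auto
      moreover have "(\<Sum>i<n. indicator (X i) z) = (indicator (\<Union>i<n. X i) z :: real)" for z
        using union(1) by (subst indicator_UN_disjoint) (auto simp: disjoint_family_on_def)
      ultimately have "step_approximable M (indicator (\<Union>i<n. X i))" by simp
      moreover have "(\<integral>\<^sup>+z. ennreal \<bar>indicator (\<Union>i. X i) z - indicator (\<Union>i<n. X i) z\<bar> \<partial>(M \<Otimes>\<^sub>M M)) \<le> ennreal \<epsilon>"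
      proof -
        have "(\<integral>\<^sup>+z. ennreal \<bar>indicator (\<Union>i. X i) z - indicator (\<Union>i<n. X i) z\<bar> \<partial>(M \<Otimes>\<^sub>M M)) = (\<integral>\<^sup>+z. indicator ((\<Union>i. X i) - (\<Union>i<n. X i)) z \<partial>(M \<Otimes>\<^sub>M M))"
          by (intro nn_integral_cong) (auto simp: indicator_def)
        also have "\<dots> = emeasure (M \<Otimes>\<^sub>M M) ((\<Union>i. X i) - (\<Union>i<n. X i))" by (rule nn_integral_indicator) measurable
        also have "\<dots> = ennreal (measure (M \<Otimes>\<^sub>M M) (\<Union>i. X i) - measure (M \<Otimes>\<^sub>M M) (\<Union>i<n. X i))"
          by (subst MM.emeasure_eq_measure, subst MM.finite_measure_Diff) auto
        also have "\<dots> \<le> ennreal \<epsilon>" using n by (intro ennreal_leI) auto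
        finally show ?thesis .
      qed
      ultimately show "\<exists>g. g \<in> borel_measurable (M \<Otimes>\<^sub>M M) \<and> step_approximable M g \<and>
         (\<integral>\<^sup>+z. ennreal \<bar>indicator (\<Union>i. X i) z - g z\<bar> \<partial>(M \<Otimes>\<^sub>M M)) \<le> ennreal \<epsilon>"
        by (intro exI[of _ "indicator (\<Union>i<n. X i)"]) auto
    qed measurable
  qed
qed

text \<open>Summing 1 / m over the levels k / m that are reached by f gives floor (m f) / m, which
  is within 1 / m of f and is a finite combination of indicators of superlevel sets.\<close>

lemma step_approximable_bounded:
  assumes M: "prob_space M" and f[measurable]: "f \<in> borel_measurable (M \<Otimes>\<^sub>M M)" and fK: "\<And>z. 0 \<le> f z" "\<And>z. f z \<le> K"
  shows "step_approximable M f"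
proof (rule step_approximable_trans[OF f])
  interpret M: prob_space M by fact
  interpret MM: pair_prob_space M M ..
  fix \<epsilon> :: real assume e: "0 < \<epsilon>"
  obtain n where n: "inverse (real (Suc n)) < \<epsilon>" using reals_Archimedean[OF e] by blast
  define m where "m = real (Suc n)"
  have m: "0 < m" "1 / m < \<epsilon>" using n by (auto simp: m_def inverse_eq_divide)
  obtain l :: nat where l: "m * K \<le> real l" using real_arch_simple by blast
  define A where "A k = {z \<in> space (M \<Otimes>\<^sub>M M). real k \<le> m * f z}" for k
  have [measurable]: "A k \<in> sets (M \<Otimes>\<^sub>M M)" for k unfolding A_def by measurable
  let ?g = "\<lambda>z. \<Sum>k\<in>{1..l}. 1 / m * indicator (A k) z"
  have "step_approximable M ?g"
    by (intro step_approximable_sum step_approximable_indicator M) auto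
  moreover have "\<bar>f z - ?g z\<bar> \<le> \<epsilon>" if z: "z \<in> space (M \<Otimes>\<^sub>M M)" for z
  proof -
    let ?y = "m * f z"
    have y: "0 \<le> ?y" "?y \<le> l" using fK[of z] m l by (auto intro: order_trans[OF mult_left_mono[of "f z" K m]])
    have fl: "real (nat \<lfloor>?y\<rfloor>) = of_int \<lfloor>?y\<rfloor>" using y by (simp add: of_nat_nat)
    have iff: "real k \<le> ?y \<longleftrightarrow> k \<le> nat \<lfloor>?y\<rfloor>" for k
    proof
      assume "k \<le> nat \<lfloor>?y\<rfloor>"
      then have "real k \<le> of_int \<lfloor>?y\<rfloor>" unfolding fl[symmetric] by simp
      then show "real k \<le> ?y" by linarith
    qed (rule le_nat_floor)
    have le: "k \<le> l" if "real k \<le> ?y" for k using that y by linarith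
    have cells: "{k \<in> {1..l}. real k \<le> ?y} = {1..nat \<lfloor>?y\<rfloor>}"
      unfolding set_eq_iff mem_Collect_eq atLeastAtMost_iff using iff le by blast
    have "?g z = (\<Sum>k\<in>{1..l}. if real k \<le> ?y then 1 / m else 0)"
      using z by (intro sum.cong refl) (simp add: A_def indicator_def)
    also have "\<dots> = (\<Sum>k\<in>{k \<in> {1..l}. real k \<le> ?y}. 1 / m)" by (rule sum.inter_filter[symmetric]) simp
    finally have "?g z = of_int \<lfloor>?y\<rfloor> / m" unfolding cells by (simp add: fl[symmetric])
    moreover have "f z = ?y / m" using m by simp
    ultimately have "f z - ?g z = (?y - of_int \<lfloor>?y\<rfloor>) / m" by (simp add: diff_divide_distrib)
    moreover have "0 \<le> ?y - of_int \<lfloor>?y\<rfloor>" "?y - of_int \<lfloor>?y\<rfloor> \<le> 1" by linarith+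
    ultimately have "\<bar>f z - ?g z\<bar> \<le> 1 / m" using m by (simp add: divide_right_mono)
    then show ?thesis using m by simp
  qed
  then have "(\<integral>\<^sup>+z. ennreal \<bar>f z - ?g z\<bar> \<partial>(M \<Otimes>\<^sub>M M)) \<le> (\<integral>\<^sup>+z. ennreal \<epsilon> \<partial>(M \<Otimes>\<^sub>M M))"
    by (intro nn_integral_mono ennreal_leI) auto
  then have "(\<integral>\<^sup>+z. ennreal \<bar>f z - ?g z\<bar> \<partial>(M \<Otimes>\<^sub>M M)) \<le> ennreal \<epsilon>"
    by (simp add: MM.emeasure_space_1)
  ultimately show "\<exists>g. g \<in> borel_measurable (M \<Otimes>\<^sub>M M) \<and> step_approximable M g \<and> (\<integral>\<^sup>+z. ennreal \<bar>f z - g z\<bar> \<partial>(M \<Otimes>\<^sub>M M)) \<le> ennreal \<epsilon>"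
    by (intro exI[of _ ?g]) auto
qed

section \<open>Averages of a kernel over pairs of cells\<close>

definition cell_average :: "'a measure \<Rightarrow> ('a \<Rightarrow> 'a \<Rightarrow> real) \<Rightarrow> ('a \<Rightarrow> nat) \<Rightarrow> nat \<Rightarrow> nat \<Rightarrow> real" where
  "cell_average \<alpha> V p a a' =
     (\<integral>z. V (fst z) (snd z) * (indicator (p -` {a}) (fst z) * indicator (p -` {a'}) (snd z)) \<partial>(\<alpha> \<Otimes>\<^sub>M \<alpha>)) /
     (measure \<alpha> (p -` {a}) * measure \<alpha> (p -` {a'}))"

context
  fixes \<alpha> :: "'a measure" and V :: "'a \<Rightarrow> 'a \<Rightarrow> real" and K :: real and p :: "'a \<Rightarrow> nat"
  assumes \<alpha>: "prob_space \<alpha>" "space \<alpha> = UNIV"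
    and V[measurable]: "case_prod V \<in> borel_measurable (\<alpha> \<Otimes>\<^sub>M \<alpha>)"
    and VK: "\<And>s s'. 0 \<le> V s s'" "\<And>s s'. V s s' \<le> K"
    and p[measurable]: "p \<in> \<alpha> \<rightarrow>\<^sub>M count_space UNIV"
begin

interpretation A: prob_space \<alpha> by (rule \<alpha>)
interpretation AA: pair_prob_space \<alpha> \<alpha> ..

lemma cell_sets[measurable]: "p -` X \<in> sets \<alpha>"
  using measurable_sets[OF p, of X] by (simp add: \<alpha>)

lemma integral_cells:
  "(\<integral>z. indicator (p -` {a}) (fst z) * indicator (p -` {a'}) (snd z) \<partial>(\<alpha> \<Otimes>\<^sub>M \<alpha>)) = measure \<alpha> (p -` {a}) * measure \<alpha> (p -` {a'})"
proof -
  have "(\<integral>z. indicator (p -` {a}) (fst z) * indicator (p -` {a'}) (snd z) \<partial>(\<alpha> \<Otimes>\<^sub>M \<alpha>)) = (\<integral>z. indicator (p -` {a} \<times> p -` {a'}) z \<partial>(\<alpha> \<Otimes>\<^sub>M \<alpha>) :: real)"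
    by (intro Bochner_Integration.integral_cong refl indicator_times[symmetric])
  also have "\<dots> = measure (\<alpha> \<Otimes>\<^sub>M \<alpha>) (p -` {a} \<times> p -` {a'})" by (subst Bochner_Integration.integral_indicator) (simp add: space_pair_measure \<alpha>)
  also have "\<dots> = measure \<alpha> (p -` {a}) * measure \<alpha> (p -` {a'})"
    using cell_sets unfolding measure_def by (subst A.emeasure_pair_measure_Times) (simp_all only: enn2real_mult)
  finally show ?thesis .
qed

lemma integrable_on_cell:
  assumes [measurable]: "f \<in> borel_measurable (\<alpha> \<Otimes>\<^sub>M \<alpha>)" and "\<And>z. \<bar>f z\<bar> \<le> (L :: real)"
  shows "integrable (\<alpha> \<Otimes>\<^sub>M \<alpha>) (\<lambda>z. f z * (indicator (p -` {a}) (fst z) * indicator (p -` {a'}) (snd z)))"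
proof (rule AA.integrable_const_bound[where B=L])
  have "0 \<le> L" using assms(2)[of undefined] by linarith
  then show "AE z in \<alpha> \<Otimes>\<^sub>M \<alpha>. norm (f z * (indicator (p -` {a}) (fst z) * indicator (p -` {a'}) (snd z))) \<le> L"
    using assms(2) by (intro AE_I2) (auto simp: indicator_def)
qed measurable

lemma Vm: "(\<lambda>z. V (fst z) (snd z)) \<in> borel_measurable (\<alpha> \<Otimes>\<^sub>M \<alpha>)"
  using V by (simp add: split_beta')

lemma cell_average_nonneg: "0 \<le> cell_average \<alpha> V p a a'"
  unfolding cell_average_def by (intro divide_nonneg_nonneg integral_nonneg) (auto simp: VK)

text \<open>Over a rectangle of measure zero the average is 0 by division by zero, and the integral
  of the bounded kernel vanishes as well, so the identity holds without a case distinction.\<close>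

lemma cell_average_times:
  "cell_average \<alpha> V p a a' * (measure \<alpha> (p -` {a}) * measure \<alpha> (p -` {a'})) =
    (\<integral>z. V (fst z) (snd z) * (indicator (p -` {a}) (fst z) * indicator (p -` {a'}) (snd z)) \<partial>(\<alpha> \<Otimes>\<^sub>M \<alpha>))"
proof (cases "measure \<alpha> (p -` {a}) * measure \<alpha> (p -` {a'}) = 0")
  case True
  have "(\<integral>z. V (fst z) (snd z) * (indicator (p -` {a}) (fst z) * indicator (p -` {a'}) (snd z)) \<partial>(\<alpha> \<Otimes>\<^sub>M \<alpha>))
    \<le> (\<integral>z. K * (indicator (p -` {a}) (fst z) * indicator (p -` {a'}) (snd z)) \<partial>(\<alpha> \<Otimes>\<^sub>M \<alpha>))"
  proof (rule integral_mono)
    show "integrable (\<alpha> \<Otimes>\<^sub>M \<alpha>) (\<lambda>z. K * (indicator (p -` {a}) (fst z) * indicator (p -` {a'}) (snd z)))"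
      by (rule integrable_on_cell[of "\<lambda>_. K" "\<bar>K\<bar>"]) auto
    show "integrable (\<alpha> \<Otimes>\<^sub>M \<alpha>) (\<lambda>z. V (fst z) (snd z) * (indicator (p -` {a}) (fst z) * indicator (p -` {a'}) (snd z)))"
      using VK by (intro integrable_on_cell[of _ K] Vm) auto
  qed (auto simp: VK intro!: mult_right_mono)
  also have "\<dots> = 0" using True by (simp add: integral_cells)
  finally have "(\<integral>z. V (fst z) (snd z) * (indicator (p -` {a}) (fst z) * indicator (p -` {a'}) (snd z)) \<partial>(\<alpha> \<Otimes>\<^sub>M \<alpha>)) = 0"
    by (intro antisym) (auto intro!: integral_nonneg simp: VK)
  then show ?thesis using True by simp
qed (simp add: cell_average_def)

lemma cell_average_le: "cell_average \<alpha> V p a a' \<le> K"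
proof (cases "measure \<alpha> (p -` {a}) * measure \<alpha> (p -` {a'}) = 0")
  case True
  then have "cell_average \<alpha> V p a a' = 0" unfolding cell_average_def by simp
  then show ?thesis using VK[of undefined undefined] by simp
next
  case False
  then have pos: "0 < measure \<alpha> (p -` {a}) * measure \<alpha> (p -` {a'})"
    by (simp add: zero_less_measure_iff)
  have "cell_average \<alpha> V p a a' * (measure \<alpha> (p -` {a}) * measure \<alpha> (p -` {a'})) \<le> (\<integral>z. K * (indicator (p -` {a}) (fst z) * indicator (p -` {a'}) (snd z)) \<partial>(\<alpha> \<Otimes>\<^sub>M \<alpha>))"
    unfolding cell_average_times
  proof (rule integral_mono)
    show "integrable (\<alpha> \<Otimes>\<^sub>M \<alpha>) (\<lambda>z. K * (indicator (p -` {a}) (fst z) * indicator (p -` {a'}) (snd z)))"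
      by (rule integrable_on_cell[of "\<lambda>_. K" "\<bar>K\<bar>"]) auto
    show "integrable (\<alpha> \<Otimes>\<^sub>M \<alpha>) (\<lambda>z. V (fst z) (snd z) * (indicator (p -` {a}) (fst z) * indicator (p -` {a'}) (snd z)))"
      using VK by (intro integrable_on_cell[of _ K] Vm) auto
  qed (auto simp: VK intro!: mult_right_mono)
  also have "\<dots> = K * (measure \<alpha> (p -` {a}) * measure \<alpha> (p -` {a'}))" by (simp add: integral_cells)
  finally show ?thesis using pos by (rule mult_right_le_imp_le)
qed

lemma cell_average_commute:
  assumes "\<And>s s'. V s s' = V s' s"
  shows "cell_average \<alpha> V p a a' = cell_average \<alpha> V p a' a"
proof -
  have "(\<integral>z. V (fst z) (snd z) * (indicator (p -` {a}) (fst z) * indicator (p -` {a'}) (snd z)) \<partial>(\<alpha> \<Otimes>\<^sub>M \<alpha>)) =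
    (\<integral>(x, y). (\<lambda>z. V (fst z) (snd z) * (indicator (p -` {a}) (fst z) * indicator (p -` {a'}) (snd z))) (y, x) \<partial>(\<alpha> \<Otimes>\<^sub>M \<alpha>))"
    using Vm by (intro AA.integral_product_swap[symmetric]) measurable
  also have "\<dots> = (\<integral>z. V (fst z) (snd z) * (indicator (p -` {a'}) (fst z) * indicator (p -` {a}) (snd z)) \<partial>(\<alpha> \<Otimes>\<^sub>M \<alpha>))"
    using assms by (intro Bochner_Integration.integral_cong refl) (auto simp: mult_ac)
  finally show ?thesis unfolding cell_average_def by (simp add: mult.commute)
qed

text \<open>Averaging over cells is a contraction in \<open>L\<^sup>1\<close> that fixes step kernels.\<close>

lemma cell_average_dist:
  assumes A: "finite A" "range p \<subseteq> A" and GL: "\<And>a a'. \<bar>G a a'\<bar> \<le> L"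
  shows "(\<integral>z. \<bar>V (fst z) (snd z) - cell_average \<alpha> V p (p (fst z)) (p (snd z))\<bar> \<partial>(\<alpha> \<Otimes>\<^sub>M \<alpha>))
    \<le> 2 * (\<integral>z. \<bar>V (fst z) (snd z) - G (p (fst z)) (p (snd z))\<bar> \<partial>(\<alpha> \<Otimes>\<^sub>M \<alpha>))"
proof -
  let ?I = "\<lambda>a a' z. indicator (p -` {a}) (fst z) * indicator (p -` {a'}) (snd z) :: real"
  let ?G = "\<lambda>z. G (p (fst z)) (p (snd z))" and ?C = "\<lambda>z. cell_average \<alpha> V p (p (fst z)) (p (snd z))"
  let ?V = "\<lambda>z. V (fst z) (snd z)"
  let ?J = "\<lambda>f. \<integral>z. f z \<partial>(\<alpha> \<Otimes>\<^sub>M \<alpha>)"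
  have L: "0 \<le> L" using GL[of 0 0] by linarith
  note [measurable] = Vm measurable_step[OF p, of G] measurable_step[OF p, of "cell_average \<alpha> V p"]
  have expand: "f z = (\<Sum>a\<in>A. \<Sum>a'\<in>A. f z * ?I a a' z)" for f :: "'a \<times> 'a \<Rightarrow> real" and z
  proof -
    have one: "(\<Sum>a\<in>A. indicator (p -` {a}) x) = (1::real)" for x
      using A by (subst sum.remove[of _ "p x"]) (auto simp: indicator_def)
    have "(\<Sum>a\<in>A. \<Sum>a'\<in>A. f z * ?I a a' z) = f z * ((\<Sum>a\<in>A. indicator (p -` {a}) (fst z)) * (\<Sum>a'\<in>A. indicator (p -` {a'}) (snd z)))"
      unfolding sum_product by (simp add: sum_distrib_left)
    then show ?thesis by (simp add: one)
  qed
  have VGb: "\<bar>?V z - ?G z\<bar> \<le> K + L" for z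
    using VK[of "fst z" "snd z"] GL[of "p (fst z)" "p (snd z)"] by linarith
  have VCb: "\<bar>?V z - ?C z\<bar> \<le> K" for z
    using VK[of "fst z" "snd z"] cell_average_nonneg[of "p (fst z)" "p (snd z)"] cell_average_le[of "p (fst z)" "p (snd z)"] by linarith
  have CGb: "\<bar>?C z - ?G z\<bar> \<le> K + L" for z
    using GL[of "p (fst z)" "p (snd z)"] cell_average_nonneg[of "p (fst z)" "p (snd z)"] cell_average_le[of "p (fst z)" "p (snd z)"] by linarith
  have iVG: "integrable (\<alpha> \<Otimes>\<^sub>M \<alpha>) (\<lambda>z. \<bar>?V z - ?G z\<bar>)"
    using VGb by (intro AA.integrable_const_bound[where B="K + L"]) auto
  have iCG: "integrable (\<alpha> \<Otimes>\<^sub>M \<alpha>) (\<lambda>z. \<bar>?C z - ?G z\<bar>)"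
    using CGb by (intro AA.integrable_const_bound[where B="K + L"]) auto
  have iVC: "integrable (\<alpha> \<Otimes>\<^sub>M \<alpha>) (\<lambda>z. \<bar>?V z - ?C z\<bar>)"
    using VCb by (intro AA.integrable_const_bound[where B=K]) auto
  \<comment> \<open>On a rectangle \<open>?C\<close> and \<open>?G\<close> are constant, so the
    integral of their distance is the absolute value of the integral of \<open>?V - ?G\<close> over
    the rectangle, which is at most the integral of the absolute value.\<close>
  have cell: "?J (\<lambda>z. \<bar>?C z - ?G z\<bar> * ?I a a' z) \<le> ?J (\<lambda>z. \<bar>?V z - ?G z\<bar> * ?I a a' z)" for a a'
  proof -
    have "?J (\<lambda>z. \<bar>?C z - ?G z\<bar> * ?I a a' z) = ?J (\<lambda>z. \<bar>cell_average \<alpha> V p a a' - G a a'\<bar> * ?I a a' z)"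
      by (intro Bochner_Integration.integral_cong refl) (auto simp: indicator_def)
    also have "\<dots> = \<bar>cell_average \<alpha> V p a a' - G a a'\<bar> * (measure \<alpha> (p -` {a}) * measure \<alpha> (p -` {a'}))"
      by (simp add: integral_cells)
    also have "\<dots> = \<bar>(cell_average \<alpha> V p a a' - G a a') * (measure \<alpha> (p -` {a}) * measure \<alpha> (p -` {a'}))\<bar>"
      by (simp add: abs_mult)
    also have "(cell_average \<alpha> V p a a' - G a a') * (measure \<alpha> (p -` {a}) * measure \<alpha> (p -` {a'})) = ?J (\<lambda>z. ?V z * ?I a a' z) - ?J (\<lambda>z. G a a' * ?I a a' z)"
      by (simp add: left_diff_distrib cell_average_times integral_cells)
    also have "\<dots> = ?J (\<lambda>z. ?V z * ?I a a' z - G a a' * ?I a a' z)"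
    proof (rule Bochner_Integration.integral_diff[symmetric])
      show "integrable (\<alpha> \<Otimes>\<^sub>M \<alpha>) (\<lambda>z. G a a' * ?I a a' z)"
        by (rule integrable_on_cell[of "\<lambda>_. G a a'" L]) (auto simp: GL)
      show "integrable (\<alpha> \<Otimes>\<^sub>M \<alpha>) (\<lambda>z. ?V z * ?I a a' z)"
        using VK by (intro integrable_on_cell[of _ K] Vm) auto
    qed
    also have "\<dots> = ?J (\<lambda>z. (?V z - ?G z) * ?I a a' z)"
      by (intro Bochner_Integration.integral_cong refl) (auto simp: indicator_def)
    also have "\<bar>\<dots>\<bar> \<le> ?J (\<lambda>z. \<bar>(?V z - ?G z) * ?I a a' z\<bar>)" by (rule integral_abs_bound)
    also have "\<dots> = ?J (\<lambda>z. \<bar>?V z - ?G z\<bar> * ?I a a' z)" by (simp add: abs_mult)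
    finally show ?thesis .
  qed
  have "?J (\<lambda>z. \<bar>?C z - ?G z\<bar>) = ?J (\<lambda>z. \<Sum>a\<in>A. \<Sum>a'\<in>A. \<bar>?C z - ?G z\<bar> * ?I a a' z)"
    by (subst expand) (rule refl)
  also have "\<dots> = (\<Sum>a\<in>A. \<Sum>a'\<in>A. ?J (\<lambda>z. \<bar>?C z - ?G z\<bar> * ?I a a' z))"
    using CGb by (subst Bochner_Integration.integral_sum, intro Bochner_Integration.integrable_sum integrable_on_cell[of _ "K + L"])
      (simp_all add: Bochner_Integration.integral_sum integrable_on_cell[of _ "K + L"])
  also have "\<dots> \<le> (\<Sum>a\<in>A. \<Sum>a'\<in>A. ?J (\<lambda>z. \<bar>?V z - ?G z\<bar> * ?I a a' z))"
    by (intro sum_mono cell)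
  also have "\<dots> = ?J (\<lambda>z. \<Sum>a\<in>A. \<Sum>a'\<in>A. \<bar>?V z - ?G z\<bar> * ?I a a' z)"
    using VGb by (subst Bochner_Integration.integral_sum, intro Bochner_Integration.integrable_sum integrable_on_cell[of _ "K + L"])
      (simp_all add: Bochner_Integration.integral_sum integrable_on_cell[of _ "K + L"])
  also have "\<dots> = ?J (\<lambda>z. \<bar>?V z - ?G z\<bar>)"
    by (subst (2) expand) (rule refl)
  finally have CG: "?J (\<lambda>z. \<bar>?C z - ?G z\<bar>) \<le> ?J (\<lambda>z. \<bar>?V z - ?G z\<bar>)" .
  have "?J (\<lambda>z. \<bar>?V z - ?C z\<bar>) \<le> ?J (\<lambda>z. \<bar>?V z - ?G z\<bar> + \<bar>?C z - ?G z\<bar>)"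
    by (rule integral_mono) (use iVC iVG iCG in auto)
  also have "\<dots> = ?J (\<lambda>z. \<bar>?V z - ?G z\<bar>) + ?J (\<lambda>z. \<bar>?C z - ?G z\<bar>)"
    using iVG iCG by simp
  finally show ?thesis using CG by simp
qed

end

text \<open>A step kernel within \<epsilon> / 2 exists by density; exchanging it for the cell
  averages at most doubles the distance. All cells are given positive mass, because the densities
  built on them later divide by the masses.\<close>

lemma partition_approximation:
  fixes V :: "'a \<Rightarrow> 'a \<Rightarrow> real"
  assumes \<alpha>: "prob_space \<alpha>" "space \<alpha> = UNIV"
    and V: "case_prod V \<in> borel_measurable (\<alpha> \<Otimes>\<^sub>M \<alpha>)"
    and VK: "\<And>s s'. 0 \<le> V s s'" "\<And>s s'. V s s' \<le> K" and e: "0 < \<epsilon>"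
  obtains p :: "'a \<Rightarrow> nat" and A where "p \<in> \<alpha> \<rightarrow>\<^sub>M count_space UNIV" "finite A" "range p \<subseteq> A"
    "\<And>a. a \<in> A \<Longrightarrow> 0 < measure \<alpha> (p -` {a})"
    "(\<integral>z. \<bar>V (fst z) (snd z) - cell_average \<alpha> V p (p (fst z)) (p (snd z))\<bar> \<partial>(\<alpha> \<Otimes>\<^sub>M \<alpha>)) \<le> \<epsilon>"
proof -
  interpret A: prob_space \<alpha> by fact
  interpret AA: pair_prob_space \<alpha> \<alpha> ..
  let ?V = "\<lambda>z. V (fst z) (snd z)"
  have Vm[measurable]: "?V \<in> borel_measurable (\<alpha> \<Otimes>\<^sub>M \<alpha>)" using V by (simp add: split_beta')
  have "step_approximable \<alpha> ?V"
    using VK by (intro step_approximable_bounded[where K=K] \<alpha> Vm)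
  moreover have "0 < \<epsilon> / 2" using e by simp
  ultimately obtain r :: "'a \<Rightarrow> nat" and G where r[measurable]: "r \<in> \<alpha> \<rightarrow>\<^sub>M count_space UNIV" and fin: "finite (range r)"
    and G: "(\<integral>\<^sup>+z. ennreal \<bar>?V z - G (r (fst z)) (r (snd z))\<bar> \<partial>(\<alpha> \<Otimes>\<^sub>M \<alpha>)) \<le> ennreal (\<epsilon> / 2)"
    unfolding step_approximable_def by blast
  have rs: "r -` X \<in> sets \<alpha>" for X using measurable_sets[OF r, of X] by (simp add: \<alpha>(2))
  define A where "A = {a \<in> range r. 0 < measure \<alpha> (r -` {a})}"
  have finA: "finite A" using fin by (simp add: A_def)
  define Nl where "Nl = r -` (range r - A)"
  have "Nl = (\<Union>a\<in>range r - A. r -` {a})" by (auto simp: Nl_def)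
  moreover have "(\<Union>a\<in>range r - A. r -` {a}) \<in> null_sets \<alpha>"
  proof (rule null_sets.finite_UN)
    show "r -` {a} \<in> null_sets \<alpha>" if "a \<in> range r - A" for a
    proof -
      have "measure \<alpha> (r -` {a}) = 0" using that measure_nonneg[of \<alpha> "r -` {a}"] by (auto simp: A_def not_less intro: antisym)
      then show ?thesis by (intro null_setsI) (simp_all add: A.emeasure_eq_measure rs)
    qed
  qed (use fin in simp)
  ultimately have Nl: "Nl \<in> null_sets \<alpha>" by simp
  have "A \<noteq> {}"
  proof
    assume "A = {}"
    then have "Nl = UNIV" by (auto simp: Nl_def)
    then show False using Nl A.emeasure_space_1 \<alpha>(2) by (simp add: null_sets_def)
  qed
  then obtain a0 where a0: "a0 \<in> A" by blast
  \<comment> \<open>Points of null cells join a fixed cell of positive mass. This changes the labels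
    on a null set only.\<close>
  define p where "p x = (if r x \<in> A then r x else a0)" for x
  have p[measurable]: "p \<in> \<alpha> \<rightarrow>\<^sub>M count_space UNIV" unfolding p_def by measurable
  have pA: "range p \<subseteq> A" using a0 by (auto simp: p_def)
  have pr: "p x = r x" if "x \<notin> Nl" for x using that by (simp add: p_def Nl_def)
  have ppos: "0 < measure \<alpha> (p -` {a})" if "a \<in> A" for a
  proof -
    have "r -` {a} \<subseteq> p -` {a}" using that by (auto simp: p_def)
    then have "measure \<alpha> (r -` {a}) \<le> measure \<alpha> (p -` {a})"
      by (rule A.finite_measure_mono) (use measurable_sets[OF p, of "{a}"] in \<open>simp add: \<alpha>(2)\<close>)
    then show ?thesis using that by (simp add: A_def)
  qed
  \<comment> \<open>The step kernel is cut off to the finitely many labels in \<open>A\<close> to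
    make it bounded, as \<open>cell_average_dist\<close> requires.\<close>
  define G' where "G' a a' = (if a \<in> A \<and> a' \<in> A then G a a' else 0)" for a a'
  define L where "L = (\<Sum>a\<in>A. \<Sum>a'\<in>A. \<bar>G a a'\<bar>)"
  have G'L: "\<bar>G' a a'\<bar> \<le> L" for a a'
  proof (cases "a \<in> A \<and> a' \<in> A")
    case True
    then have "\<bar>G a a'\<bar> \<le> (\<Sum>a'\<in>A. \<bar>G a a'\<bar>)" using finA by (intro member_le_sum) auto
    also have "\<dots> \<le> L" unfolding L_def using True finA by (intro member_le_sum[of a]) (auto intro: sum_nonneg)
    finally show ?thesis using True by (simp add: G'_def)
  qed (auto simp: G'_def L_def intro!: sum_nonneg)
  have N1: "Nl \<times> UNIV \<in> null_sets (\<alpha> \<Otimes>\<^sub>M \<alpha>)"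
    using A.times_in_null_sets1[OF Nl sets.top[of \<alpha>]] by (simp add: \<alpha>(2))
  have N2: "UNIV \<times> Nl \<in> null_sets (\<alpha> \<Otimes>\<^sub>M \<alpha>)"
    using A.times_in_null_sets2[OF sets.top[of \<alpha>] Nl] by (simp add: \<alpha>(2))
  have "AE z in \<alpha> \<Otimes>\<^sub>M \<alpha>. ennreal \<bar>?V z - G' (p (fst z)) (p (snd z))\<bar> = ennreal \<bar>?V z - G (r (fst z)) (r (snd z))\<bar>"
    using AE_not_in[OF N1] AE_not_in[OF N2]
  proof eventually_elim
    case (elim z)
    then have "fst z \<notin> Nl" "snd z \<notin> Nl" by (cases z; auto)+
    then have "p (fst z) = r (fst z)" "p (snd z) = r (snd z)" using pr by auto
    moreover have "p (fst z) \<in> A" "p (snd z) \<in> A" using pA by auto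
    ultimately show ?case by (simp add: G'_def)
  qed
  then have "(\<integral>\<^sup>+z. ennreal \<bar>?V z - G' (p (fst z)) (p (snd z))\<bar> \<partial>(\<alpha> \<Otimes>\<^sub>M \<alpha>)) = (\<integral>\<^sup>+z. ennreal \<bar>?V z - G (r (fst z)) (r (snd z))\<bar> \<partial>(\<alpha> \<Otimes>\<^sub>M \<alpha>))"
    by (rule nn_integral_cong_AE)
  with G have G2: "(\<integral>\<^sup>+z. ennreal \<bar>?V z - G' (p (fst z)) (p (snd z))\<bar> \<partial>(\<alpha> \<Otimes>\<^sub>M \<alpha>)) \<le> ennreal (\<epsilon> / 2)" by simp
  have gm: "(\<lambda>z. \<bar>?V z - G' (p (fst z)) (p (snd z))\<bar>) \<in> borel_measurable (\<alpha> \<Otimes>\<^sub>M \<alpha>)"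
    by (intro borel_measurable_abs borel_measurable_diff Vm measurable_step p)
  have "(\<integral>z. \<bar>?V z - G' (p (fst z)) (p (snd z))\<bar> \<partial>(\<alpha> \<Otimes>\<^sub>M \<alpha>)) = enn2real (\<integral>\<^sup>+z. ennreal \<bar>?V z - G' (p (fst z)) (p (snd z))\<bar> \<partial>(\<alpha> \<Otimes>\<^sub>M \<alpha>))"
    by (rule integral_eq_nn_integral[OF gm]) simp
  also have "\<dots> \<le> \<epsilon> / 2" using e by (intro enn2real_leI G2) simp
  finally have "(\<integral>z. \<bar>?V z - G' (p (fst z)) (p (snd z))\<bar> \<partial>(\<alpha> \<Otimes>\<^sub>M \<alpha>)) \<le> \<epsilon> / 2" .
  moreover have "(\<integral>z. \<bar>?V z - cell_average \<alpha> V p (p (fst z)) (p (snd z))\<bar> \<partial>(\<alpha> \<Otimes>\<^sub>M \<alpha>)) \<le> 2 * (\<integral>z. \<bar>?V z - G' (p (fst z)) (p (snd z))\<bar> \<partial>(\<alpha> \<Otimes>\<^sub>M \<alpha>))"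
    by (rule cell_average_dist[OF \<alpha> V VK p finA pA G'L])
  ultimately have "(\<integral>z. \<bar>?V z - cell_average \<alpha> V p (p (fst z)) (p (snd z))\<bar> \<partial>(\<alpha> \<Otimes>\<^sub>M \<alpha>)) \<le> \<epsilon>" by linarith
  with p finA pA ppos show ?thesis by (rule that)
qed

section \<open>The variational problem\<close>

text \<open>The hypothesis \<open>eq\<close> says that \<nu>, restricted to weights in
  \<open>S\<close>, has a spin marginal with density \<pi> f relative to \<alpha>. Both sides are
  the integral of g against this marginal, the restriction being written as a density.\<close>

lemma class_density_integral:
  fixes \<nu> :: "('a::second_countable_topology \<times> real) measure" and f g :: "'a \<Rightarrow> real"
  assumes \<nu>: "sets \<nu> = sets borel" and \<alpha>: "sets \<alpha> = sets borel" and S: "S \<in> sets borel"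
    and f[measurable]: "f \<in> borel_measurable \<alpha>" and f0: "\<And>s. 0 \<le> f s" and \<pi>: "0 \<le> \<pi>"
    and eq: "\<And>A. A \<in> sets borel \<Longrightarrow> emeasure \<nu> (A \<times> S) = ennreal \<pi> * (\<integral>\<^sup>+s. ennreal (f s) * indicator A s \<partial>\<alpha>)"
    and g: "g \<in> borel_measurable borel"
  shows "(\<integral>z. g (fst z) * indicator S (snd z) \<partial>\<nu>) = \<pi> * (\<integral>s. g s * f s \<partial>\<alpha>)"
proof -
  let ?i = "\<lambda>z. indicator S (snd z) :: real"
  have fstm: "fst \<in> \<nu> \<rightarrow>\<^sub>M borel"
    unfolding measurable_cong_sets[OF \<nu> refl] borel_prod[symmetric] by measurable
  have im: "?i \<in> borel_measurable \<nu>"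
    unfolding measurable_cong_sets[OF \<nu> refl] borel_prod[symmetric] using S by measurable
  have g\<alpha>: "g \<in> borel_measurable \<alpha>" using g by (simp add: measurable_cong_sets[OF \<alpha> refl])
  let ?D = "density \<nu> (\<lambda>z. ennreal (?i z))"
  have "distr ?D borel fst = density \<alpha> (\<lambda>s. ennreal (\<pi> * f s))"
  proof (rule measure_eqI)
    show "sets (distr ?D borel fst) = sets (density \<alpha> (\<lambda>s. ennreal (\<pi> * f s)))" using \<alpha> by simp
    fix A assume "A \<in> sets (distr ?D borel fst)"
    then have A: "A \<in> sets borel" by simp
    have AU: "A \<times> UNIV \<in> sets \<nu>" and AS: "A \<times> S \<in> sets \<nu>" unfolding \<nu> borel_prod[symmetric] using A S by auto
    have sp: "space \<nu> = UNIV" using sets_eq_imp_space_eq[OF \<nu>] by simp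
    have "emeasure (distr ?D borel fst) A = emeasure ?D (fst -` A \<inter> space ?D)"
      using fstm A by (intro emeasure_distr) auto
    also have "fst -` A \<inter> space ?D = A \<times> UNIV" using sp by auto
    also have "emeasure ?D (A \<times> UNIV) = (\<integral>\<^sup>+z. ennreal (?i z) * indicator (A \<times> UNIV) z \<partial>\<nu>)"
      using im AU by (intro emeasure_density) auto
    also have "\<dots> = (\<integral>\<^sup>+z. indicator (A \<times> S) z \<partial>\<nu>)"
      by (intro nn_integral_cong) (auto simp: indicator_def)
    also have "\<dots> = emeasure \<nu> (A \<times> S)" using AS by simp
    also have "\<dots> = ennreal \<pi> * (\<integral>\<^sup>+s. ennreal (f s) * indicator A s \<partial>\<alpha>)" by (rule eq[OF A])
    also have "\<dots> = (\<integral>\<^sup>+s. ennreal \<pi> * (ennreal (f s) * indicator A s) \<partial>\<alpha>)"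
      using A \<alpha> by (intro nn_integral_cmult[symmetric]) auto
    also have "\<dots> = (\<integral>\<^sup>+s. ennreal (\<pi> * f s) * indicator A s \<partial>\<alpha>)"
      using \<pi> f0 by (intro nn_integral_cong) (simp add: ennreal_mult mult.assoc)
    also have "\<dots> = emeasure (density \<alpha> (\<lambda>s. ennreal (\<pi> * f s))) A"
      using A \<alpha> by (intro emeasure_density[symmetric]) auto
    finally show "emeasure (distr ?D borel fst) A = emeasure (density \<alpha> (\<lambda>s. ennreal (\<pi> * f s))) A" .
  qed
  then have "(\<integral>s. g s \<partial>distr ?D borel fst) = (\<integral>s. g s \<partial>density \<alpha> (\<lambda>s. ennreal (\<pi> * f s)))" by simp
  moreover have "(\<integral>s. g s \<partial>distr ?D borel fst) = (\<integral>z. g (fst z) \<partial>?D)"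
    using fstm g by (intro integral_distr) auto
  moreover have "\<dots> = (\<integral>z. ?i z * g (fst z) \<partial>\<nu>)"
    using measurable_compose[OF fstm g] im by (intro integral_real_density) auto
  moreover have "(\<integral>s. g s \<partial>density \<alpha> (\<lambda>s. ennreal (\<pi> * f s))) = (\<integral>s. (\<pi> * f s) * g s \<partial>\<alpha>)"
    using g\<alpha> \<pi> f0 by (intro integral_real_density) auto
  moreover have "\<dots> = (\<integral>s. \<pi> * (g s * f s) \<partial>\<alpha>)" by (intro Bochner_Integration.integral_cong refl) simp
  ultimately show ?thesis by (simp add: mult.commute)
qed

text \<open>\<open>V\<close> stands for exp \<Phi>. Here the weights are present only through their
  limit law \<open>P\<close>; the sequence of weights joins in
  \<open>weighted_mean_field\<close>.\<close>

locale mean_field = A: prob_space \<alpha> + P: real_distribution P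
  for \<alpha> :: "'a :: second_countable_topology measure" and P :: "real measure" +
  fixes V :: "'a \<Rightarrow> 'a \<Rightarrow> real" and K :: real
  assumes sets_\<alpha>: "sets \<alpha> = sets borel"
    and V_borel: "case_prod V \<in> borel_measurable borel"
    and V_nonneg: "\<And>s s'. 0 \<le> V s s'" and V_le: "\<And>s s'. V s s' \<le> K"
    and V_sym: "\<And>s s'. V s s' = V s' s"
    and P_pos: "AE x in P. 0 < x"
    and P_square: "integrable P (\<lambda>x. x\<^sup>2)"
begin

sublocale AA: pair_prob_space \<alpha> \<alpha> ..

definition mean :: real where "mean = (\<integral>x. x \<partial>P)"

definition admissible :: "('a \<times> real) measure \<Rightarrow> bool" where
  "admissible \<nu> \<longleftrightarrow> \<nu> \<in> space (prob_algebra borel) \<and> weight_marginal \<nu> = P"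

text \<open>The weight enters through a function \<phi>, so that one functional covers both the true
  weights and their class values. The normalization is the mean of \<open>P\<close> in either case,
  which keeps the two energies comparable.\<close>

definition energy :: "(real \<Rightarrow> real) \<Rightarrow> ('a \<times> real) measure \<Rightarrow> real" where
  "energy \<phi> \<nu> = (\<integral>z. (\<integral>z'. \<phi> (snd z) * \<phi> (snd z') / (2 * mean) * V (fst z) (fst z') \<partial>\<nu>) \<partial>\<nu>)"

lemma space_\<alpha>: "space \<alpha> = UNIV"
  using sets_eq_imp_space_eq[OF sets_\<alpha>] by simp

lemma K_nonneg: "0 \<le> K"
  using V_nonneg[of undefined undefined] V_le[of undefined undefined] by linarith

lemma sets_\<alpha>\<alpha>: "sets (\<alpha> \<Otimes>\<^sub>M \<alpha>) = sets borel"
  unfolding borel_prod[symmetric] by (intro sets_pair_measure_cong sets_\<alpha>)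

lemma V_pair: "case_prod V \<in> borel_measurable (\<alpha> \<Otimes>\<^sub>M \<alpha>)"
  using V_borel by (simp add: measurable_cong_sets[OF sets_\<alpha>\<alpha> refl])

lemma V_fst_snd[measurable]: "(\<lambda>z. V (fst z) (snd z)) \<in> borel_measurable (\<alpha> \<Otimes>\<^sub>M \<alpha>)"
  using V_pair by (simp add: split_beta')

lemma V_comp:
  assumes "f \<in> M \<rightarrow>\<^sub>M borel" "g \<in> M \<rightarrow>\<^sub>M borel"
  shows "(\<lambda>x. V (f x) (g x)) \<in> borel_measurable M"
  using measurable_compose[OF borel_measurable_Pair[OF assms] V_borel] by simp

lemma integrable_id: "integrable P (\<lambda>x. x)"
proof (rule Bochner_Integration.integrable_bound)
  show "integrable P (\<lambda>x. 1 + x\<^sup>2)" using P_square by simp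
  show "AE x in P. norm x \<le> norm (1 + x\<^sup>2)"
  proof (rule AE_I2)
    fix x :: real
    have "0 \<le> (\<bar>x\<bar> - 1)\<^sup>2" by simp
    then have "2 * \<bar>x\<bar> \<le> 1 + \<bar>x\<bar>\<^sup>2" by (simp add: power2_eq_square algebra_simps)
    then show "norm x \<le> norm (1 + x\<^sup>2)" by simp
  qed
qed simp

lemma mean_pos: "0 < mean"
proof -
  have pos: "AE x in P. 0 \<le> x" using P_pos by eventually_elim simp
  then have "0 \<le> mean" unfolding mean_def by (rule integral_nonneg_AE)
  moreover have "mean \<noteq> 0"
  proof
    assume "mean = 0"
    then have "AE x in P. x = 0"
      using integral_nonneg_eq_0_iff_AE[OF integrable_id pos] by (simp add: mean_def)
    with P_pos have "AE x in P. False" by eventually_elim simp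
    then show False by simp
  qed
  ultimately show ?thesis by simp
qed

lemma admissible_facts:
  assumes "admissible \<nu>"
  shows "prob_space \<nu>" "sets \<nu> = sets borel" "fst \<in> \<nu> \<rightarrow>\<^sub>M borel" "snd \<in> \<nu> \<rightarrow>\<^sub>M borel" "distr \<nu> borel snd = P"
proof -
  show "prob_space \<nu>" and s: "sets \<nu> = sets borel" using assms by (auto simp: admissible_def space_prob_algebra)
  show "fst \<in> \<nu> \<rightarrow>\<^sub>M borel" "snd \<in> \<nu> \<rightarrow>\<^sub>M borel"
    unfolding measurable_cong_sets[OF s refl] borel_prod[symmetric] by measurable
  show "distr \<nu> borel snd = P" using assms by (simp add: admissible_def weight_marginal_def)
qed

lemma admissible_snd:
  fixes f :: "real \<Rightarrow> real"
  assumes "admissible \<nu>" "f \<in> borel_measurable borel"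
  shows "(\<integral>z. f (snd z) \<partial>\<nu>) = (\<integral>x. f x \<partial>P)" "integrable \<nu> (\<lambda>z. f (snd z)) \<longleftrightarrow> integrable P f"
  using integral_distr[OF admissible_facts(4)[OF assms(1)] assms(2)] integrable_distr_eq[OF admissible_facts(4)[OF assms(1)] assms(2)]
  by (simp_all add: admissible_facts(5)[OF assms(1)])

lemma admissible_AE_snd:
  assumes "admissible \<nu>"
  shows "AE z in \<nu>. 0 < snd z"
  using P_pos AE_distrD[OF admissible_facts(4)[OF assms]] unfolding admissible_facts(5)[OF assms] by blast

end

lemma (in pair_sigma_finite) integrable_mult_fst_snd:
  fixes f :: "'a \<Rightarrow> real" and g :: "'b \<Rightarrow> real"
  assumes f: "integrable M1 f" and g: "integrable M2 g"
  shows "integrable (M1 \<Otimes>\<^sub>M M2) (\<lambda>z. f (fst z) * g (snd z))"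
    "(\<integral>z. f (fst z) * g (snd z) \<partial>(M1 \<Otimes>\<^sub>M M2)) = (\<integral>x. f x \<partial>M1) * (\<integral>y. g y \<partial>M2)"
proof -
  have [measurable]: "f \<in> borel_measurable M1" "g \<in> borel_measurable M2" using f g by auto
  show i: "integrable (M1 \<Otimes>\<^sub>M M2) (\<lambda>z. f (fst z) * g (snd z))"
  proof (rule Fubini_integrable)
    show "integrable M1 (\<lambda>x. \<integral>y. norm (f (fst (x, y)) * g (snd (x, y))) \<partial>M2)"
      using f by (simp add: abs_mult)
    show "AE x in M1. integrable M2 (\<lambda>y. f (fst (x, y)) * g (snd (x, y)))"
      using g by simp
  qed measurable
  show "(\<integral>z. f (fst z) * g (snd z) \<partial>(M1 \<Otimes>\<^sub>M M2)) = (\<integral>x. f x \<partial>M1) * (\<integral>y. g y \<partial>M2)"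
    using integral_fst'[OF i] by simp
qed

section \<open>Comparison of the energies of true and truncated weights\<close>

context mean_field
begin

definition second_moment :: real where "second_moment = (\<integral>x. x\<^sup>2 \<partial>P)"

lemma second_moment_nonneg: "0 \<le> second_moment"
  unfolding second_moment_def by (rule Bochner_Integration.integral_nonneg) simp

lemma borel_measurable_id: "(\<lambda>x. x) \<in> borel_measurable (borel :: real measure)"
  by simp

text \<open>The comparisons below are made pointwise under the product of \<nu> with itself, for
  which the iterated integral must become a single one. The kernel is dominated by a multiple of the
  product of the two values of \<phi>, whose integral factorizes.\<close>

lemma energy_pair_integral:
  assumes adm: "admissible \<nu>" and \<phi>: "\<phi> \<in> borel_measurable borel" and int: "integrable P \<phi>"
  defines "h \<equiv> \<lambda>z. \<phi> (snd (fst z)) * \<phi> (snd (snd z)) / (2 * mean) * V (fst (fst z)) (fst (snd z))"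
  shows "integrable (\<nu> \<Otimes>\<^sub>M \<nu>) h" "energy \<phi> \<nu> = (\<integral>z. h z \<partial>(\<nu> \<Otimes>\<^sub>M \<nu>))"
proof -
  interpret N: prob_space \<nu> by (rule admissible_facts[OF adm])
  interpret NN: pair_prob_space \<nu> \<nu> ..
  note [measurable] = admissible_facts(3,4)[OF adm] \<phi>
  have [measurable]: "(\<lambda>z. V (fst (fst z)) (fst (snd z))) \<in> borel_measurable (\<nu> \<Otimes>\<^sub>M \<nu>)"
    by (rule V_comp) measurable
  have i: "integrable \<nu> (\<lambda>z. \<phi> (snd z))" using admissible_snd(2)[OF adm \<phi>] int by simp
  show ih: "integrable (\<nu> \<Otimes>\<^sub>M \<nu>) h"
  proof (rule Bochner_Integration.integrable_bound)
    show "integrable (\<nu> \<Otimes>\<^sub>M \<nu>) (\<lambda>z. (\<phi> (snd (fst z)) * \<phi> (snd (snd z))) * (K / (2 * mean)))"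
      using NN.integrable_mult_fst_snd(1)[OF i i] by simp
    show "h \<in> borel_measurable (\<nu> \<Otimes>\<^sub>M \<nu>)" unfolding h_def by measurable
    show "AE z in \<nu> \<Otimes>\<^sub>M \<nu>. norm (h z) \<le> norm ((\<phi> (snd (fst z)) * \<phi> (snd (snd z))) * (K / (2 * mean)))"
    proof (rule AE_I2)
      fix z
      have "norm (h z) = \<bar>\<phi> (snd (fst z)) * \<phi> (snd (snd z))\<bar> / (2 * mean) * V (fst (fst z)) (fst (snd z))"
        using mean_pos V_nonneg by (simp add: h_def abs_mult)
      also have "\<dots> \<le> \<bar>\<phi> (snd (fst z)) * \<phi> (snd (snd z))\<bar> / (2 * mean) * K"
        using mean_pos V_le by (intro mult_left_mono) auto
      also have "\<dots> = norm ((\<phi> (snd (fst z)) * \<phi> (snd (snd z))) * (K / (2 * mean)))"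
        using mean_pos K_nonneg by (simp add: abs_mult)
      finally show "norm (h z) \<le> norm ((\<phi> (snd (fst z)) * \<phi> (snd (snd z))) * (K / (2 * mean)))" .
    qed
  qed
  show "energy \<phi> \<nu> = (\<integral>z. h z \<partial>(\<nu> \<Otimes>\<^sub>M \<nu>))"
    unfolding energy_def NN.integral_fst'[OF ih, symmetric] by (simp add: h_def)
qed

lemma admissible_AE_pair:
  assumes adm: "admissible \<nu>"
  shows "AE z in \<nu> \<Otimes>\<^sub>M \<nu>. 0 < snd (fst z) \<and> 0 < snd (snd z)"
proof -
  interpret N: prob_space \<nu> by (rule admissible_facts[OF adm])
  interpret NN: pair_prob_space \<nu> \<nu> ..
  note [measurable] = admissible_facts(3,4)[OF adm]
  show ?thesis
  proof (rule NN.AE_pair_measure)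
    show "{z \<in> space (\<nu> \<Otimes>\<^sub>M \<nu>). 0 < snd (fst z) \<and> 0 < snd (snd z)} \<in> sets (\<nu> \<Otimes>\<^sub>M \<nu>)" by measurable
    show "AE x in \<nu>. AE y in \<nu>. 0 < snd (fst (x, y)) \<and> 0 < snd (snd (x, y))"
      using admissible_AE_snd[OF adm]
    proof eventually_elim
      case (elim x)
      show ?case using admissible_AE_snd[OF adm] by eventually_elim (use elim in simp)
    qed
  qed
qed

lemma energy_mono:
  assumes adm: "admissible \<nu>" and \<phi>: "\<phi> \<in> borel_measurable borel"
    and \<phi>b: "\<And>x. 0 < x \<Longrightarrow> 0 \<le> \<phi> x" "\<And>x. 0 < x \<Longrightarrow> \<phi> x \<le> x"
  shows "energy \<phi> \<nu> \<le> energy (\<lambda>x. x) \<nu>"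
proof -
  interpret N: prob_space \<nu> by (rule admissible_facts[OF adm])
  interpret NN: pair_prob_space \<nu> \<nu> ..
  note [measurable] = admissible_facts(3,4)[OF adm] \<phi>
  have i\<phi>: "integrable P \<phi>"
  proof (rule Bochner_Integration.integrable_bound[OF integrable_id])
    show "AE x in P. norm (\<phi> x) \<le> norm x" using P_pos by eventually_elim (use \<phi>b in auto)
  qed (use \<phi> in simp)
  let ?h = "\<lambda>\<phi> z. \<phi> (snd (fst z)) * \<phi> (snd (snd z)) / (2 * mean) * V (fst (fst z)) (fst (snd z))"
  note e = energy_pair_integral[OF adm \<phi> i\<phi>] energy_pair_integral[OF adm borel_measurable_id integrable_id]
  note pos = admissible_AE_pair[OF adm]
  show "energy \<phi> \<nu> \<le> energy (\<lambda>x. x) \<nu>"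
    unfolding e(2,4)
  proof (rule integral_mono_AE[OF e(1,3)])
    show "AE z in \<nu> \<Otimes>\<^sub>M \<nu>. ?h \<phi> z \<le> ?h (\<lambda>x. x) z"
      using pos
    proof eventually_elim
      case (elim z)
      then have "\<phi> (snd (fst z)) * \<phi> (snd (snd z)) \<le> snd (fst z) * snd (snd z)"
        using \<phi>b by (intro mult_mono) auto
      then show ?case using mean_pos V_nonneg by (intro mult_right_mono divide_right_mono) auto
    qed
  qed
qed

text \<open>Write x y - \<phi>(x) \<phi>(y) = x (y - \<phi>(y)) + (x - \<phi>(x)) \<phi>(y) and
  bound the differences by \<delta> (1 + x^2). The result depends on \<nu> through its weight
  marginal only and is therefore uniform over all competitors; the two terms contribute the factor 2
  \<open>mean\<close>, which the normalization removes.\<close>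

lemma energy_truncation:
  assumes adm: "admissible \<nu>" and \<phi>: "\<phi> \<in> borel_measurable borel"
    and \<phi>b: "\<And>x. 0 < x \<Longrightarrow> 0 \<le> \<phi> x" "\<And>x. 0 < x \<Longrightarrow> \<phi> x \<le> x" "\<And>x. 0 < x \<Longrightarrow> x - \<phi> x \<le> \<delta> * (1 + x\<^sup>2)"
  shows "energy (\<lambda>x. x) \<nu> \<le> energy \<phi> \<nu> + K * \<delta> * (1 + second_moment)"
proof -
  interpret N: prob_space \<nu> by (rule admissible_facts[OF adm])
  interpret NN: pair_prob_space \<nu> \<nu> ..
  note [measurable] = admissible_facts(3,4)[OF adm] \<phi>
  have i\<phi>: "integrable P \<phi>"
  proof (rule Bochner_Integration.integrable_bound[OF integrable_id])
    show "AE x in P. norm (\<phi> x) \<le> norm x" using P_pos by eventually_elim (use \<phi>b in auto)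
  qed (use \<phi> in simp)
  let ?h = "\<lambda>\<phi> z. \<phi> (snd (fst z)) * \<phi> (snd (snd z)) / (2 * mean) * V (fst (fst z)) (fst (snd z))"
  note e = energy_pair_integral[OF adm \<phi> i\<phi>] energy_pair_integral[OF adm borel_measurable_id integrable_id]
  note pos = admissible_AE_pair[OF adm]
  have i1: "integrable \<nu> (\<lambda>z. snd z)" "(\<integral>z. snd z \<partial>\<nu>) = mean"
    unfolding admissible_snd[OF adm borel_measurable_id] mean_def by (rule integrable_id refl)+
  have i2: "integrable \<nu> (\<lambda>z. 1 + (snd z)\<^sup>2)" "(\<integral>z. 1 + (snd z)\<^sup>2 \<partial>\<nu>) = 1 + second_moment"
  proof -
    have m: "(\<lambda>x. 1 + x\<^sup>2) \<in> borel_measurable (borel :: real measure)" by measurable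
    show "integrable \<nu> (\<lambda>z. 1 + (snd z)\<^sup>2)" "(\<integral>z. 1 + (snd z)\<^sup>2 \<partial>\<nu>) = 1 + second_moment"
      unfolding admissible_snd[OF adm m] second_moment_def using P_square P.prob_space by simp_all
  qed
  let ?r = "\<lambda>z. K * \<delta> / (2 * mean) * (snd (fst z) * (1 + (snd (snd z))\<^sup>2) + (1 + (snd (fst z))\<^sup>2) * snd (snd z))"
  note i12 = NN.integrable_mult_fst_snd[OF i1(1) i2(1)] and i21 = NN.integrable_mult_fst_snd[OF i2(1) i1(1)]
  have ir: "integrable (\<nu> \<Otimes>\<^sub>M \<nu>) ?r" using i12(1) i21(1) by (intro integrable_mult_right Bochner_Integration.integrable_add)
  have "(\<integral>z. ?h (\<lambda>x. x) z \<partial>(\<nu> \<Otimes>\<^sub>M \<nu>)) \<le> (\<integral>z. ?h \<phi> z + ?r z \<partial>(\<nu> \<Otimes>\<^sub>M \<nu>))"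
  proof (rule integral_mono_AE)
    show "integrable (\<nu> \<Otimes>\<^sub>M \<nu>) (?h (\<lambda>x. x))" by (rule e(3))
    show "integrable (\<nu> \<Otimes>\<^sub>M \<nu>) (\<lambda>z. ?h \<phi> z + ?r z)" by (rule Bochner_Integration.integrable_add[OF e(1) ir])
    show "AE z in \<nu> \<Otimes>\<^sub>M \<nu>. ?h (\<lambda>x. x) z \<le> ?h \<phi> z + ?r z"
      using pos
    proof eventually_elim
      case (elim z)
      let ?x = "snd (fst z)" and ?y = "snd (snd z)" and ?v = "V (fst (fst z)) (fst (snd z))"
      have "?x * ?y - \<phi> ?x * \<phi> ?y = ?x * (?y - \<phi> ?y) + (?x - \<phi> ?x) * \<phi> ?y" by (simp add: algebra_simps)
      also have "\<dots> \<le> ?x * (\<delta> * (1 + ?y\<^sup>2)) + (\<delta> * (1 + ?x\<^sup>2)) * ?y"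
      proof (intro add_mono mult_mono)
        show "0 \<le> \<delta> * (1 + ?x\<^sup>2)" using \<phi>b(2,3)[of ?x] elim by linarith
      qed (use elim \<phi>b in auto)
      finally have d: "?x * ?y - \<phi> ?x * \<phi> ?y \<le> \<delta> * (?x * (1 + ?y\<^sup>2) + (1 + ?x\<^sup>2) * ?y)" (is "_ \<le> ?R")
        by (simp add: algebra_simps)
      have d0: "0 \<le> ?x * ?y - \<phi> ?x * \<phi> ?y"
        using mult_mono[of "\<phi> ?x" ?x "\<phi> ?y" ?y] elim \<phi>b by auto
      have "(?x * ?y - \<phi> ?x * \<phi> ?y) * ?v \<le> ?R * K"
        using d d0 V_nonneg V_le by (intro mult_mono) auto
      then have "(?x * ?y - \<phi> ?x * \<phi> ?y) * ?v / (2 * mean) \<le> ?R * K / (2 * mean)"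
        using mean_pos by (intro divide_right_mono) auto
      moreover have "?h (\<lambda>x. x) z - ?h \<phi> z = (?x * ?y - \<phi> ?x * \<phi> ?y) * ?v / (2 * mean)"
        by (simp add: diff_divide_distrib left_diff_distrib)
      moreover have "?r z = ?R * K / (2 * mean)" by simp
      ultimately show ?case by linarith
    qed
  qed
  also have "\<dots> = (\<integral>z. ?h \<phi> z \<partial>(\<nu> \<Otimes>\<^sub>M \<nu>)) + (\<integral>z. ?r z \<partial>(\<nu> \<Otimes>\<^sub>M \<nu>))"
    by (rule Bochner_Integration.integral_add[OF e(1) ir])
  also have "(\<integral>z. ?r z \<partial>(\<nu> \<Otimes>\<^sub>M \<nu>)) = K * \<delta> / (2 * mean) * (mean * (1 + second_moment) + (1 + second_moment) * mean)"
    unfolding integral_mult_right_zero Bochner_Integration.integral_add[OF i12(1) i21(1)] i12(2) i21(2) i1(2) i2(2) ..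
  also have "\<dots> = K * \<delta> * (1 + second_moment)" using mean_pos by (simp add: field_simps)
  finally show "energy (\<lambda>x. x) \<nu> \<le> energy \<phi> \<nu> + K * \<delta> * (1 + second_moment)"
    unfolding e(2,4) .
qed

text \<open>As entropies are nonnegative, this is the upper bound that makes the supremum in the
  variational formula finite.\<close>

lemma energy_le:
  assumes adm: "admissible \<nu>" shows "energy (\<lambda>x. x) \<nu> \<le> K * mean / 2"
proof -
  interpret N: prob_space \<nu> by (rule admissible_facts[OF adm])
  interpret NN: pair_prob_space \<nu> \<nu> ..
  have i1: "integrable \<nu> (\<lambda>z. snd z)" "(\<integral>z. snd z \<partial>\<nu>) = mean"
    unfolding admissible_snd[OF adm borel_measurable_id] mean_def by (rule integrable_id refl)+
  note ii = NN.integrable_mult_fst_snd[OF i1(1) i1(1)]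
  note [measurable] = admissible_facts(3,4)[OF adm]
  note e = energy_pair_integral[OF adm borel_measurable_id integrable_id]
  note pos = admissible_AE_pair[OF adm]
  have "energy (\<lambda>x. x) \<nu> \<le> (\<integral>z. K / (2 * mean) * (snd (fst z) * snd (snd z)) \<partial>(\<nu> \<Otimes>\<^sub>M \<nu>))"
    unfolding e(2)
  proof (rule integral_mono_AE[OF e(1)])
    show "AE z in \<nu> \<Otimes>\<^sub>M \<nu>. snd (fst z) * snd (snd z) / (2 * mean) * V (fst (fst z)) (fst (snd z)) \<le> K / (2 * mean) * (snd (fst z) * snd (snd z))"
      using pos
    proof eventually_elim
      case (elim z)
      have "snd (fst z) * snd (snd z) / (2 * mean) * V (fst (fst z)) (fst (snd z)) \<le> snd (fst z) * snd (snd z) / (2 * mean) * K"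
        using elim V_le mean_pos by (intro mult_left_mono) auto
      then show ?case by (simp add: mult_ac)
    qed
  qed (use ii(1) in simp)
  also have "\<dots> = K / (2 * mean) * (mean * mean)" unfolding integral_mult_right_zero ii(2) i1(2) ..
  finally show ?thesis using mean_pos by simp
qed

end

section \<open>Weights grouped into finitely many classes\<close>

locale discretized_mean_field = mean_field +
  fixes b :: "real \<Rightarrow> nat" and B :: nat and c :: "nat \<Rightarrow> real"
  assumes b_measurable[measurable]: "b \<in> borel \<rightarrow>\<^sub>M count_space UNIV"
    and b_le: "\<And>x. b x \<le> B" and c_nonneg: "\<And>k. 0 \<le> c k"
begin

definition mass :: "nat \<Rightarrow> real" where "mass k = measure P {x. b x = k}"

definition class_energy :: "(nat \<Rightarrow> 'a \<Rightarrow> real) \<Rightarrow> real" where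
  "class_energy f = (\<Sum>k\<le>B. \<Sum>l\<le>B. c k * c l / (2 * mean) * (mass k * mass l) *
     (\<integral>z. V (fst z) (snd z) * (f k (fst z) * f l (snd z)) \<partial>(\<alpha> \<Otimes>\<^sub>M \<alpha>)))"

lemma class_sets[measurable]: "{x. b x = k} \<in> sets borel"
  using measurable_sets[OF b_measurable, of "{k}"] by (simp add: vimage_def)

lemma mass_nonneg: "0 \<le> mass k" by (simp add: mass_def)

lemma sum_classes: "F (b x) = (\<Sum>k\<le>B. F k * indicator {x. b x = k} x)" for F :: "nat \<Rightarrow> 'b :: semiring_1"
proof -
  have "(\<Sum>k\<le>B. F k * indicator {x. b x = k} x) = (\<Sum>k\<in>{b x}. F k * indicator {x. b x = k} x)"
    using b_le[of x] by (intro sum.mono_neutral_right) auto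
  then show ?thesis by simp
qed

text \<open>\<open>f k\<close> is the density of the spin given the class, not given the weight: it
  belongs to the average of the conditional laws over class \<open>k\<close>. For a class of mass
  zero the identity does not determine it.\<close>

definition has_class_densities :: "('a \<times> real) measure \<Rightarrow> (nat \<Rightarrow> 'a \<Rightarrow> real) \<Rightarrow> bool" where
  "has_class_densities \<nu> f \<longleftrightarrow> (\<forall>k\<le>B. integrable \<alpha> (f k) \<and> (\<forall>s. 0 \<le> f k s) \<and>
     (\<forall>A\<in>sets borel. emeasure \<nu> (A \<times> {x. b x = k}) = ennreal (mass k) * (\<integral>\<^sup>+s. ennreal (f k s) * indicator A s \<partial>\<alpha>)))"

lemma has_class_densities_integral:
  assumes adm: "admissible \<nu>" and f: "has_class_densities \<nu> f" and k: "k \<le> B" and g: "g \<in> borel_measurable borel"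
  shows "(\<integral>z. g (fst z) * indicator {x. b x = k} (snd z) \<partial>\<nu>) = mass k * (\<integral>s. g s * f k s \<partial>\<alpha>)"
proof (rule class_density_integral[OF admissible_facts(2)[OF adm] sets_\<alpha> class_sets])
  have "integrable \<alpha> (f k)" using f k unfolding has_class_densities_def by blast
  then show "f k \<in> borel_measurable \<alpha>" by (rule borel_measurable_integrable)
qed (use f k g mass_nonneg in \<open>unfold has_class_densities_def, blast+\<close>)

text \<open>With class values the integrand depends on the weights through their classes only, so
  \<nu> enters through its restrictions to single classes. Integrating the second argument for a
  fixed first spin yields the functions \<open>H\<close>, which are bounded; the first argument is
  then treated in the same way.\<close>

lemma energy_class_energy:
  assumes adm: "admissible \<nu>" and f: "has_class_densities \<nu> f"
  shows "energy (\<lambda>x. c (b x)) \<nu> = class_energy f"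
proof -
  interpret N: prob_space \<nu> by (rule admissible_facts[OF adm])
  note [measurable] = admissible_facts(3,4)[OF adm]
  have fi: "integrable \<alpha> (f k)" and f0: "0 \<le> f k s" if "k \<le> B" for k s
    using f that unfolding has_class_densities_def by blast+
  define H where "H l s = (\<integral>s'. V s s' * f l s' \<partial>\<alpha>)" for l s
  have Vs: "(\<lambda>s'. V s s') \<in> borel_measurable borel" for s
    by (rule V_comp) auto
  have Vs\<alpha>: "(\<lambda>s'. V s s') \<in> borel_measurable \<alpha>" for s
    using Vs by (simp add: measurable_cong_sets[OF sets_\<alpha> refl])
  have iV: "integrable (\<alpha> \<Otimes>\<^sub>M \<alpha>) (\<lambda>z. V (fst z) (snd z) * (f k (fst z) * f l (snd z)))" if "k \<le> B" "l \<le> B" for k l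
  proof (rule Bochner_Integration.integrable_bound)
    have i: "integrable (\<alpha> \<Otimes>\<^sub>M \<alpha>) (\<lambda>z. f k (fst z) * f l (snd z))"
      using AA.integrable_mult_fst_snd(1)[OF fi[OF that(1)] fi[OF that(2)]] .
    then show "integrable (\<alpha> \<Otimes>\<^sub>M \<alpha>) (\<lambda>z. K * (f k (fst z) * f l (snd z)))" by simp
    show "(\<lambda>z. V (fst z) (snd z) * (f k (fst z) * f l (snd z))) \<in> borel_measurable (\<alpha> \<Otimes>\<^sub>M \<alpha>)"
      using fi[OF that(1), THEN borel_measurable_integrable] fi[OF that(2), THEN borel_measurable_integrable] by measurable
    show "AE z in \<alpha> \<Otimes>\<^sub>M \<alpha>. norm (V (fst z) (snd z) * (f k (fst z) * f l (snd z))) \<le> norm (K * (f k (fst z) * f l (snd z)))"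
      using V_nonneg V_le K_nonneg by (intro AE_I2) (auto simp: abs_mult intro!: mult_right_mono)
  qed
  have Hm: "H l \<in> borel_measurable \<alpha>" if "l \<le> B" for l
  proof -
    have "(\<lambda>(s, s'). V s s' * f l s') \<in> borel_measurable (\<alpha> \<Otimes>\<^sub>M \<alpha>)"
      unfolding split_beta using fi[OF that, THEN borel_measurable_integrable] by measurable
    then show ?thesis unfolding H_def by (rule A.borel_measurable_lebesgue_integral)
  qed
  then have Hb: "H l \<in> borel_measurable borel" if "l \<le> B" for l
    using that by (simp add: measurable_cong_sets[OF sets_\<alpha> refl])
  have HK: "\<bar>H l s\<bar> \<le> K * (\<integral>s. f l s \<partial>\<alpha>)" if "l \<le> B" for l s
  proof -
    have i: "integrable \<alpha> (\<lambda>s'. V s s' * f l s')"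
    proof (rule Bochner_Integration.integrable_bound)
      show "integrable \<alpha> (\<lambda>s'. K * f l s')" using fi[OF that] by simp
      show "AE x in \<alpha>. norm (V s x * f l x) \<le> norm (K * f l x)"
        using V_nonneg V_le K_nonneg by (intro AE_I2) (auto simp: abs_mult intro!: mult_right_mono)
    qed (use fi[OF that] Vs\<alpha> in auto)
    have "H l s \<le> (\<integral>s'. K * f l s' \<partial>\<alpha>)" unfolding H_def
      using i fi[OF that] V_le f0[OF that] by (intro integral_mono) (auto intro: mult_right_mono)
    moreover have "0 \<le> H l s" unfolding H_def using V_nonneg f0[OF that] by (intro Bochner_Integration.integral_nonneg) auto
    ultimately show ?thesis by simp
  qed
  have HH: "(\<integral>s. H l s * f k s \<partial>\<alpha>) = (\<integral>z. V (fst z) (snd z) * (f k (fst z) * f l (snd z)) \<partial>(\<alpha> \<Otimes>\<^sub>M \<alpha>))" if "k \<le> B" "l \<le> B" for k l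
  proof -
    have "(\<integral>s. H l s * f k s \<partial>\<alpha>) = (\<integral>s. (\<integral>s'. V s s' * (f k s * f l s') \<partial>\<alpha>) \<partial>\<alpha>)"
      unfolding H_def integral_mult_left_zero[symmetric]
      by (intro Bochner_Integration.integral_cong refl) (simp only: mult_ac)
    then show ?thesis using AA.integral_fst'[OF iV[OF that]] by simp
  qed
  have inner: "(\<integral>z'. c (b (snd z')) * V s (fst z') \<partial>\<nu>) = (\<Sum>l\<le>B. c l * (mass l * H l s))" for s
  proof -
    have "(\<integral>z'. c (b (snd z')) * V s (fst z') \<partial>\<nu>) = (\<integral>z'. (\<Sum>l\<le>B. c l * (V s (fst z') * indicator {x. b x = l} (snd z'))) \<partial>\<nu>)"
      by (intro Bochner_Integration.integral_cong refl, subst sum_classes[of c]) (unfold sum_distrib_right, intro sum.cong refl, simp only: mult_ac)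
    also have "\<dots> = (\<Sum>l\<le>B. \<integral>z'. c l * (V s (fst z') * indicator {x. b x = l} (snd z')) \<partial>\<nu>)"
    proof (rule Bochner_Integration.integral_sum)
      fix l assume "l \<in> {..B}"
      have "integrable \<nu> (\<lambda>z'. V s (fst z') * indicator {x. b x = l} (snd z'))"
      proof (rule N.integrable_const_bound[where B=K])
        show "AE z in \<nu>. norm (V s (fst z) * indicator {x. b x = l} (snd z)) \<le> K"
          using V_nonneg V_le K_nonneg by (intro AE_I2) (auto simp: indicator_def)
        show "(\<lambda>z'. V s (fst z') * indicator {x. b x = l} (snd z')) \<in> borel_measurable \<nu>"
          using measurable_compose[OF admissible_facts(3)[OF adm] Vs[of s]] by measurable
      qed
      then show "integrable \<nu> (\<lambda>z'. c l * (V s (fst z') * indicator {x. b x = l} (snd z')))" by simp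
    qed
    also have "\<dots> = (\<Sum>l\<le>B. c l * (mass l * H l s))"
      using has_class_densities_integral[OF adm f _ Vs[of s]] by (intro sum.cong refl) (simp add: H_def)
    finally show ?thesis .
  qed
  have "energy (\<lambda>x. c (b x)) \<nu> = (\<integral>z. c (b (snd z)) / (2 * mean) * (\<integral>z'. c (b (snd z')) * V (fst z) (fst z') \<partial>\<nu>) \<partial>\<nu>)"
    unfolding energy_def
    by (intro Bochner_Integration.integral_cong refl, subst integral_mult_right_zero[symmetric])
      (intro Bochner_Integration.integral_cong refl, simp)
  also have "\<dots> = (\<integral>z. (\<Sum>k\<le>B. \<Sum>l\<le>B. (c k * c l / (2 * mean) * mass l) * (H l (fst z) * indicator {x. b x = k} (snd z))) \<partial>\<nu>)"
    unfolding inner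
    by (intro Bochner_Integration.integral_cong refl, subst sum_classes[of c])
      (unfold sum_divide_distrib sum_product, intro sum.cong refl, simp)
  also have "\<dots> = (\<Sum>k\<le>B. \<Sum>l\<le>B. \<integral>z. (c k * c l / (2 * mean) * mass l) * (H l (fst z) * indicator {x. b x = k} (snd z)) \<partial>\<nu>)"
  proof -
    have i: "integrable \<nu> (\<lambda>z. (c k * c l / (2 * mean) * mass l) * (H l (fst z) * indicator {x. b x = k} (snd z)))" if "l \<le> B" for k l
    proof -
      have "integrable \<nu> (\<lambda>z. H l (fst z) * indicator {x. b x = k} (snd z))"
      proof (rule N.integrable_const_bound[where B="K * (\<integral>s. f l s \<partial>\<alpha>)"])
        show "AE z in \<nu>. norm (H l (fst z) * indicator {x. b x = k} (snd z)) \<le> K * (\<integral>s. f l s \<partial>\<alpha>)"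
          using HK[OF that] by (intro AE_I2) (auto simp: indicator_def intro: order_trans[OF abs_ge_zero])
        show "(\<lambda>z. H l (fst z) * indicator {x. b x = k} (snd z)) \<in> borel_measurable \<nu>"
          using measurable_compose[OF admissible_facts(3)[OF adm] Hb[OF that]] by measurable
      qed
      then show ?thesis by simp
    qed
    show ?thesis
      by (rule trans[OF Bochner_Integration.integral_sum sum.cong[OF refl Bochner_Integration.integral_sum]])
        (rule Bochner_Integration.integrable_sum i | simp only: atMost_iff)+
  qed
  also have "\<dots> = class_energy f"
    unfolding class_energy_def
    by (intro sum.cong refl) (simp add: has_class_densities_integral[OF adm f _ Hb] HH)
  finally show ?thesis .
qed

text \<open>The measure with conditional densities \<open>f (b x)\<close> is a competitor in the variational formula.\<close>

lemma class_energy_le: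
  assumes s: "\<And>\<nu>. admissible \<nu> \<Longrightarrow> ereal (energy (\<lambda>x. x) \<nu>) - enn2ereal (mean_conditional_entropy \<alpha> \<nu>) \<le> ereal s"
    and cb: "\<And>x. 0 < x \<Longrightarrow> c (b x) \<le> x"
    and f[measurable]: "\<And>k. f k \<in> borel_measurable \<alpha>" and f0: "\<And>k x. 0 \<le> f k x" and fL: "\<And>k x. f k x \<le> L"
    and f1: "\<And>k. (\<integral>x. f k x \<partial>\<alpha>) = 1"
  shows "class_energy f - (\<Sum>k\<le>B. mass k * (\<integral>x. f k x * ln (f k x) \<partial>\<alpha>)) \<le> s"
proof -
  interpret AP: pair_prob_space \<alpha> P ..
  define h where "h k = (\<integral>x. f k x * ln (f k x) \<partial>\<alpha>)" for k
  define u where "u z = f (b (snd z)) (fst z)" for z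
  define \<nu> where "\<nu> = density (\<alpha> \<Otimes>\<^sub>M P) (\<lambda>z. ennreal (u z))"
  have bP[measurable]: "b \<in> P \<rightarrow>\<^sub>M count_space UNIV" using b_measurable by simp
  have um[measurable]: "u \<in> borel_measurable (\<alpha> \<Otimes>\<^sub>M P)"
    unfolding u_def by (rule measurable_compose_countable) measurable
  have fi: "integrable \<alpha> (f k)" for k
    using f0 fL by (intro A.integrable_const_bound[where B=L]) auto
  have f1': "(\<integral>\<^sup>+x. ennreal (f k x) \<partial>\<alpha>) = 1" for k
    using f1 f0 fi by (subst nn_integral_eq_integral) auto
  have sets_\<nu>: "sets \<nu> = sets borel"
    unfolding \<nu>_def sets_density borel_prod[symmetric] by (intro sets_pair_measure_cong sets_\<alpha>) simp
  have em: "emeasure \<nu> (A \<times> S) = (\<integral>\<^sup>+x. (\<integral>\<^sup>+s. ennreal (f (b x) s) * indicator A s \<partial>\<alpha>) * indicator S x \<partial>P)"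
    if [measurable]: "A \<in> sets borel" "S \<in> sets borel" for A S
  proof -
    have A[measurable]: "A \<in> sets \<alpha>" and S[measurable]: "S \<in> sets P" using that sets_\<alpha> by auto
    have "emeasure \<nu> (A \<times> S) = (\<integral>\<^sup>+z. ennreal (u z) * indicator (A \<times> S) z \<partial>(\<alpha> \<Otimes>\<^sub>M P))"
      unfolding \<nu>_def by (rule emeasure_density) auto
    also have "\<dots> = (\<integral>\<^sup>+x. (\<integral>\<^sup>+s. ennreal (u (s, x)) * indicator (A \<times> S) (s, x) \<partial>\<alpha>) \<partial>P)"
      by (rule AP.nn_integral_snd[symmetric]) measurable
    also have "\<dots> = (\<integral>\<^sup>+x. (\<integral>\<^sup>+s. (ennreal (f (b x) s) * indicator A s) * indicator S x \<partial>\<alpha>) \<partial>P)"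
      by (intro nn_integral_cong) (simp add: u_def indicator_times mult.assoc)
    also have "\<dots> = (\<integral>\<^sup>+x. (\<integral>\<^sup>+s. ennreal (f (b x) s) * indicator A s \<partial>\<alpha>) * indicator S x \<partial>P)"
      by (intro nn_integral_cong nn_integral_multc) measurable
    finally show ?thesis .
  qed
  have space_\<nu>: "space \<nu> = UNIV" using sets_eq_imp_space_eq[OF sets_\<nu>] by simp
  have prob\<nu>: "prob_space \<nu>"
  proof (rule prob_spaceI)
    have "emeasure \<nu> (UNIV \<times> UNIV) = (\<integral>\<^sup>+x. 1 \<partial>P)" by (subst em) (auto simp: f1')
    then show "emeasure \<nu> (space \<nu>) = 1" using P.emeasure_space_1 by (simp add: space_\<nu>)
  qed
  have sndm: "snd \<in> \<nu> \<rightarrow>\<^sub>M borel" unfolding measurable_cong_sets[OF sets_\<nu> refl] borel_prod[symmetric] by measurable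
  have marg: "distr \<nu> borel snd = P"
  proof (rule measure_eqI)
    fix S assume "S \<in> sets (distr \<nu> borel snd)"
    then have S: "S \<in> sets borel" by simp
    have "emeasure (distr \<nu> borel snd) S = emeasure \<nu> (UNIV \<times> S)"
      using sndm S by (subst emeasure_distr) (auto simp: space_\<nu> vimage_def intro!: arg_cong2[where f=emeasure])
    also have "\<dots> = (\<integral>\<^sup>+x. indicator S x \<partial>P)" using S by (subst em) (auto simp: f1')
    also have "\<dots> = emeasure P S" using S by simp
    finally show "emeasure (distr \<nu> borel snd) S = emeasure P S" .
  qed simp
  have adm: "admissible \<nu>"
    unfolding admissible_def weight_marginal_def space_prob_algebra using prob\<nu> sets_\<nu> marg by simp
  have dens: "has_class_densities \<nu> f"
    unfolding has_class_densities_def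
  proof (intro allI impI conjI ballI fi f0)
    fix k A assume A: "A \<in> sets (borel :: 'a measure)"
    have "emeasure \<nu> (A \<times> {x. b x = k}) = (\<integral>\<^sup>+x. (\<integral>\<^sup>+s. ennreal (f (b x) s) * indicator A s \<partial>\<alpha>) * indicator {x. b x = k} x \<partial>P)"
      by (rule em[OF A class_sets])
    also have "\<dots> = (\<integral>\<^sup>+x. (\<integral>\<^sup>+s. ennreal (f k s) * indicator A s \<partial>\<alpha>) * indicator {x. b x = k} x \<partial>P)"
      by (intro nn_integral_cong) (auto simp: indicator_def)
    also have "\<dots> = (\<integral>\<^sup>+s. ennreal (f k s) * indicator A s \<partial>\<alpha>) * emeasure P {x. b x = k}"
      by (subst nn_integral_cmult) auto
    also have "\<dots> = ennreal (mass k) * (\<integral>\<^sup>+s. ennreal (f k s) * indicator A s \<partial>\<alpha>)"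
      by (simp add: mass_def P.emeasure_eq_measure mult.commute)
    finally show "emeasure \<nu> (A \<times> {x. b x = k}) = ennreal (mass k) * (\<integral>\<^sup>+s. ennreal (f k s) * indicator A s \<partial>\<alpha>)" .
  qed
  let ?\<kappa> = "\<lambda>k. density \<alpha> (\<lambda>s. ennreal (f k s))"
  have \<kappa>p: "prob_space (?\<kappa> k)" for k
    by (rule prob_spaceI) (simp add: emeasure_density f1' cong: nn_integral_cong)
  have reg: "regular_conditional_law \<nu> (\<lambda>x. ?\<kappa> (b x))"
    unfolding regular_conditional_law_def weight_marginal_def marg
  proof (intro conjI ballI)
    \<comment> \<open>The conditional law factors through the discrete class index, which settles
      its measurability.\<close>
    have "?\<kappa> \<in> count_space UNIV \<rightarrow>\<^sub>M prob_algebra borel"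
      using \<kappa>p sets_\<alpha> by (simp add: measurable_count_space_eq1 space_prob_algebra)
    then show "(\<lambda>x. ?\<kappa> (b x)) \<in> borel \<rightarrow>\<^sub>M prob_algebra borel"
      by (rule measurable_compose[OF b_measurable])
    fix A :: "'a set" and S :: "real set" assume AS: "A \<in> sets borel" "S \<in> sets borel"
    have "A \<in> sets \<alpha>" using AS sets_\<alpha> by simp
    then show "emeasure \<nu> (A \<times> S) = (\<integral>\<^sup>+x\<in>S. emeasure (?\<kappa> (b x)) A \<partial>P)"
      unfolding em[OF AS] by (intro nn_integral_cong) (simp add: emeasure_density)
  qed
  have flb: "\<bar>f k x * ln (f k x)\<bar> \<le> 1 + L * \<bar>ln L\<bar>" for k x
  proof (cases "f k x = 0")
    case True then show ?thesis using f0[of k x] fL[of k x] by simp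
  next
    case False
    then have p: "0 < f k x" using f0[of k x] by simp
    have "ln (inverse (f k x)) \<le> inverse (f k x) - 1" using p by (intro ln_le_minus_one) simp
    then have "f k x * (- ln (f k x)) \<le> f k x * (inverse (f k x) - 1)" using p by (intro mult_left_mono) (auto simp: ln_inverse)
    also have "\<dots> \<le> 1" using p by (simp add: right_diff_distrib)
    finally have 1: "- (f k x * ln (f k x)) \<le> 1" by simp
    have "ln (f k x) \<le> \<bar>ln L\<bar>" using p fL[of k x] ln_le_cancel_iff[of "f k x" L] by linarith
    then have "f k x * ln (f k x) \<le> f k x * \<bar>ln L\<bar>" using p by (intro mult_left_mono) auto
    also have "\<dots> \<le> L * \<bar>ln L\<bar>" using fL by (intro mult_right_mono) auto
    finally have 2: "f k x * ln (f k x) \<le> L * \<bar>ln L\<bar>" .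
    have "0 \<le> L * \<bar>ln L\<bar>" using p fL[of k x] by simp
    then show ?thesis using 1 2 unfolding abs_le_iff by linarith
  qed
  have fli: "integrable \<alpha> (\<lambda>x. f k x * ln (f k x))" for k
    using flb by (intro A.integrable_const_bound[where B="1 + L * \<bar>ln L\<bar>"]) auto
  have h0: "0 \<le> h k" for k
  proof -
    have "(\<integral>x. f k x - 1 \<partial>\<alpha>) \<le> h k" unfolding h_def
    proof (rule integral_mono)
      fix x
      show "f k x - 1 \<le> f k x * ln (f k x)"
      proof (cases "f k x = 0")
        case False
        then have p: "0 < f k x" using f0[of k x] by simp
        have "ln (inverse (f k x)) \<le> inverse (f k x) - 1" using p by (intro ln_le_minus_one) simp
        then have "f k x * (- ln (f k x)) \<le> f k x * (inverse (f k x) - 1)" using p by (intro mult_left_mono) (auto simp: ln_inverse)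
        also have "\<dots> = 1 - f k x" using p by (simp add: right_diff_distrib)
        finally show ?thesis by simp
      qed simp
    qed (use fi fli in auto)
    then show ?thesis using fi f1 by (simp add: A.prob_space)
  qed
  have ent: "relative_entropy (?\<kappa> k) \<alpha> \<le> ennreal (h k)" for k
  proof -
    have ac: "absolutely_continuous \<alpha> (?\<kappa> k)" by (rule absolutely_continuousI_density) simp
    have KL: "KL_divergence (exp 1) \<alpha> (?\<kappa> k) = h k"
      using A.KL_density[where f="f k" and b="exp 1"] f0 by (simp add: h_def log_def)
    have ae: "AE x in \<alpha>. ennreal (f k x) = RN_deriv \<alpha> (?\<kappa> k) x"
      by (rule A.RN_deriv_unique) auto
    have "integrable \<alpha> (\<lambda>x. f k x * entropy_density (exp 1) \<alpha> (?\<kappa> k) x)"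
    proof (subst integrable_cong_AE)
      show "AE x in \<alpha>. f k x * entropy_density (exp 1) \<alpha> (?\<kappa> k) x = f k x * ln (f k x)"
        using ae
      proof eventually_elim
        case (elim x)
        show ?case unfolding entropy_density_def comp_def elim[symmetric] using f0[of k x] by (simp add: log_def)
      qed
    qed (use fli in auto)
    then have "integrable (?\<kappa> k) (entropy_density (exp 1) \<alpha> (?\<kappa> k))"
      using f0 by (subst integrable_real_density) auto
    then show ?thesis using ac KL by (simp add: relative_entropy_def)
  qed
  have mce: "mean_conditional_entropy \<alpha> \<nu> \<le> ennreal (\<Sum>k\<le>B. mass k * h k)"
  proof -
    have "mean_conditional_entropy \<alpha> \<nu> \<le> (\<integral>\<^sup>+x. relative_entropy (?\<kappa> (b x)) \<alpha> \<partial>weight_marginal \<nu>)"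
      unfolding mean_conditional_entropy_def using reg by (intro Inf_lower CollectI exI[of _ "\<lambda>x. ?\<kappa> (b x)"]) auto
    also have "\<dots> = (\<integral>\<^sup>+x. relative_entropy (?\<kappa> (b x)) \<alpha> \<partial>P)" by (simp add: weight_marginal_def marg)
    also have "\<dots> \<le> (\<integral>\<^sup>+x. ennreal (h (b x)) \<partial>P)" by (intro nn_integral_mono ent)
    also have "\<dots> = (\<integral>\<^sup>+x. (\<Sum>k\<le>B. ennreal (h k) * indicator {x. b x = k} x) \<partial>P)"
      by (intro nn_integral_cong sum_classes)
    also have "\<dots> = (\<Sum>k\<le>B. ennreal (h k) * emeasure P {x. b x = k})"
      by (subst nn_integral_sum) (auto intro!: sum.cong simp: nn_integral_cmult)
    also have "\<dots> = ennreal (\<Sum>k\<le>B. mass k * h k)"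
      using h0 mass_nonneg by (simp add: mass_def P.emeasure_eq_measure mult.commute flip: sum_ennreal ennreal_mult)
    finally show ?thesis .
  qed
  have Hn: "0 \<le> (\<Sum>k\<le>B. mass k * h k)" using h0 mass_nonneg by (intro sum_nonneg) auto
  have "ereal (energy (\<lambda>x. x) \<nu>) - ereal (\<Sum>k\<le>B. mass k * h k) \<le> ereal (energy (\<lambda>x. x) \<nu>) - enn2ereal (mean_conditional_entropy \<alpha> \<nu>)"
    using mce Hn by (intro ereal_minus_mono order_refl) (metis enn2ereal_ennreal less_eq_ennreal.rep_eq)
  also have "\<dots> \<le> ereal s" by (rule s[OF adm])
  finally have "energy (\<lambda>x. x) \<nu> - (\<Sum>k\<le>B. mass k * h k) \<le> s" by simp
  \<comment> \<open>Here the class values must not exceed the weights: the class energy is then at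
    most the true energy, so the passage to classes causes no error in this direction.\<close>
  moreover have "class_energy f \<le> energy (\<lambda>x. x) \<nu>"
  proof -
    have "(\<lambda>x. c (b x)) \<in> borel_measurable borel" by measurable
    from energy_mono[OF adm this c_nonneg cb] show ?thesis using energy_class_energy[OF adm dens] by simp
  qed
  ultimately show ?thesis by (simp add: h_def)
qed

end

section \<open>Trial densities\<close>

text \<open>f is clipped to the interval from 1 / k to k and divided by the mass Z of the result.
  The last property bounds the entropy of g by the integral of f ln g and avoids f ln f, which need
  not be integrable. It holds because clipping moves f against the sign of ln g: above k one has g =
  k / Z \<ge> 1, and below 1 / k one has g = 1 / (k Z) \<le> 1, as 1 / k \<le> Z \<le> k.\<close>

lemma clipped_density:
  fixes f :: "'a \<Rightarrow> real"
  assumes \<alpha>: "prob_space \<alpha>" and f[measurable]: "f \<in> borel_measurable \<alpha>" and f0: "\<And>x. 0 \<le> f x"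
    and fi: "integrable \<alpha> f" and f1: "(\<integral>x. f x \<partial>\<alpha>) = 1" and \<eta>: "0 < \<eta>"
  obtains g lo hi Z where "g \<in> borel_measurable \<alpha>" "0 < lo" "\<And>x. lo \<le> g x" "\<And>x. g x \<le> hi"
    "(\<integral>x. g x \<partial>\<alpha>) = 1" "(\<integral>x. \<bar>f x - g x\<bar> \<partial>\<alpha>) \<le> \<eta>" "1 - \<eta> \<le> Z" "\<And>x. Z * (g x * ln (g x)) \<le> f x * ln (g x)"
proof -
  interpret A: prob_space \<alpha> by fact
  define C where "C n x = max (1 / real (Suc n)) (min (f x) (real (Suc n)))" for n x
  have Cm[measurable]: "C n \<in> borel_measurable \<alpha>" for n unfolding C_def by measurable
  have Cb: "1 / real (Suc n) \<le> C n x" "C n x \<le> real (Suc n)" for n x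
  proof -
    have "1 / real (Suc n) \<le> real (Suc n)" by (simp add: field_simps)
    then show "1 / real (Suc n) \<le> C n x" "C n x \<le> real (Suc n)" by (auto simp: C_def)
  qed
  have Cf: "\<bar>C n x\<bar> \<le> f x + 1" for n x
  proof -
    have "1 / real (Suc n) \<le> 1" "0 < 1 / real (Suc n)" by auto
    then show ?thesis using f0[of x] unfolding C_def by linarith
  qed
  have Ci: "integrable \<alpha> (C n)" for n
  proof (rule Bochner_Integration.integrable_bound)
    show "integrable \<alpha> (\<lambda>x. f x + 1)" using fi by simp
    show "AE x in \<alpha>. norm (C n x) \<le> norm (f x + 1)"
    proof (rule AE_I2)
      fix x show "norm (C n x) \<le> norm (f x + 1)" using Cf[of n x] f0[of x] by simp
    qed
  qed measurable
  have "(\<lambda>n. \<integral>x. \<bar>f x - C n x\<bar> \<partial>\<alpha>) \<longlonglongrightarrow> (\<integral>x. 0 \<partial>\<alpha>)"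
  proof (rule integral_dominated_convergence[where w="\<lambda>x. 2 * f x + 1"])
    show "AE x in \<alpha>. (\<lambda>n. \<bar>f x - C n x\<bar>) \<longlonglongrightarrow> 0"
    proof (rule AE_I2)
      fix x
      have "(\<lambda>n. 1 / real (Suc n)) \<longlonglongrightarrow> 0" using LIMSEQ_inverse_real_of_nat by (simp add: inverse_eq_divide)
      moreover obtain k :: nat where k: "f x \<le> real k" using real_arch_simple by blast
      have "\<bar>f x - C n x\<bar> \<le> 1 / real (Suc n)" if "k \<le> n" for n
      proof -
        have "min (f x) (real (Suc n)) = f x" using that k by simp
        then show ?thesis using f0[of x] unfolding C_def by (auto simp: max_def)
      qed
      then have "\<forall>\<^sub>F n in sequentially. norm \<bar>f x - C n x\<bar> \<le> 1 / real (Suc n)"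
        by (auto simp: eventually_sequentially)
      ultimately show "(\<lambda>n. \<bar>f x - C n x\<bar>) \<longlonglongrightarrow> 0" by (rule Lim_null_comparison[rotated])
    qed
    show "AE x in \<alpha>. norm \<bar>f x - C n x\<bar> \<le> 2 * f x + 1" for n
    proof (rule AE_I2)
      fix x show "norm \<bar>f x - C n x\<bar> \<le> 2 * f x + 1"
        unfolding real_norm_def abs_idempotent using Cf[of n x] f0[of x] by linarith
    qed
  qed (use fi in auto)
  then have "\<forall>\<^sub>F n in sequentially. dist (\<integral>x. \<bar>f x - C n x\<bar> \<partial>\<alpha>) 0 < \<eta> / 2"
    using \<eta> by (intro tendstoD) auto
  then obtain n where n: "(\<integral>x. \<bar>f x - C n x\<bar> \<partial>\<alpha>) < \<eta> / 2"
    by (auto simp: eventually_sequentially)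
  define k where "k = real (Suc n)"
  have k: "0 < k" by (simp add: k_def)
  note Cb' = Cb[of n, folded k_def]
  define Z where "Z = (\<integral>x. C n x \<partial>\<alpha>)"
  have dZ: "\<bar>1 - Z\<bar> \<le> (\<integral>x. \<bar>f x - C n x\<bar> \<partial>\<alpha>)"
  proof -
    have "1 - Z = (\<integral>x. f x - C n x \<partial>\<alpha>)" using fi Ci f1 by (simp add: Z_def)
    then show ?thesis using integral_abs_bound[of \<alpha> "\<lambda>x. f x - C n x"] by simp
  qed
  have Zb: "1 / k \<le> Z" "Z \<le> k"
  proof -
    have "(\<integral>x. 1 / k \<partial>\<alpha>) \<le> Z" "Z \<le> (\<integral>x. k \<partial>\<alpha>)"
      unfolding Z_def by (intro integral_mono A.integrable_const Ci Cb')+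
    then show "1 / k \<le> Z" "Z \<le> k" by (simp_all add: A.prob_space)
  qed
  have Z: "0 < Z" using Zb(1) k by (simp add: less_le_trans[of 0 "1 / k"])
  define g where "g x = C n x / Z" for x
  have Cg: "C n x = Z * g x" for x using Z by (simp add: g_def)
  have Cpos: "0 < C n x" for x using Cb'(1)[of x] k by (simp add: less_le_trans[of 0 "1 / k"])
  have gi: "integrable \<alpha> g" unfolding g_def using Ci by simp
  have g1: "(\<integral>x. g x \<partial>\<alpha>) = 1" unfolding g_def using Z by (simp add: Z_def[symmetric])
  have gpos: "0 < g x" for x unfolding g_def using Cpos Z by simp
  show ?thesis
  proof (rule that[of g "1 / k / Z" "k / Z" Z])
    show "g \<in> borel_measurable \<alpha>" unfolding g_def by measurable
    show "0 < 1 / k / Z" using k Z by simp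
    show "1 / k / Z \<le> g x" "g x \<le> k / Z" for x unfolding g_def using Cb'[of x] Z by (simp_all only: divide_right_mono less_imp_le)
    show "1 - \<eta> \<le> Z" using dZ n \<eta> by linarith
    have "(\<integral>x. \<bar>f x - g x\<bar> \<partial>\<alpha>) \<le> (\<integral>x. \<bar>f x - C n x\<bar> + \<bar>1 - Z\<bar> * g x \<partial>\<alpha>)"
    proof (rule integral_mono)
      fix x
      have "f x - g x = (f x - C n x) - (1 - Z) * g x" by (simp add: Cg algebra_simps)
      also have "\<bar>\<dots>\<bar> \<le> \<bar>f x - C n x\<bar> + \<bar>(1 - Z) * g x\<bar>" by (rule abs_triangle_ineq4)
      finally show "\<bar>f x - g x\<bar> \<le> \<bar>f x - C n x\<bar> + \<bar>1 - Z\<bar> * g x" using gpos[of x] by (simp add: abs_mult)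
    qed (use fi gi Ci in auto)
    also have "\<dots> = (\<integral>x. \<bar>f x - C n x\<bar> \<partial>\<alpha>) + \<bar>1 - Z\<bar>"
      using fi gi Ci g1 by simp
    also have "\<dots> \<le> \<eta>" using dZ n by linarith
    finally show "(\<integral>x. \<bar>f x - g x\<bar> \<partial>\<alpha>) \<le> \<eta>" .
    fix x
    have "Z * (g x * ln (g x)) = C n x * ln (g x)" by (simp add: Cg)
    also have "\<dots> \<le> f x * ln (g x)"
    proof (cases "f x > k")
      case True
      then have "C n x = k" using k Cb'[of x] by (simp add: C_def k_def)
      then have "1 \<le> g x" unfolding g_def using Z Zb by simp
      then show ?thesis using True \<open>C n x = k\<close> by (intro mult_right_mono) auto
    next
      case nk: False
      show ?thesis
      proof (cases "f x < 1 / k")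
        case True
        then have "C n x = 1 / k" using nk by (simp add: C_def k_def)
        then have "g x \<le> 1" unfolding g_def using Z Zb(1) by (simp only: divide_le_eq_1_pos)
        then have "ln (g x) \<le> 0" using gpos[of x] by simp
        then show ?thesis using True \<open>C n x = 1 / k\<close> by (intro mult_right_mono_neg) auto
      next
        case False
        then have "C n x = f x" using nk by (simp add: C_def k_def)
        then show ?thesis by simp
      qed
    qed
    finally show "Z * (g x * ln (g x)) \<le> f x * ln (g x)" .
  qed (rule g1)
qed

section \<open>Integration against regular conditional laws\<close>

context mean_field
begin

text \<open>A regular conditional law is specified on rectangles; the functional monotone class
  argument in u extends this to integrals over a slice of weights.\<close>

lemma conditional_law_nn_integral:
  assumes adm: "admissible \<nu>" and reg: "regular_conditional_law \<nu> \<kappa>"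
    and S[measurable]: "S \<in> sets borel" and u: "u \<in> borel_measurable borel"
  shows "(\<integral>\<^sup>+z. u (fst z) * indicator S (snd z) \<partial>\<nu>) = (\<integral>\<^sup>+x. (\<integral>\<^sup>+s. u s \<partial>\<kappa> x) * indicator S x \<partial>P)"
  using u
proof (induction rule: borel_measurable_induct)
  note [measurable] = admissible_facts(3,4)[OF adm]
  have \<kappa>m: "\<kappa> \<in> borel \<rightarrow>\<^sub>M subprob_algebra borel"
    using reg by (auto simp: regular_conditional_law_def intro: measurable_prob_algebraD)
  have [measurable]: "(\<lambda>x. \<integral>\<^sup>+s. f s \<partial>\<kappa> x) \<in> borel_measurable P" if "f \<in> borel_measurable borel" for f
    using measurable_compose[OF \<kappa>m nn_integral_measurable_subprob_algebra[OF that]] by simp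
  have ks: "sets (\<kappa> x) = sets borel" for x
    using measurable_space[OF \<kappa>m, of x] by (simp add: space_subprob_algebra)
  have [measurable_cong]: "sets (\<kappa> x) = sets borel" for x by (rule ks)
  {
    case (cong f g)
    then show ?case by simp
  next
    case (set A)
    have "A \<times> S \<in> sets \<nu>" unfolding admissible_facts(2)[OF adm] borel_prod[symmetric] using set S by auto
    then have "(\<integral>\<^sup>+z. indicator A (fst z) * indicator S (snd z) \<partial>\<nu>) = emeasure \<nu> (A \<times> S)"
      by (simp add: indicator_times[symmetric])
    also have "\<dots> = (\<integral>\<^sup>+x. emeasure (\<kappa> x) A * indicator S x \<partial>P)"
      using reg set S admissible_facts(5)[OF adm] by (simp add: regular_conditional_law_def weight_marginal_def)
    also have "\<dots> = (\<integral>\<^sup>+x. (\<integral>\<^sup>+s. indicator A s \<partial>\<kappa> x) * indicator S x \<partial>P)"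
      using set ks by (intro nn_integral_cong) simp
    finally show ?case .
  next
    case (mult u c)
    have [measurable]: "u \<in> borel_measurable borel" by fact
    have "(\<integral>\<^sup>+z. c * u (fst z) * indicator S (snd z) \<partial>\<nu>) = c * (\<integral>\<^sup>+z. u (fst z) * indicator S (snd z) \<partial>\<nu>)"
      unfolding mult.assoc by (rule nn_integral_cmult) measurable
    also have "\<dots> = (\<integral>\<^sup>+x. c * ((\<integral>\<^sup>+s. u s \<partial>\<kappa> x) * indicator S x) \<partial>P)"
      unfolding mult.IH by (rule nn_integral_cmult[symmetric]) measurable
    also have "\<dots> = (\<integral>\<^sup>+x. (\<integral>\<^sup>+s. c * u s \<partial>\<kappa> x) * indicator S x \<partial>P)"
      by (intro nn_integral_cong) (subst nn_integral_cmult, measurable, simp only: mult.assoc)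
    finally show ?case .
  next
    case (add u v)
    have [measurable]: "u \<in> borel_measurable borel" "v \<in> borel_measurable borel" by fact+
    have "(\<integral>\<^sup>+z. (u (fst z) + v (fst z)) * indicator S (snd z) \<partial>\<nu>) = (\<integral>\<^sup>+z. u (fst z) * indicator S (snd z) \<partial>\<nu>) + (\<integral>\<^sup>+z. v (fst z) * indicator S (snd z) \<partial>\<nu>)"
      unfolding distrib_right by (rule nn_integral_add) measurable
    also have "\<dots> = (\<integral>\<^sup>+x. (\<integral>\<^sup>+s. u s \<partial>\<kappa> x) * indicator S x + (\<integral>\<^sup>+s. v s \<partial>\<kappa> x) * indicator S x \<partial>P)"
      unfolding add.IH by (rule nn_integral_add[symmetric]) measurable
    also have "\<dots> = (\<integral>\<^sup>+x. (\<integral>\<^sup>+s. u s + v s \<partial>\<kappa> x) * indicator S x \<partial>P)"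
      by (intro nn_integral_cong) (subst nn_integral_add, measurable, simp only: distrib_right)
    finally show ?case by (simp add: add.commute)
  next
    case (seq U)
    have Um: "U i \<in> borel_measurable borel" for i using seq.hyps by blast
    have incU: "incseq U" using seq.hyps by blast
    note [measurable] = Um
    have incS: "incseq (\<lambda>i z. U i (fst z) * indicator S (snd z))"
      using incU by (auto simp: incseq_def le_fun_def intro!: mult_right_mono)
    have Us: "(SUP i. U i) s = (SUP i. U i s)" for s by (rule SUP_apply)
    have SUPm: "(SUP i. U i) s * t = (SUP i. U i s * t)" for s t
      unfolding Us SUP_mult_right_ennreal ..
    have "(\<integral>\<^sup>+z. (SUP i. U i) (fst z) * indicator S (snd z) \<partial>\<nu>) = (\<integral>\<^sup>+z. (SUP i. U i (fst z) * indicator S (snd z)) \<partial>\<nu>)"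
      by (simp only: SUPm)
    also have "\<dots> = (SUP i. \<integral>\<^sup>+z. U i (fst z) * indicator S (snd z) \<partial>\<nu>)"
      by (rule nn_integral_monotone_convergence_SUP[OF incS]) measurable
    also have "\<dots> = (SUP i. \<integral>\<^sup>+x. (\<integral>\<^sup>+s. U i s \<partial>\<kappa> x) * indicator S x \<partial>P)"
      unfolding seq.IH ..
    also have "\<dots> = (\<integral>\<^sup>+x. (SUP i. (\<integral>\<^sup>+s. U i s \<partial>\<kappa> x) * indicator S x) \<partial>P)"
    proof (rule nn_integral_monotone_convergence_SUP[symmetric])
      show "incseq (\<lambda>i x. (\<integral>\<^sup>+s. U i s \<partial>\<kappa> x) * indicator S x)"
        using incU by (auto simp: incseq_def le_fun_def intro!: mult_right_mono nn_integral_mono)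
    qed measurable
    also have "\<dots> = (\<integral>\<^sup>+x. (\<integral>\<^sup>+s. (SUP i. U i) s \<partial>\<kappa> x) * indicator S x \<partial>P)"
    proof (intro nn_integral_cong)
      fix x
      have "(\<integral>\<^sup>+s. (SUP i. U i s) \<partial>\<kappa> x) = (SUP i. \<integral>\<^sup>+s. U i s \<partial>\<kappa> x)"
        by (rule nn_integral_monotone_convergence_SUP[OF incU]) measurable
      then show "(SUP i. (\<integral>\<^sup>+s. U i s \<partial>\<kappa> x) * indicator S x) = (\<integral>\<^sup>+s. (SUP i. U i) s \<partial>\<kappa> x) * indicator S x"
        unfolding Us by (simp add: SUP_mult_right_ennreal)
    qed
    finally show ?case .
  }
qed

text \<open>Adding the bound \<open>L\<close> makes u nonnegative, so the version for nonnegative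
  functions applies; the added constant integrates to the same amount on both sides, because the two
  weight marginals agree.\<close>

lemma conditional_law_integral:
  fixes u :: "'a \<Rightarrow> real"
  assumes adm: "admissible \<nu>" and reg: "regular_conditional_law \<nu> \<kappa>"
    and S[measurable]: "S \<in> sets borel" and u[measurable]: "u \<in> borel_measurable borel" and uL: "\<And>s. \<bar>u s\<bar> \<le> L"
  shows "(\<lambda>x. \<integral>s. u s \<partial>\<kappa> x) \<in> borel_measurable borel" "\<And>x. \<bar>\<integral>s. u s \<partial>\<kappa> x\<bar> \<le> L"
    "(\<integral>z. u (fst z) * indicator S (snd z) \<partial>\<nu>) = (\<integral>x. (\<integral>s. u s \<partial>\<kappa> x) * indicator S x \<partial>P)"
proof -
  interpret N: prob_space \<nu> by (rule admissible_facts[OF adm])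
  note [measurable] = admissible_facts(3,4)[OF adm]
  have \<kappa>p: "\<kappa> \<in> borel \<rightarrow>\<^sub>M prob_algebra borel" using reg by (simp add: regular_conditional_law_def)
  have \<kappa>m: "\<kappa> \<in> borel \<rightarrow>\<^sub>M subprob_algebra borel" using \<kappa>p by (rule measurable_prob_algebraD)
  have kx: "sets (\<kappa> x) = sets borel" "prob_space (\<kappa> x)" for x
    using measurable_space[OF \<kappa>p, of x] by (simp_all add: space_prob_algebra)
  have [measurable_cong]: "sets (\<kappa> x) = sets borel" for x by (rule kx)
  define v where "v s = u s + L" for s
  have v0: "0 \<le> v s" "v s \<le> 2 * L" for s using uL[of s] by (auto simp: v_def)
  have vm[measurable]: "v \<in> borel_measurable borel" unfolding v_def by measurable
  have iu: "integrable (\<kappa> x) u" for x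
  proof -
    interpret K: prob_space "\<kappa> x" by (rule kx)
    show ?thesis using uL by (intro K.integrable_const_bound[where B=L]) auto
  qed
  have vu: "(\<integral>s. v s \<partial>\<kappa> x) = (\<integral>s. u s \<partial>\<kappa> x) + L" and iv: "integrable (\<kappa> x) v" for x
  proof -
    interpret K: prob_space "\<kappa> x" by (rule kx)
    show "(\<integral>s. v s \<partial>\<kappa> x) = (\<integral>s. u s \<partial>\<kappa> x) + L" unfolding v_def using iu[of x] by (simp add: K.prob_space)
    show "integrable (\<kappa> x) v" unfolding v_def using iu[of x] by simp
  qed
  have vn: "(\<integral>\<^sup>+s. ennreal (v s) \<partial>\<kappa> x) = ennreal (\<integral>s. v s \<partial>\<kappa> x)" for x
    using iv v0 by (intro nn_integral_eq_integral) auto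
  have "(\<lambda>x. enn2real (\<integral>\<^sup>+s. ennreal (v s) \<partial>\<kappa> x) - L) \<in> borel_measurable borel"
    using measurable_compose[OF \<kappa>m nn_integral_measurable_subprob_algebra[of "\<lambda>s. ennreal (v s)" borel]] by measurable
  moreover have "enn2real (\<integral>\<^sup>+s. ennreal (v s) \<partial>\<kappa> x) - L = (\<integral>s. u s \<partial>\<kappa> x)" for x
    unfolding vn using v0 vu[of x] Bochner_Integration.integral_nonneg[of "\<kappa> x" v] by simp
  ultimately show um: "(\<lambda>x. \<integral>s. u s \<partial>\<kappa> x) \<in> borel_measurable borel" by simp
  show ub: "\<bar>\<integral>s. u s \<partial>\<kappa> x\<bar> \<le> L" for x
  proof -
    interpret K: prob_space "\<kappa> x" by (rule kx)
    have "\<bar>\<integral>s. u s \<partial>\<kappa> x\<bar> \<le> (\<integral>s. \<bar>u s\<bar> \<partial>\<kappa> x)" by (rule integral_abs_bound)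
    also have "\<dots> \<le> (\<integral>s. L \<partial>\<kappa> x)" using iu uL by (intro integral_mono) auto
    finally show ?thesis by (simp add: K.prob_space)
  qed
  have eq: "(\<integral>z. v (fst z) * indicator S (snd z) \<partial>\<nu>) = (\<integral>x. (\<integral>s. v s \<partial>\<kappa> x) * indicator S x \<partial>P)"
  proof -
    have "(\<integral>z. v (fst z) * indicator S (snd z) \<partial>\<nu>) = enn2real (\<integral>\<^sup>+z. ennreal (v (fst z) * indicator S (snd z)) \<partial>\<nu>)"
      using v0 by (intro integral_eq_nn_integral) (auto intro!: AE_I2)
    also have "(\<integral>\<^sup>+z. ennreal (v (fst z) * indicator S (snd z)) \<partial>\<nu>) = (\<integral>\<^sup>+z. ennreal (v (fst z)) * indicator S (snd z) \<partial>\<nu>)"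
      by (intro nn_integral_cong) (auto simp: indicator_def)
    also have "\<dots> = (\<integral>\<^sup>+x. (\<integral>\<^sup>+s. ennreal (v s) \<partial>\<kappa> x) * indicator S x \<partial>P)"
      by (rule conditional_law_nn_integral[OF adm reg S]) measurable
    also have "\<dots> = (\<integral>\<^sup>+x. ennreal ((\<integral>s. v s \<partial>\<kappa> x) * indicator S x) \<partial>P)"
      unfolding vn by (intro nn_integral_cong) (auto simp: indicator_def)
    also have "enn2real \<dots> = (\<integral>x. (\<integral>s. v s \<partial>\<kappa> x) * indicator S x \<partial>P)"
    proof (rule integral_eq_nn_integral[symmetric])
      show "(\<lambda>x. (\<integral>s. v s \<partial>\<kappa> x) * indicator S x) \<in> borel_measurable P" unfolding vu using um by simp
      show "AE x in P. 0 \<le> (\<integral>s. v s \<partial>\<kappa> x) * indicator S x"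
        using v0 by (intro AE_I2 mult_nonneg_nonneg Bochner_Integration.integral_nonneg) auto
    qed
    finally show ?thesis .
  qed
  have iS: "integrable \<nu> (\<lambda>z. indicator S (snd z) :: real)"
    by (rule N.integrable_const_bound[where B=1]) auto
  have iuS: "integrable \<nu> (\<lambda>z. u (fst z) * indicator S (snd z))"
    using uL by (intro N.integrable_const_bound[where B=L]) (auto intro!: AE_I2 simp: indicator_def intro: order_trans[OF abs_ge_zero])
  have iUS: "integrable P (\<lambda>x. (\<integral>s. u s \<partial>\<kappa> x) * indicator S x)"
    using ub um by (intro P.integrable_const_bound[where B=L]) (auto intro!: AE_I2 simp: indicator_def intro: order_trans[OF abs_ge_zero])
  have "(\<integral>z. v (fst z) * indicator S (snd z) \<partial>\<nu>) = (\<integral>z. u (fst z) * indicator S (snd z) \<partial>\<nu>) + L * (\<integral>z. indicator S (snd z) \<partial>\<nu>)"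
    unfolding v_def distrib_right using iuS iS by simp
  moreover have "(\<integral>z. indicator S (snd z) \<partial>\<nu>) = (\<integral>x. indicator S x \<partial>P :: real)"
    by (rule admissible_snd(1)[OF adm]) simp
  moreover have "(\<integral>x. (\<integral>s. v s \<partial>\<kappa> x) * indicator S x \<partial>P) = (\<integral>x. (\<integral>s. u s \<partial>\<kappa> x) * indicator S x \<partial>P) + L * (\<integral>x. indicator S x \<partial>P)"
  proof -
    have "integrable P (indicator S :: real \<Rightarrow> real)"
      by (rule P.integrable_const_bound[where B=1]) auto
    then show ?thesis unfolding vu distrib_right using iUS by simp
  qed
  ultimately show "(\<integral>z. u (fst z) * indicator S (snd z) \<partial>\<nu>) = (\<integral>x. (\<integral>s. u s \<partial>\<kappa> x) * indicator S x \<partial>P)"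
    using eq by simp
qed

end

section \<open>Class densities of a competitor and their entropy\<close>

context discretized_mean_field
begin

definition pair_mean :: "(nat \<Rightarrow> 'a \<Rightarrow> real) \<Rightarrow> nat \<Rightarrow> nat \<Rightarrow> real" where
  "pair_mean f k l = (\<integral>z. V (fst z) (snd z) * (f k (fst z) * f l (snd z)) \<partial>(\<alpha> \<Otimes>\<^sub>M \<alpha>))"

lemma class_energy_pair_mean:
  "class_energy f = (\<Sum>k\<le>B. \<Sum>l\<le>B. c k * c l / (2 * mean) * (mass k * mass l) * pair_mean f k l)"
  by (simp add: class_energy_def pair_mean_def)

lemma integrable_V_times:
  fixes f g :: "'a \<Rightarrow> real"
  assumes "integrable \<alpha> f" "integrable \<alpha> g"
  shows "integrable (\<alpha> \<Otimes>\<^sub>M \<alpha>) (\<lambda>z. V (fst z) (snd z) * (f (fst z) * g (snd z)))"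
proof (rule Bochner_Integration.integrable_bound)
  have [measurable]: "f \<in> borel_measurable \<alpha>" "g \<in> borel_measurable \<alpha>" using assms by auto
  show "integrable (\<alpha> \<Otimes>\<^sub>M \<alpha>) (\<lambda>z. K * (f (fst z) * g (snd z)))"
    using AA.integrable_mult_fst_snd(1)[OF assms] by simp
  show "(\<lambda>z. V (fst z) (snd z) * (f (fst z) * g (snd z))) \<in> borel_measurable (\<alpha> \<Otimes>\<^sub>M \<alpha>)" by measurable
  show "AE z in \<alpha> \<Otimes>\<^sub>M \<alpha>. norm (V (fst z) (snd z) * (f (fst z) * g (snd z))) \<le> norm (K * (f (fst z) * g (snd z)))"
    using V_nonneg V_le K_nonneg by (intro AE_I2) (auto simp: abs_mult intro!: mult_right_mono)
qed

lemma pair_mean_commute: "pair_mean f k l = pair_mean f l k"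
  if "\<And>k. f k \<in> borel_measurable \<alpha>"
proof -
  note [measurable] = that
  have "pair_mean f k l = (\<integral>(x, y). (\<lambda>z. V (fst z) (snd z) * (f k (fst z) * f l (snd z))) (y, x) \<partial>(\<alpha> \<Otimes>\<^sub>M \<alpha>))"
    unfolding pair_mean_def by (rule AA.integral_product_swap[symmetric]) measurable
  also have "\<dots> = pair_mean f l k"
    unfolding pair_mean_def
    by (intro Bochner_Integration.integral_cong refl) (simp only: split_beta fst_conv snd_conv, subst V_sym, simp only: mult_ac)
  finally show ?thesis .
qed

text \<open>The difference of the two products is telescoped as (f k - g k) f l + g k (f l - g l),
  so that in each term the second factor integrates to 1. Applied to L1-close densities, it controls
  the loss of energy under clipping.\<close>

lemma pair_mean_dist:
  fixes f g :: "nat \<Rightarrow> 'a \<Rightarrow> real"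
  assumes f: "integrable \<alpha> (f k)" "integrable \<alpha> (f l)" "\<And>x. 0 \<le> f k x" "\<And>x. 0 \<le> f l x" "(\<integral>x. f l x \<partial>\<alpha>) = 1"
    and g: "integrable \<alpha> (g k)" "integrable \<alpha> (g l)" "\<And>x. 0 \<le> g k x" "\<And>x. 0 \<le> g l x" "(\<integral>x. g k x \<partial>\<alpha>) = 1"
  shows "pair_mean f k l \<le> pair_mean g k l + K * ((\<integral>x. \<bar>f k x - g k x\<bar> \<partial>\<alpha>) + (\<integral>x. \<bar>f l x - g l x\<bar> \<partial>\<alpha>))"
proof -
  let ?J = "\<lambda>h. \<integral>z. h z \<partial>(\<alpha> \<Otimes>\<^sub>M \<alpha>)"
  have id: "integrable \<alpha> (\<lambda>x. \<bar>f k x - g k x\<bar>)" "integrable \<alpha> (\<lambda>x. \<bar>f l x - g l x\<bar>)"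
    using f g by auto
  note i1 = AA.integrable_mult_fst_snd[OF id(1) f(2)] and i2 = AA.integrable_mult_fst_snd[OF g(1) id(2)]
  let ?r = "\<lambda>z. K * (\<bar>f k (fst z) - g k (fst z)\<bar> * f l (snd z) + g k (fst z) * \<bar>f l (snd z) - g l (snd z)\<bar>)"
  have ir: "integrable (\<alpha> \<Otimes>\<^sub>M \<alpha>) ?r"
    using i1(1) i2(1) by (intro integrable_mult_right Bochner_Integration.integrable_add)
  have "pair_mean f k l \<le> ?J (\<lambda>z. V (fst z) (snd z) * (g k (fst z) * g l (snd z)) + ?r z)"
    unfolding pair_mean_def
  proof (rule integral_mono)
    fix z :: "'a \<times> 'a"
    let ?s = "fst z" and ?t = "snd z"
    have "f k ?s * f l ?t - g k ?s * g l ?t = (f k ?s - g k ?s) * f l ?t + g k ?s * (f l ?t - g l ?t)"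
      by (simp add: algebra_simps)
    also have "\<dots> \<le> \<bar>f k ?s - g k ?s\<bar> * f l ?t + g k ?s * \<bar>f l ?t - g l ?t\<bar>"
      using f(4) g(3) by (intro add_mono mult_right_mono mult_left_mono) auto
    finally have d: "f k ?s * f l ?t - g k ?s * g l ?t \<le> \<bar>f k ?s - g k ?s\<bar> * f l ?t + g k ?s * \<bar>f l ?t - g l ?t\<bar>" (is "_ \<le> ?R") .
    have R: "0 \<le> ?R" using f(4) g(3) by simp
    have "V ?s ?t * (f k ?s * f l ?t - g k ?s * g l ?t) \<le> V ?s ?t * ?R" using d V_nonneg by (rule mult_left_mono)
    also have "\<dots> \<le> K * ?R" using V_le R by (rule mult_right_mono)
    finally show "V ?s ?t * (f k ?s * f l ?t) \<le> V ?s ?t * (g k ?s * g l ?t) + ?r z" by (simp add: right_diff_distrib)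
  qed (intro integrable_V_times f Bochner_Integration.integrable_add g ir)+
  also have "\<dots> = pair_mean g k l + ?J ?r"
    unfolding pair_mean_def by (intro Bochner_Integration.integral_add integrable_V_times g ir)
  also have "?J ?r = K * ((\<integral>x. \<bar>f k x - g k x\<bar> \<partial>\<alpha>) + (\<integral>x. \<bar>f l x - g l x\<bar> \<partial>\<alpha>))"
    unfolding integral_mult_right_zero Bochner_Integration.integral_add[OF i1(1) i2(1)] i1(2) i2(2) f(5) g(5) by simp
  finally show ?thesis .
qed

text \<open>Finite mean entropy forces the conditional laws to be absolutely continuous almost
  everywhere, hence \<nu> charges no set \<open>A \<times> S\<close> with A an \<alpha>-null set.
  Radon-Nikodym, applied to the spin marginal of \<nu> conditioned on a class, then yields the
  density.\<close>

lemma class_density_exists: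
  assumes adm: "admissible \<nu>" and reg: "regular_conditional_law \<nu> \<kappa>"
    and fin: "(\<integral>\<^sup>+x. relative_entropy (\<kappa> x) \<alpha> \<partial>P) < \<infinity>"
  obtains f where "has_class_densities \<nu> f" "\<And>k. k \<le> B \<Longrightarrow> (\<integral>x. f k x \<partial>\<alpha>) = 1"
proof -
  interpret N: prob_space \<nu> by (rule admissible_facts[OF adm])
  note [measurable] = admissible_facts(3,4)[OF adm]
  have \<kappa>m: "\<kappa> \<in> borel \<rightarrow>\<^sub>M subprob_algebra borel"
    using reg by (auto simp: regular_conditional_law_def intro: measurable_prob_algebraD)
  have prod_sets: "A \<times> S \<in> sets \<nu>" if "A \<in> sets borel" "S \<in> sets borel" for A S
    unfolding admissible_facts(2)[OF adm] borel_prod[symmetric] using that by auto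
  have null: "emeasure \<nu> (A \<times> S) = 0" if A: "A \<in> null_sets \<alpha>" and S: "S \<in> sets borel" for A S
  proof -
    have Ab: "A \<in> sets borel" using A sets_\<alpha> by auto
    have m[measurable]: "(\<lambda>x. emeasure (\<kappa> x) A) \<in> borel_measurable P"
      using measurable_compose[OF \<kappa>m measurable_emeasure_subprob_algebra[OF Ab]] by simp
    define Bad where "Bad = {x \<in> space P. emeasure (\<kappa> x) A \<noteq> 0}"
    have Bad: "Bad \<in> sets P" unfolding Bad_def by measurable
    \<comment> \<open>On \<open>Bad\<close> absolute continuity fails and the entropy is infinite.
      The comparison uses monotonicity of \<open>nn_integral\<close> alone, which asks for no
      measurability of the entropy as a function of the weight.\<close>
    have "\<infinity> * emeasure P Bad = (\<integral>\<^sup>+x. \<infinity> * indicator Bad x \<partial>P)" by (rule nn_integral_cmult_indicator[OF Bad, symmetric])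
    also have "\<dots> \<le> (\<integral>\<^sup>+x. relative_entropy (\<kappa> x) \<alpha> \<partial>P)"
    proof (rule nn_integral_mono)
      fix x
      show "\<infinity> * indicator Bad x \<le> relative_entropy (\<kappa> x) \<alpha>"
      proof (cases "x \<in> Bad")
        case True
        then have "\<not> absolutely_continuous \<alpha> (\<kappa> x)"
          using A by (auto simp: Bad_def absolutely_continuous_def null_sets_def)
        then show ?thesis by (simp add: relative_entropy_def)
      qed simp
    qed
    also have "\<dots> < \<infinity>" by (rule fin)
    finally have "emeasure P Bad = 0" by (auto simp: ennreal_mult_less_top)
    then have "AE x in P. x \<notin> Bad" by (intro AE_not_in null_setsI Bad)
    then have "AE x in P. emeasure (\<kappa> x) A * indicator S x = 0"
      using AE_space by eventually_elim (auto simp: Bad_def)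
    then have "(\<integral>\<^sup>+x. emeasure (\<kappa> x) A * indicator S x \<partial>P) = (\<integral>\<^sup>+x. 0 \<partial>P)"
      by (rule nn_integral_cong_AE)
    then show ?thesis
      using reg Ab S by (simp add: regular_conditional_law_def weight_marginal_def admissible_facts(5)[OF adm])
  qed
  have marg: "emeasure \<nu> (UNIV \<times> S) = emeasure P S" if S: "S \<in> sets borel" for S
  proof -
    have sp: "space \<nu> = UNIV" using sets_eq_imp_space_eq[OF admissible_facts(2)[OF adm]] by simp
    have "emeasure P S = emeasure (distr \<nu> borel snd) S" by (simp add: admissible_facts(5)[OF adm])
    also have "\<dots> = emeasure \<nu> (snd -` S \<inter> space \<nu>)" by (rule emeasure_distr) (use S in measurable)
    also have "snd -` S \<inter> space \<nu> = UNIV \<times> S" using sp by auto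
    finally show ?thesis ..
  qed
  define Q where "Q k f \<longleftrightarrow> integrable \<alpha> f \<and> (\<forall>s. 0 \<le> f s) \<and> (\<integral>x. f x \<partial>\<alpha>) = 1 \<and>
     (\<forall>A\<in>sets borel. emeasure \<nu> (A \<times> {x. b x = k}) = ennreal (mass k) * (\<integral>\<^sup>+s. ennreal (f s) * indicator A s \<partial>\<alpha>))" for k and f :: "'a \<Rightarrow> real"
  have "\<exists>f. Q k f" for k
  proof (cases "mass k = 0")
    case True
    have "emeasure \<nu> (A \<times> {x. b x = k}) = 0" if "A \<in> sets borel" for A
    proof -
      have "emeasure \<nu> (A \<times> {x. b x = k}) \<le> emeasure \<nu> (UNIV \<times> {x. b x = k})"
        by (rule emeasure_mono) (auto intro!: prod_sets)
      also have "\<dots> = 0" using True by (simp add: marg mass_def P.emeasure_eq_measure)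
      finally show ?thesis by simp
    qed
    \<comment> \<open>A class of mass zero imposes no identity; the constant 1 keeps its density
      normalized.\<close>
    then show ?thesis using True unfolding Q_def by (intro exI[of _ "\<lambda>_. 1"]) (simp add: A.prob_space)
  next
    case False
    then have mk: "0 < mass k" using mass_nonneg[of k] by simp
    let ?S = "{x. b x = k}"
    let ?r = "\<lambda>z. ennreal (1 / mass k) * indicator (UNIV \<times> ?S) z"
    have US: "UNIV \<times> ?S \<in> sets \<nu>" by (rule prod_sets) auto
    then have rm: "?r \<in> borel_measurable \<nu>" by measurable
    define \<rho> where "\<rho> = distr (density \<nu> ?r) borel fst"
    have sp: "space \<nu> = UNIV" using sets_eq_imp_space_eq[OF admissible_facts(2)[OF adm]] by simp
    have \<rho>: "emeasure \<rho> A = ennreal (1 / mass k) * emeasure \<nu> (A \<times> ?S)" if A: "A \<in> sets borel" for A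
    proof -
      have AU: "A \<times> UNIV \<in> sets \<nu>" and AS: "A \<times> ?S \<in> sets \<nu>" using A by (auto intro!: prod_sets)
      have "emeasure \<rho> A = emeasure (density \<nu> ?r) (fst -` A \<inter> space (density \<nu> ?r))"
        unfolding \<rho>_def using A by (intro emeasure_distr) auto
      also have "fst -` A \<inter> space (density \<nu> ?r) = A \<times> UNIV" using sp by auto
      also have "emeasure (density \<nu> ?r) (A \<times> UNIV) = (\<integral>\<^sup>+z. ?r z * indicator (A \<times> UNIV) z \<partial>\<nu>)"
        by (rule emeasure_density[OF rm AU])
      also have "\<dots> = (\<integral>\<^sup>+z. ennreal (1 / mass k) * indicator (A \<times> ?S) z \<partial>\<nu>)"
        by (intro nn_integral_cong) (auto simp: indicator_def)
      also have "\<dots> = ennreal (1 / mass k) * emeasure \<nu> (A \<times> ?S)"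
        by (rule nn_integral_cmult_indicator[OF AS])
      finally show ?thesis .
    qed
    have \<rho>1: "emeasure \<rho> UNIV = 1"
      using mk by (subst \<rho>) (simp_all add: marg mass_def P.emeasure_eq_measure flip: ennreal_mult)
    have sets_\<rho>: "sets \<rho> = sets \<alpha>" by (simp add: \<rho>_def sets_\<alpha>)
    interpret R: prob_space \<rho> 
    proof (rule prob_spaceI)
      have "space \<rho> = UNIV" by (simp add: \<rho>_def)
      then show "emeasure \<rho> (space \<rho>) = 1" using \<rho>1 by simp
    qed
    have ac: "absolutely_continuous \<alpha> \<rho>"
      unfolding absolutely_continuous_def
    proof
      fix A assume A: "A \<in> null_sets \<alpha>"
      then have "A \<in> sets borel" using sets_\<alpha> by auto
      then show "A \<in> null_sets \<rho>" using null[OF A, of ?S] sets_\<rho> sets_\<alpha> by (intro null_setsI) (simp_all add: \<rho>)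
    qed
    define f where "f x = enn2real (RN_deriv \<alpha> \<rho> x)" for x
    have [measurable]: "f \<in> borel_measurable \<alpha>" unfolding f_def by measurable
    have "AE x in \<alpha>. RN_deriv \<alpha> \<rho> x \<noteq> \<infinity>"
      by (rule A.RN_deriv_finite[OF R.sigma_finite_measure_axioms ac sets_\<rho>])
    then have "AE x in \<alpha>. RN_deriv \<alpha> \<rho> x = ennreal (f x)"
      by eventually_elim (simp add: f_def less_top)
    then have "density \<alpha> (RN_deriv \<alpha> \<rho>) = density \<alpha> (\<lambda>x. ennreal (f x))"
      by (intro density_cong) auto
    then have \<rho>f: "\<rho> = density \<alpha> (\<lambda>x. ennreal (f x))"
      using A.density_RN_deriv[OF ac sets_\<rho>] by simp
    have em: "(\<integral>\<^sup>+s. ennreal (f s) * indicator A s \<partial>\<alpha>) = ennreal (1 / mass k) * emeasure \<nu> (A \<times> ?S)" if A: "A \<in> sets borel" for A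
    proof -
      have "emeasure \<rho> A = (\<integral>\<^sup>+s. ennreal (f s) * indicator A s \<partial>\<alpha>)"
        using A sets_\<alpha> by (subst \<rho>f) (rule emeasure_density, auto)
      then show ?thesis using \<rho>[OF A] by simp
    qed
    have tot: "(\<integral>\<^sup>+s. ennreal (f s) \<partial>\<alpha>) = 1" using em[of UNIV] \<rho>[of UNIV] \<rho>1 by simp
    have f0: "0 \<le> f s" for s by (simp add: f_def)
    have fi: "integrable \<alpha> f" by (rule integrableI_nonneg) (simp_all add: tot f0)
    have f1: "(\<integral>s. f s \<partial>\<alpha>) = 1"
      by (subst integral_eq_nn_integral) (simp_all add: tot f0)
    have "emeasure \<nu> (A \<times> ?S) = ennreal (mass k) * (\<integral>\<^sup>+s. ennreal (f s) * indicator A s \<partial>\<alpha>)" if "A \<in> sets borel" for A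
    proof -
      have "ennreal (mass k) * (ennreal (1 / mass k) * emeasure \<nu> (A \<times> ?S)) = ennreal (mass k * (1 / mass k)) * emeasure \<nu> (A \<times> ?S)"
        using mk by (subst ennreal_mult) (auto simp: mult.assoc)
      then show ?thesis unfolding em[OF that] using mk by simp
    qed
    then show ?thesis using fi f1 f0 unfolding Q_def by blast
  qed
  then obtain f where f: "\<And>k. Q k (f k)" by metis
  show ?thesis by (rule that[of f]) (use f in \<open>unfold Q_def has_class_densities_def, blast+\<close>)
qed

text \<open>Donsker-Varadhan is applied to each conditional law with the test function ln g of the
  class of the weight; its normalizing term is the logarithm of the integral of g, hence 0. Since
  the test function is the same throughout a class, integrating over the weights replaces the
  conditional laws by their class averages.\<close>

lemma entropy_class_bound:
  assumes adm: "admissible \<nu>" and reg: "regular_conditional_law \<nu> \<kappa>"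
    and fin: "(\<integral>\<^sup>+x. relative_entropy (\<kappa> x) \<alpha> \<partial>P) < \<infinity>"
    and f: "has_class_densities \<nu> f"
    and g: "\<And>k. g k \<in> borel_measurable \<alpha>" "\<And>k x. 0 < g k x" "\<And>k x. \<bar>ln (g k x)\<bar> \<le> L" "\<And>k. (\<integral>x. g k x \<partial>\<alpha>) = 1"
  shows "(\<Sum>k\<le>B. mass k * (\<integral>x. f k x * ln (g k x) \<partial>\<alpha>)) \<le> enn2real (\<integral>\<^sup>+x. relative_entropy (\<kappa> x) \<alpha> \<partial>P)"
proof -
  let ?T = "\<integral>\<^sup>+x. relative_entropy (\<kappa> x) \<alpha> \<partial>P"
  have \<kappa>p: "\<kappa> \<in> borel \<rightarrow>\<^sub>M prob_algebra borel" using reg by (simp add: regular_conditional_law_def)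
  have kx: "sets (\<kappa> x) = sets borel" "prob_space (\<kappa> x)" for x
    using measurable_space[OF \<kappa>p, of x] by (simp_all add: space_prob_algebra)
  define u where "u k s = ln (g k s)" for k s
  have um: "u k \<in> borel_measurable borel" for k
  proof -
    have "u k \<in> borel_measurable \<alpha>" unfolding u_def using g(1) by measurable
    then show ?thesis by (simp add: measurable_cong_sets[OF sets_\<alpha> refl])
  qed
  have uL: "\<bar>u k s\<bar> \<le> L" for k s using g(3) by (simp add: u_def)
  note U = conditional_law_integral[OF adm reg class_sets um uL]
  have dv: "ennreal (\<integral>s. u k s \<partial>\<kappa> x) \<le> relative_entropy (\<kappa> x) \<alpha>" for k x
  proof -
    have "ennreal ((\<integral>s. u k s \<partial>\<kappa> x) - ln (\<integral>s. exp (u k s) \<partial>\<alpha>)) \<le> relative_entropy (\<kappa> x) \<alpha>"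
      using kx um uL sets_\<alpha>
      by (intro donsker_varadhan_relative_entropy A.prob_space_axioms) (auto simp: measurable_cong_sets[OF sets_\<alpha> refl])
    moreover have "(\<integral>s. exp (u k s) \<partial>\<alpha>) = 1" using g(2,4) by (simp add: u_def)
    ultimately show ?thesis by simp
  qed
  define h where "h x = (\<integral>s. u (b x) s \<partial>\<kappa> x)" for x
  have h: "h x = (\<Sum>k\<le>B. (\<integral>s. u k s \<partial>\<kappa> x) * indicator {x. b x = k} x)" for x
    unfolding h_def using sum_classes[of "\<lambda>k. \<integral>s. u k s \<partial>\<kappa> x" x] by simp
  have ih: "integrable P (\<lambda>x. (\<integral>s. u k s \<partial>\<kappa> x) * indicator {x. b x = k} x)" for k
  proof (rule P.integrable_const_bound[where B=L])
    show "AE x in P. norm ((\<integral>s. u k s \<partial>\<kappa> x) * indicator {x. b x = k} x) \<le> L"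
    proof (rule AE_I2)
      fix x
      have "\<bar>\<integral>s. u k s \<partial>\<kappa> x\<bar> \<le> L" by (rule U(2))
      then show "norm ((\<integral>s. u k s \<partial>\<kappa> x) * indicator {x. b x = k} x) \<le> L" by (auto simp: indicator_def)
    qed
    show "(\<lambda>x. (\<integral>s. u k s \<partial>\<kappa> x) * indicator {x. b x = k} x) \<in> borel_measurable P"
      using U(1)[of k] by simp
  qed
  have hi: "integrable P h" unfolding h by (intro Bochner_Integration.integrable_sum ih)
  have "(\<Sum>k\<le>B. mass k * (\<integral>x. f k x * ln (g k x) \<partial>\<alpha>)) = (\<Sum>k\<le>B. \<integral>z. u k (fst z) * indicator {x. b x = k} (snd z) \<partial>\<nu>)"
    using has_class_densities_integral[OF adm f _ um] by (intro sum.cong refl) (simp add: u_def mult.commute)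
  also have "\<dots> = (\<Sum>k\<le>B. \<integral>x. (\<integral>s. u k s \<partial>\<kappa> x) * indicator {x. b x = k} x \<partial>P)"
    by (simp only: U(3))
  also have "\<dots> = (\<integral>x. h x \<partial>P)"
    unfolding h by (rule Bochner_Integration.integral_sum[symmetric]) (rule ih)
  also have "\<dots> \<le> enn2real (\<integral>\<^sup>+x. ennreal (h x) \<partial>P)"
    using hi by (simp add: real_lebesgue_integral_def)
  also have "\<dots> \<le> enn2real ?T"
    using fin dv by (intro enn2real_mono nn_integral_mono) (auto simp: h_def)
  finally show ?thesis .
qed

text \<open>The class densities of \<nu> are clipped. With h the entropy of the clipped density g
  and j the integral of f ln g, clipping gives (1 - \<eta>) h \<le> j, and the sum of j over the
  classes is at most the mean entropy of \<nu>. The energy changes by a multiple of the L1 distance,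
  so both losses are linear in \<eta>.\<close>

lemma trial_densities:
  assumes adm: "admissible \<nu>" and reg: "regular_conditional_law \<nu> \<kappa>"
    and fin: "(\<integral>\<^sup>+x. relative_entropy (\<kappa> x) \<alpha> \<partial>P) < \<infinity>" and \<epsilon>: "0 < \<epsilon>"
  obtains g lo hi where "\<And>k. g k \<in> borel_measurable \<alpha>" "0 < lo" "\<And>k x. lo \<le> g k x" "\<And>k x. g k x \<le> hi" "\<And>k. (\<integral>x. g k x \<partial>\<alpha>) = 1"
    "energy (\<lambda>x. c (b x)) \<nu> - enn2real (\<integral>\<^sup>+x. relative_entropy (\<kappa> x) \<alpha> \<partial>P) - \<epsilon> \<le> class_energy g - (\<Sum>k\<le>B. mass k * (\<integral>x. g k x * ln (g k x) \<partial>\<alpha>))"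
proof -
  define T where "T = enn2real (\<integral>\<^sup>+x. relative_entropy (\<kappa> x) \<alpha> \<partial>P)"
  define C where "C = (\<Sum>k\<le>B. \<Sum>l\<le>B. c k * c l / (2 * mean) * (mass k * mass l))"
  have T0: "0 \<le> T" by (simp add: T_def)
  have C0: "0 \<le> C" unfolding C_def using mean_pos c_nonneg mass_nonneg by (intro sum_nonneg) auto
  \<comment> \<open>The losses are at most 2 \<eta> T for the entropy and 2 \<eta> K C for the
    energy; the summand 1 keeps the denominator positive. The cap 1 / 2 is needed for 1 / (1 -
    \<eta>) \<le> 1 + 2 \<eta>.\<close>
  define \<eta> where "\<eta> = min (1 / 2) (\<epsilon> / (2 * T + 2 * K * C + 1))"
  have den: "0 < 2 * T + 2 * K * C + 1" using T0 K_nonneg C0 by (simp add: add_nonneg_pos)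
  have "0 < \<eta>" unfolding \<eta>_def using den \<epsilon> by simp
  moreover have "\<eta> \<le> 1 / 2" unfolding \<eta>_def by (rule min.cobounded1)
  ultimately have \<eta>: "0 < \<eta>" "\<eta> \<le> 1 / 2" .
  have \<eta>\<epsilon>: "\<eta> * (2 * T + 2 * K * C) \<le> \<epsilon>"
  proof -
    have "\<eta> * (2 * T + 2 * K * C) \<le> \<eta> * (2 * T + 2 * K * C + 1)" using \<eta> by (intro mult_left_mono) auto
    also have "\<dots> \<le> \<epsilon> / (2 * T + 2 * K * C + 1) * (2 * T + 2 * K * C + 1)" using den by (intro mult_right_mono) (auto simp: \<eta>_def)
    finally show ?thesis using den by simp
  qed
  obtain f where f: "has_class_densities \<nu> f" and f1: "\<And>k. k \<le> B \<Longrightarrow> (\<integral>x. f k x \<partial>\<alpha>) = 1"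
    using class_density_exists[OF adm reg fin] by blast
  have fi: "integrable \<alpha> (f k)" and f0: "\<forall>s. 0 \<le> f k s" if "k \<le> B" for k
    using f that unfolding has_class_densities_def by blast+
  define Q where "Q k g lo hi Z \<longleftrightarrow> g \<in> borel_measurable \<alpha> \<and> 0 < lo \<and> (\<forall>x. lo \<le> g x) \<and> (\<forall>x. g x \<le> hi) \<and>
    (\<integral>x. g x \<partial>\<alpha>) = 1 \<and> (k \<le> B \<longrightarrow> (\<integral>x. \<bar>f k x - g x\<bar> \<partial>\<alpha>) \<le> \<eta> \<and> 1 - \<eta> \<le> Z \<and> (\<forall>x. Z * (g x * ln (g x)) \<le> f k x * ln (g x)))"
    for k and g :: "'a \<Rightarrow> real" and lo hi Z :: real
  have "\<exists>g lo hi Z. Q k g lo hi Z" for k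
  proof (cases "k \<le> B")
    case True
    have f0': "0 \<le> f k x" for x using f0[OF True] by blast
    show ?thesis
      by (rule clipped_density[OF A.prob_space_axioms borel_measurable_integrable[OF fi[OF True]] f0' fi[OF True] f1[OF True] \<eta>(1)])
        (unfold Q_def, blast)
  next
    case False
    then have "Q k (\<lambda>_. 1) 1 1 0" by (simp add: Q_def A.prob_space)
    then show ?thesis by blast
  qed
  then obtain g lo hi Z where Q: "\<And>k. Q k (g k) (lo k) (hi k) (Z k)" by metis
  have g: "g k \<in> borel_measurable \<alpha>" "0 < lo k" "lo k \<le> g k x" "g k x \<le> hi k" "(\<integral>x. g k x \<partial>\<alpha>) = 1" for k x
    using Q[of k] unfolding Q_def by blast+
  have fg: "(\<integral>x. \<bar>f k x - g k x\<bar> \<partial>\<alpha>) \<le> \<eta>" "1 - \<eta> \<le> Z k" "Z k * (g k x * ln (g k x)) \<le> f k x * ln (g k x)" if "k \<le> B" for k x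
    using Q[of k] that unfolding Q_def by blast+
  \<comment> \<open>Gibbs' inequality wants bounds common to all densities of the family: finitely
    many classes allow a minimum and a maximum, and beyond \<open>B\<close> the family is continued
    by 1.\<close>
  define g' where "g' k = (if k \<le> B then g k else (\<lambda>_. 1))" for k
  define lo' where "lo' = Min (insert 1 (lo ` {..B}))"
  define hi' where "hi' = Max (insert 1 (hi ` {..B}))"
  have g'm: "g' k \<in> borel_measurable \<alpha>" for k using g(1) by (simp add: g'_def)
  have lo': "0 < lo'" unfolding lo'_def using g(2) by (subst Min_gr_iff) auto
  have g'lo: "lo' \<le> g' k x" for k x
  proof (cases "k \<le> B")
    case True
    then have "lo' \<le> lo k" unfolding lo'_def by (intro Min_le) auto
    then show ?thesis using g(3)[of k x] True by (simp add: g'_def)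
  next
    case False
    have "lo' \<le> 1" unfolding lo'_def by (intro Min_le) auto
    then show ?thesis using False by (simp add: g'_def)
  qed
  have g'hi: "g' k x \<le> hi'" for k x
  proof (cases "k \<le> B")
    case True
    then have "hi k \<le> hi'" unfolding hi'_def by (intro Max_ge) auto
    then show ?thesis using g(4)[of k x] True by (simp add: g'_def)
  next
    case False
    have "1 \<le> hi'" unfolding hi'_def by (intro Max_ge) auto
    then show ?thesis using False by (simp add: g'_def)
  qed
  have g'1: "(\<integral>x. g' k x \<partial>\<alpha>) = 1" for k using g(5) by (simp add: g'_def A.prob_space)
  have g'pos: "0 < g' k x" for k x using g'lo[of k x] lo' by linarith
  have g'i: "integrable \<alpha> (g' k)" for k
    using g'hi g'pos by (intro A.integrable_const_bound[where B=hi']) (auto intro!: AE_I2 simp: less_imp_le g'm)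
  have lnb: "\<bar>ln (g' k x)\<bar> \<le> \<bar>ln lo'\<bar> + \<bar>ln hi'\<bar>" for k x
  proof -
    have "ln lo' \<le> ln (g' k x)" "ln (g' k x) \<le> ln hi'"
      using g'lo[of k x] g'hi[of k x] lo' g'pos[of k x] by auto
    then show ?thesis by linarith
  qed
  define h where "h k = (\<integral>x. g' k x * ln (g' k x) \<partial>\<alpha>)" for k
  define j where "j k = (\<integral>x. f k x * ln (g' k x) \<partial>\<alpha>)" for k
  have hint: "integrable \<alpha> (\<lambda>x. g' k x * ln (g' k x))" for k
  proof (rule Bochner_Integration.integrable_bound)
    show "integrable \<alpha> (\<lambda>x. g' k x * (\<bar>ln lo'\<bar> + \<bar>ln hi'\<bar>))" using g'i by simp
    show "AE x in \<alpha>. norm (g' k x * ln (g' k x)) \<le> norm (g' k x * (\<bar>ln lo'\<bar> + \<bar>ln hi'\<bar>))"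
    proof (rule AE_I2)
      fix x
      have "\<bar>g' k x\<bar> * \<bar>ln (g' k x)\<bar> \<le> \<bar>g' k x\<bar> * (\<bar>ln lo'\<bar> + \<bar>ln hi'\<bar>)"
        using lnb[of k x] by (rule mult_left_mono) simp
      then show "norm (g' k x * ln (g' k x)) \<le> norm (g' k x * (\<bar>ln lo'\<bar> + \<bar>ln hi'\<bar>))" by (simp add: abs_mult)
    qed
  qed (use g'm in measurable)
  have jint: "integrable \<alpha> (\<lambda>x. f k x * ln (g' k x))" if "k \<le> B" for k
  proof (rule Bochner_Integration.integrable_bound)
    show "integrable \<alpha> (\<lambda>x. f k x * (\<bar>ln lo'\<bar> + \<bar>ln hi'\<bar>))" using fi[OF that] by simp
    show "AE x in \<alpha>. norm (f k x * ln (g' k x)) \<le> norm (f k x * (\<bar>ln lo'\<bar> + \<bar>ln hi'\<bar>))"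
    proof (rule AE_I2)
      fix x
      have "\<bar>f k x\<bar> * \<bar>ln (g' k x)\<bar> \<le> \<bar>f k x\<bar> * (\<bar>ln lo'\<bar> + \<bar>ln hi'\<bar>)"
        using lnb[of k x] by (rule mult_left_mono) simp
      then show "norm (f k x * ln (g' k x)) \<le> norm (f k x * (\<bar>ln lo'\<bar> + \<bar>ln hi'\<bar>))" by (simp add: abs_mult)
    qed
  qed (use g'm borel_measurable_integrable[OF fi[OF that]] in measurable)
  have h0: "0 \<le> h k" for k
  proof -
    have "(\<integral>x. g' k x - 1 \<partial>\<alpha>) \<le> h k" unfolding h_def
    proof (rule integral_mono)
      fix x
      have p: "0 < g' k x" by (rule g'pos)
      have "ln (inverse (g' k x)) \<le> inverse (g' k x) - 1" using p by (intro ln_le_minus_one) simp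
      then have "g' k x * (- ln (g' k x)) \<le> g' k x * (inverse (g' k x) - 1)" using p by (intro mult_left_mono) (auto simp: ln_inverse)
      also have "\<dots> = 1 - g' k x" using p by (simp add: right_diff_distrib)
      finally show "g' k x - 1 \<le> g' k x * ln (g' k x)" by simp
    qed (use g'i hint in auto)
    then show ?thesis using g'i g'1 by (simp add: A.prob_space)
  qed
  have hj: "h k \<le> (1 + 2 * \<eta>) * j k" if k: "k \<le> B" for k
  proof -
    have "(\<integral>x. Z k * (g' k x * ln (g' k x)) \<partial>\<alpha>) \<le> j k"
      unfolding j_def
      by (rule integral_mono[OF integrable_mult_right[OF hint] jint[OF k]]) (use fg(3)[OF k] k in \<open>simp add: g'_def\<close>)
    then have Zh: "Z k * h k \<le> j k" by (simp add: h_def)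
    have "(1 - \<eta>) * h k \<le> Z k * h k" using fg(2)[OF k] h0 by (intro mult_right_mono)
    then have "(1 - \<eta>) * h k \<le> j k" using Zh by linarith
    then have "(1 + 2 * \<eta>) * ((1 - \<eta>) * h k) \<le> (1 + 2 * \<eta>) * j k" using \<eta> by (intro mult_left_mono) auto
    \<comment> \<open>This is (1 + 2 \<eta>)(1 - \<eta>) = 1 + \<eta> (1 - 2 \<eta>) \<ge> 1,
      together with nonnegativity of the entropy.\<close>
    moreover have "h k \<le> (1 + 2 * \<eta>) * ((1 - \<eta>) * h k)"
    proof -
      have "0 \<le> \<eta> * (1 - 2 * \<eta>) * h k" using \<eta> h0 by simp
      then show ?thesis by (simp add: algebra_simps)
    qed
    ultimately show ?thesis by linarith
  qed
  have "(\<Sum>k\<le>B. mass k * j k) \<le> T"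
    unfolding j_def T_def using entropy_class_bound[OF adm reg fin f g'm g'pos lnb g'1] .
  have "(\<Sum>k\<le>B. mass k * h k) \<le> (\<Sum>k\<le>B. mass k * ((1 + 2 * \<eta>) * j k))"
    using hj mass_nonneg by (intro sum_mono mult_left_mono) auto
  also have "\<dots> = (1 + 2 * \<eta>) * (\<Sum>k\<le>B. mass k * j k)" by (simp add: sum_distrib_left mult_ac)
  also have "\<dots> \<le> (1 + 2 * \<eta>) * T" using \<open>(\<Sum>k\<le>B. mass k * j k) \<le> T\<close> \<eta> by (intro mult_left_mono) auto
  finally have ent: "(\<Sum>k\<le>B. mass k * h k) \<le> T + 2 * \<eta> * T" by (simp add: algebra_simps)
  have "class_energy f \<le> (\<Sum>k\<le>B. \<Sum>l\<le>B. c k * c l / (2 * mean) * (mass k * mass l) * (pair_mean g' k l + K * (2 * \<eta>)))"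
    unfolding class_energy_pair_mean
  proof (intro sum_mono mult_left_mono)
    fix k l assume kl: "k \<in> {..B}" "l \<in> {..B}"
    then have k: "k \<le> B" and l: "l \<le> B" by auto
    have "pair_mean f k l \<le> pair_mean g' k l + K * ((\<integral>x. \<bar>f k x - g' k x\<bar> \<partial>\<alpha>) + (\<integral>x. \<bar>f l x - g' l x\<bar> \<partial>\<alpha>))"
      using f0[OF k] f0[OF l] g'pos by (intro pair_mean_dist fi k l g'i g'1 f1) (auto simp: less_imp_le)
    also have "\<dots> \<le> pair_mean g' k l + K * (\<eta> + \<eta>)"
      using fg(1)[OF k] fg(1)[OF l] k l K_nonneg by (intro add_left_mono mult_left_mono add_mono) (auto simp: g'_def)
    finally show "pair_mean f k l \<le> pair_mean g' k l + K * (2 * \<eta>)" by simp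
    show "0 \<le> c k * c l / (2 * mean) * (mass k * mass l)" using mean_pos c_nonneg mass_nonneg by simp
  qed
  also have "\<dots> = class_energy g' + C * (K * (2 * \<eta>))"
    unfolding class_energy_pair_mean C_def distrib_left sum.distrib sum_distrib_right ..
  finally have en: "energy (\<lambda>x. c (b x)) \<nu> \<le> class_energy g' + C * (K * (2 * \<eta>))"
    unfolding energy_class_energy[OF adm f] .
  have "energy (\<lambda>x. c (b x)) \<nu> - T - \<epsilon> \<le> class_energy g' - (\<Sum>k\<le>B. mass k * h k)"
    using en ent \<eta>\<epsilon> by (simp add: algebra_simps)
  with g'm lo' g'lo g'hi g'1 show ?thesis unfolding T_def h_def by (rule that)
qed

end

section \<open>Lower bound\<close>

lemma sum_over_fibres:
  fixes F :: "'b \<Rightarrow> real"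
  assumes "finite S" "finite T" "\<And>i. i \<in> S \<Longrightarrow> \<beta> i \<in> T"
  shows "(\<Sum>i\<in>S. F (\<beta> i)) = (\<Sum>t\<in>T. real (card {i \<in> S. \<beta> i = t}) * F t)"
proof -
  have "(\<Sum>t\<in>T. real (card {i \<in> S. \<beta> i = t}) * F t) = (\<Sum>t\<in>T. \<Sum>i\<in>{i \<in> S. \<beta> i = t}. F (\<beta> i))"
    by (intro sum.cong refl) simp
  also have "\<dots> = (\<Sum>i\<in>S. F (\<beta> i))"
    using assms by (intro sum.group) auto
  finally show ?thesis ..
qed

lemma double_sum_over_fibres:
  fixes H :: "'b \<Rightarrow> 'b \<Rightarrow> real"
  assumes "finite S" "finite T" "\<And>i. i \<in> S \<Longrightarrow> \<beta> i \<in> T"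
  shows "(\<Sum>i\<in>S. \<Sum>j\<in>S. H (\<beta> i) (\<beta> j)) =
    (\<Sum>t\<in>T. \<Sum>u\<in>T. real (card {i \<in> S. \<beta> i = t}) * real (card {i \<in> S. \<beta> i = u}) * H t u)"
proof -
  have "(\<Sum>i\<in>S. \<Sum>j\<in>S. H (\<beta> i) (\<beta> j)) = (\<Sum>i\<in>S. \<Sum>u\<in>T. real (card {i \<in> S. \<beta> i = u}) * H (\<beta> i) u)"
    by (intro sum.cong refl sum_over_fibres assms)
  also have "\<dots> = (\<Sum>t\<in>T. real (card {i \<in> S. \<beta> i = t}) * (\<Sum>u\<in>T. real (card {i \<in> S. \<beta> i = u}) * H t u))"
    by (rule sum_over_fibres[OF assms])
  finally show ?thesis by (simp add: sum_distrib_left mult_ac)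
qed

lemma (in mean_field) pair_energy_abs_le:
  assumes "\<And>i. \<bar>d i\<bar> \<le> D"
  shows "\<bar>pair_energy d V N \<sigma>\<bar> \<le> (real N)\<^sup>2 * (D\<^sup>2 * K)"
proof -
  have D: "0 \<le> D" using assms[of 0] by linarith
  have "\<bar>pair_energy d V N \<sigma>\<bar> \<le> (\<Sum>e\<in>vertex_pairs N. \<bar>case e of (i, j) \<Rightarrow> d i * d j * V (\<sigma> i) (\<sigma> j)\<bar>)"
    unfolding pair_energy_def by (rule sum_abs)
  also have "\<dots> \<le> (\<Sum>e\<in>vertex_pairs N. D\<^sup>2 * K)"
  proof (rule sum_mono)
    fix e :: "nat \<times> nat"
    obtain i j where e: "e = (i, j)" by (cases e)
    have "\<bar>d i * d j * V (\<sigma> i) (\<sigma> j)\<bar> \<le> D * D * K"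
      unfolding abs_mult using assms D V_nonneg V_le by (intro mult_mono) auto
    then show "\<bar>case e of (i, j) \<Rightarrow> d i * d j * V (\<sigma> i) (\<sigma> j)\<bar> \<le> D\<^sup>2 * K" by (simp add: e power2_eq_square)
  qed
  also have "\<dots> = real (card (vertex_pairs N)) * (D\<^sup>2 * K)" by simp
  also have "\<dots> \<le> (real N)\<^sup>2 * (D\<^sup>2 * K)"
  proof (rule mult_right_mono)
    have "card (vertex_pairs N) \<le> card ({1..N} \<times> {1..N})" by (rule card_mono[OF _ vertex_pairs_subset]) simp
    then show "real (card (vertex_pairs N)) \<le> (real N)\<^sup>2" by (simp add: power2_eq_square flip: of_nat_mult)
  qed (use K_nonneg D in simp)
  finally show ?thesis .
qed

locale weighted_mean_field = discretized_mean_field +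
  fixes w :: "nat \<Rightarrow> real"
  assumes freq: "\<And>k. (\<lambda>N. card {i \<in> {1..N}. b (w i) = k} / N) \<longlonglongrightarrow> measure P {x. b x = k}"
begin

definition class_freq :: "nat \<Rightarrow> nat \<Rightarrow> real" where
  "class_freq N k = card {i \<in> {1..N}. b (w i) = k} / N"

definition class_weight :: "nat \<Rightarrow> real" where "class_weight i = c (b (w i))"

text \<open>The normalization \<open>mean * N\<close> is the limiting form of the total weight. With
  it, the asymptotics depend on the weights through the class frequencies only; the exchange with
  the actual total weight is paid for separately.\<close>

definition scaled_energy :: "nat \<Rightarrow> (nat \<Rightarrow> 'a) \<Rightarrow> real" where
  "scaled_energy N \<sigma> = pair_energy class_weight V N \<sigma> / (mean * N)"

definition log_partition :: "nat \<Rightarrow> real" where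
  "log_partition N = ln (\<integral>\<sigma>. exp (scaled_energy N \<sigma>) \<partial>PiM {1..N} (\<lambda>_. \<alpha>)) / N"

lemma class_freq_tendsto: "(\<lambda>N. class_freq N k) \<longlonglongrightarrow> mass k"
  unfolding class_freq_def mass_def by (rule freq)

lemma card_class: "real (card {i \<in> {1..N}. b (w i) = k}) = real N * class_freq N k"
  by (cases "N = 0") (simp_all add: class_freq_def)

lemma sum_vertices: "(\<Sum>i=1..N. F (b (w i))) = real N * (\<Sum>k\<le>B. class_freq N k * F k)"
proof -
  have "(\<Sum>i=1..N. F (b (w i))) = (\<Sum>k\<le>B. real (card {i \<in> {1..N}. b (w i) = k}) * F k)"
    by (rule sum_over_fibres) (auto simp: b_le)
  then show ?thesis unfolding card_class by (simp add: sum_distrib_left mult.assoc)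
qed

lemma double_sum_vertices:
  "(\<Sum>i=1..N. \<Sum>j=1..N. H (b (w i)) (b (w j))) = (real N)\<^sup>2 * (\<Sum>k\<le>B. \<Sum>l\<le>B. class_freq N k * class_freq N l * H k l)"
proof -
  have "(\<Sum>i=1..N. \<Sum>j=1..N. H (b (w i)) (b (w j))) =
    (\<Sum>k\<le>B. \<Sum>l\<le>B. real (card {i \<in> {1..N}. b (w i) = k}) * real (card {i \<in> {1..N}. b (w i) = l}) * H k l)"
    by (rule double_sum_over_fibres) (auto simp: b_le)
  then show ?thesis unfolding card_class by (simp add: sum_distrib_left power2_eq_square mult_ac)
qed

definition max_weight :: real where "max_weight = (\<Sum>k\<le>B. c k)"

lemma class_weight_bounds: "0 \<le> class_weight i" "class_weight i \<le> max_weight"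
  unfolding class_weight_def max_weight_def
  using c_nonneg b_le by (auto intro!: member_le_sum)

lemma max_weight_nonneg: "0 \<le> max_weight"
  using class_weight_bounds[of 0] by linarith

lemma scaled_energy_measurable[measurable]: "scaled_energy N \<in> borel_measurable (PiM {1..N} (\<lambda>_. \<alpha>))"
  unfolding scaled_energy_def
  by (intro borel_measurable_divide borel_measurable_const measurable_pair_energy sets_\<alpha> V_borel)

lemma scaled_energy_bounds:
  "0 \<le> scaled_energy N \<sigma>" "scaled_energy N \<sigma> \<le> N * (max_weight\<^sup>2 * K / mean)"
proof -
  show "0 \<le> scaled_energy N \<sigma>" unfolding scaled_energy_def
    using mean_pos by (intro divide_nonneg_nonneg pair_energy_nonneg class_weight_bounds V_nonneg) auto
  have "pair_energy class_weight V N \<sigma> \<le> (real N)\<^sup>2 * (max_weight\<^sup>2 * K)"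
    using pair_energy_abs_le[of class_weight max_weight N \<sigma>] class_weight_bounds by (simp add: abs_le_iff)
  then have "scaled_energy N \<sigma> \<le> (real N)\<^sup>2 * (max_weight\<^sup>2 * K) / (mean * N)"
    unfolding scaled_energy_def using mean_pos by (intro divide_right_mono) auto
  also have "\<dots> = N * (max_weight\<^sup>2 * K / mean)"
    by (cases "N = 0") (simp_all add: power2_eq_square)
  finally show "scaled_energy N \<sigma> \<le> N * (max_weight\<^sup>2 * K / mean)" .
qed

lemma integrable_exp_scaled_energy: "integrable (PiM {1..N} (\<lambda>_. \<alpha>)) (\<lambda>\<sigma>. exp (scaled_energy N \<sigma>))"
proof -
  interpret PI: prob_space "PiM {1..N} (\<lambda>_. \<alpha>)" by (rule prob_space_PiM) (rule A.prob_space_axioms)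
  show ?thesis
  proof (rule PI.integrable_const_bound)
    show "AE \<sigma> in PiM {1..N} (\<lambda>_. \<alpha>). norm (exp (scaled_energy N \<sigma>)) \<le> exp (N * (max_weight\<^sup>2 * K / mean))"
      using scaled_energy_bounds(2) by (intro AE_I2) simp
  qed measurable
qed

text \<open>In Gibbs' inequality vertex \<open>i\<close> carries the density of its own class. The
  expected energy and the entropy are then explicit in the class frequencies, apart from a diagonal
  correction of order 1 / N, and \<open>L\<close> converges because the frequencies do.\<close>

lemma log_partition_lower:
  assumes g: "\<And>k. g k \<in> borel_measurable \<alpha>" "0 < lo" "\<And>k x. lo \<le> g k x" "\<And>k x. g k x \<le> hi" "\<And>k. (\<integral>x. g k x \<partial>\<alpha>) = 1"
  obtains L where "L \<longlonglongrightarrow> class_energy g - (\<Sum>k\<le>B. mass k * (\<integral>x. g k x * ln (g k x) \<partial>\<alpha>))"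
    "\<And>N. 1 \<le> N \<Longrightarrow> L N \<le> log_partition N"
proof -
  define h where "h k = (\<integral>x. g k x * ln (g k x) \<partial>\<alpha>)" for k
  define L where "L N = (\<Sum>k\<le>B. \<Sum>l\<le>B. c k * c l / (2 * mean) * (class_freq N k * class_freq N l) * pair_mean g k l)
     - (\<Sum>k\<le>B. class_freq N k * ((c k)\<^sup>2 * pair_mean g k k)) / (2 * mean) * (1 / real N) - (\<Sum>k\<le>B. class_freq N k * h k)" for N
  have gpos: "0 < g k x" for k x using g(2) g(3)[of k x] by linarith
  note [measurable] = g(1)
  have "L \<longlonglongrightarrow> (\<Sum>k\<le>B. \<Sum>l\<le>B. c k * c l / (2 * mean) * (mass k * mass l) * pair_mean g k l)
     - (\<Sum>k\<le>B. mass k * ((c k)\<^sup>2 * pair_mean g k k)) / (2 * mean) * 0 - (\<Sum>k\<le>B. mass k * h k)"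
    unfolding L_def using mean_pos
    by (intro tendsto_intros class_freq_tendsto lim_1_over_n) auto
  then have lim: "L \<longlonglongrightarrow> class_energy g - (\<Sum>k\<le>B. mass k * h k)" by (simp add: class_energy_pair_mean)
  have bound: "L N \<le> log_partition N" if N: "1 \<le> N" for N
  proof -
    let ?I = "{1..N}"
    let ?D = "PiM ?I (\<lambda>i. density \<alpha> (g (b (w i))))"
    define G where "G i = g (b (w i))" for i
    have gi: "integrable \<alpha> (g k)" for k
      using g(4) gpos by (intro A.integrable_const_bound[where B=hi]) (auto simp: less_imp_le)
    have g1': "(\<integral>\<^sup>+x. ennreal (g k x) \<partial>\<alpha>) = 1" for k
      using gi g(5) gpos by (subst nn_integral_eq_integral) (auto simp: less_imp_le)
    have prD: "prob_space (density \<alpha> (G i))" for i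
      using g1' by (intro prob_spaceI) (simp add: emeasure_density G_def cong: nn_integral_cong)
    interpret DP: prob_space "PiM ?I (\<lambda>i. density \<alpha> (G i))" by (rule prob_space_PiM) (rule prD)
    interpret D: product_prob_space "\<lambda>i. density \<alpha> (G i)" ?I by (rule product_prob_spaceI) (rule prD)
    have stsD: "sets (PiM ?I (\<lambda>i. density \<alpha> (G i))) = sets (PiM ?I (\<lambda>_. \<alpha>))"
      by (simp cong: sets_PiM_cong)
    have pair: "(\<integral>\<sigma>. V (\<sigma> i) (\<sigma> j) \<partial>PiM ?I (\<lambda>i. density \<alpha> (G i))) = pair_mean g (b (w i)) (b (w j))"
      and pairi: "integrable (PiM ?I (\<lambda>i. density \<alpha> (G i))) (\<lambda>\<sigma>. V (\<sigma> i) (\<sigma> j))" if ij: "(i, j) \<in> vertex_pairs N" for i j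
    proof -
      have ij': "i \<in> ?I" "j \<in> ?I" "i \<noteq> j" using ij by (auto simp: vertex_pairs_def)
      have Vm: "(\<lambda>\<sigma>. V (\<sigma> i) (\<sigma> j)) \<in> borel_measurable (PiM ?I (\<lambda>i. density \<alpha> (G i)))"
        unfolding measurable_cong_sets[OF stsD refl] using ij' by (intro measurable_pair_component sets_\<alpha> V_borel)
      then show "integrable (PiM ?I (\<lambda>i. density \<alpha> (G i))) (\<lambda>\<sigma>. V (\<sigma> i) (\<sigma> j))"
        using V_nonneg V_le by (intro DP.integrable_const_bound[where B=K]) auto
      have dd: "density \<alpha> (G i) \<Otimes>\<^sub>M density \<alpha> (G j) = density (\<alpha> \<Otimes>\<^sub>M \<alpha>) (\<lambda>(x, y). ennreal (G i x) * ennreal (G j y))"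
        using prD[of j] by (intro pair_measure_density) (auto simp: G_def prob_space_imp_sigma_finite A.sigma_finite_measure_axioms)
      have pm: "(\<lambda>\<sigma>. (\<sigma> i, \<sigma> j)) \<in> PiM ?I (\<lambda>i. density \<alpha> (G i)) \<rightarrow>\<^sub>M density \<alpha> (G i) \<Otimes>\<^sub>M density \<alpha> (G j)"
        using ij' by (intro measurable_Pair measurable_component_singleton) auto
      have "(\<integral>\<sigma>. V (\<sigma> i) (\<sigma> j) \<partial>PiM ?I (\<lambda>i. density \<alpha> (G i))) = (\<integral>z. V (fst z) (snd z) \<partial>distr (PiM ?I (\<lambda>i. density \<alpha> (G i))) (density \<alpha> (G i) \<Otimes>\<^sub>M density \<alpha> (G j)) (\<lambda>\<sigma>. (\<sigma> i, \<sigma> j)))"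
        using pm by (subst integral_distr) (simp_all add: dd)
      also have "distr (PiM ?I (\<lambda>i. density \<alpha> (G i))) (density \<alpha> (G i) \<Otimes>\<^sub>M density \<alpha> (G j)) (\<lambda>\<sigma>. (\<sigma> i, \<sigma> j)) = density \<alpha> (G i) \<Otimes>\<^sub>M density \<alpha> (G j)"
        using ij' by (intro D.distr_PiM_pair) auto
      also have "\<dots> = density (\<alpha> \<Otimes>\<^sub>M \<alpha>) (\<lambda>z. ennreal (G i (fst z) * G j (snd z)))"
        unfolding dd using gpos by (intro arg_cong2[where f=density] refl ext) (simp add: split_beta G_def less_imp_le ennreal_mult)
      also have "(\<integral>z. V (fst z) (snd z) \<partial>density (\<alpha> \<Otimes>\<^sub>M \<alpha>) (\<lambda>z. ennreal (G i (fst z) * G j (snd z)))) = (\<integral>z. (G i (fst z) * G j (snd z)) * V (fst z) (snd z) \<partial>(\<alpha> \<Otimes>\<^sub>M \<alpha>))"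
        using gpos by (intro integral_real_density) (auto simp: G_def less_imp_le)
      also have "\<dots> = pair_mean g (b (w i)) (b (w j))"
        unfolding pair_mean_def by (simp add: G_def mult.commute)
      finally show "(\<integral>\<sigma>. V (\<sigma> i) (\<sigma> j) \<partial>PiM ?I (\<lambda>i. density \<alpha> (G i))) = pair_mean g (b (w i)) (b (w j))" .
    qed
    have "DP.expectation (scaled_energy N) = (\<Sum>(i, j)\<in>vertex_pairs N. class_weight i * class_weight j * pair_mean g (b (w i)) (b (w j))) / (mean * N)"
    proof -
      have "DP.expectation (scaled_energy N) = DP.expectation (\<lambda>\<sigma>. \<Sum>e\<in>vertex_pairs N. class_weight (fst e) * class_weight (snd e) * V (\<sigma> (fst e)) (\<sigma> (snd e))) / (mean * N)"
        unfolding scaled_energy_def pair_energy_def by (simp add: split_beta)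
      also have "DP.expectation (\<lambda>\<sigma>. \<Sum>e\<in>vertex_pairs N. class_weight (fst e) * class_weight (snd e) * V (\<sigma> (fst e)) (\<sigma> (snd e))) =
        (\<Sum>e\<in>vertex_pairs N. DP.expectation (\<lambda>\<sigma>. class_weight (fst e) * class_weight (snd e) * V (\<sigma> (fst e)) (\<sigma> (snd e))))"
        by (intro Bochner_Integration.integral_sum integrable_mult_right pairi) simp
      also have "\<dots> = (\<Sum>e\<in>vertex_pairs N. class_weight (fst e) * class_weight (snd e) * pair_mean g (b (w (fst e))) (b (w (snd e))))"
        by (intro sum.cong refl) (subst integral_mult_right_zero, subst pair, simp_all)
      finally show ?thesis by (simp add: split_beta)
    qed
    also have "(\<Sum>(i, j)\<in>vertex_pairs N. class_weight i * class_weight j * pair_mean g (b (w i)) (b (w j))) =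
      ((\<Sum>i=1..N. \<Sum>j=1..N. class_weight i * class_weight j * pair_mean g (b (w i)) (b (w j))) - (\<Sum>i=1..N. class_weight i * class_weight i * pair_mean g (b (w i)) (b (w i)))) / 2"
      by (rule sum_vertex_pairs) (simp add: pair_mean_commute[OF g(1)] mult.commute)
    also have "(\<Sum>i=1..N. \<Sum>j=1..N. class_weight i * class_weight j * pair_mean g (b (w i)) (b (w j))) = (real N)\<^sup>2 * (\<Sum>k\<le>B. \<Sum>l\<le>B. class_freq N k * class_freq N l * (c k * c l * pair_mean g k l))"
      unfolding class_weight_def by (rule double_sum_vertices)
    also have "(\<Sum>i=1..N. class_weight i * class_weight i * pair_mean g (b (w i)) (b (w i))) = real N * (\<Sum>k\<le>B. class_freq N k * (c k * c k * pair_mean g k k))"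
      unfolding class_weight_def by (rule sum_vertices)
    finally have E: "DP.expectation (scaled_energy N) = ((real N)\<^sup>2 * (\<Sum>k\<le>B. \<Sum>l\<le>B. class_freq N k * class_freq N l * (c k * c l * pair_mean g k l)) - real N * (\<Sum>k\<le>B. class_freq N k * (c k * c k * pair_mean g k k))) / 2 / (mean * N)" .
    have S: "(\<Sum>i\<in>?I. \<integral>x. G i x * ln (G i x) \<partial>\<alpha>) = real N * (\<Sum>k\<le>B. class_freq N k * h k)"
      unfolding G_def h_def[symmetric] by (rule sum_vertices)
    have exp_ge: "exp (DP.expectation (scaled_energy N) - (\<Sum>i\<in>?I. \<integral>x. G i x * ln (G i x) \<partial>\<alpha>)) \<le> (\<integral>\<sigma>. exp (scaled_energy N \<sigma>) \<partial>PiM ?I (\<lambda>_. \<alpha>))"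
    proof (rule exp_integral_PiM_ge[where a=lo and b=hi])
      show "\<bar>scaled_energy N \<sigma>\<bar> \<le> N * (max_weight\<^sup>2 * K / mean)" for \<sigma>
        using scaled_energy_bounds[of N \<sigma>] by simp
    qed (simp_all add: G_def g A.prob_space_axioms scaled_energy_measurable del: One_nat_def)
    have "DP.expectation (scaled_energy N) - (\<Sum>i\<in>?I. \<integral>x. G i x * ln (G i x) \<partial>\<alpha>) \<le> ln (\<integral>\<sigma>. exp (scaled_energy N \<sigma>) \<partial>PiM ?I (\<lambda>_. \<alpha>))"
      using exp_ge by (subst ln_ge_iff) (auto intro: less_le_trans[OF exp_gt_zero])
    then have "(DP.expectation (scaled_energy N) - (\<Sum>i\<in>?I. \<integral>x. G i x * ln (G i x) \<partial>\<alpha>)) / N \<le> log_partition N"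
      unfolding log_partition_def by (rule divide_right_mono) simp
    moreover have "(DP.expectation (scaled_energy N) - (\<Sum>i\<in>?I. \<integral>x. G i x * ln (G i x) \<partial>\<alpha>)) / N = L N"
    proof -
      have A1: "(\<Sum>k\<le>B. \<Sum>l\<le>B. c k * c l / (2 * mean) * (class_freq N k * class_freq N l) * pair_mean g k l)
        = (\<Sum>k\<le>B. \<Sum>l\<le>B. class_freq N k * class_freq N l * (c k * c l * pair_mean g k l)) / (2 * mean)"
        unfolding sum_divide_distrib by (intro sum.cong refl) simp
      have A2: "(\<Sum>k\<le>B. class_freq N k * ((c k)\<^sup>2 * pair_mean g k k)) = (\<Sum>k\<le>B. class_freq N k * (c k * c k * pair_mean g k k))"
        by (simp add: power2_eq_square)
      show ?thesis unfolding E S L_def A1 A2 using N mean_pos by (simp add: field_simps power2_eq_square)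
    qed
    ultimately show ?thesis by simp
  qed
  show ?thesis by (rule that[of L]) (use lim bound in \<open>simp_all add: h_def\<close>)
qed

end

section \<open>Upper bound by counting types\<close>

text \<open>On the unit interval q ln q lies between -1 and 0. This bounds the entropies of all
  types at once, including types with empty cells.\<close>

lemma mult_ln_abs_le:
  fixes q a :: real
  assumes "0 \<le> q" "q \<le> 1" "0 < a"
  shows "\<bar>q * ln (q / a)\<bar> \<le> 1 + \<bar>ln a\<bar>"
proof (cases "q = 0")
  case False
  then have q: "0 < q" using assms by simp
  have "ln (inverse q) \<le> inverse q - 1" using q by (intro ln_le_minus_one) simp
  then have "q * (- ln q) \<le> q * (inverse q - 1)" using q by (intro mult_left_mono) (auto simp: ln_inverse)
  also have "\<dots> \<le> 1" using q by (simp add: right_diff_distrib)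
  finally have 1: "- (q * ln q) \<le> 1" by simp
  have "ln q \<le> 0" using q assms by simp
  then have 2: "q * ln q \<le> 0" using q by (intro mult_nonneg_nonpos) auto
  have "q * \<bar>ln a\<bar> \<le> 1 * \<bar>ln a\<bar>" using assms by (intro mult_right_mono) auto
  then have 3: "\<bar>q * ln a\<bar> \<le> \<bar>ln a\<bar>" using q by (simp add: abs_mult)
  have "q * ln (q / a) = q * ln q - q * ln a" using q assms by (simp add: ln_div right_diff_distrib)
  then show ?thesis using 1 2 3 by linarith
qed simp

context weighted_mean_field
begin

section \<open>Type counting for an interaction that is constant on cells\<close>

context
  fixes p :: "'a \<Rightarrow> nat" and A :: "nat set" and s :: real
  assumes p[measurable]: "p \<in> \<alpha> \<rightarrow>\<^sub>M count_space UNIV" and finA: "finite A" and pA: "range p \<subseteq> A"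
    and ppos: "\<And>a. a \<in> A \<Longrightarrow> 0 < measure \<alpha> (p -` {a})"
    and s: "\<And>\<nu>. admissible \<nu> \<Longrightarrow> ereal (energy (\<lambda>x. x) \<nu>) - enn2ereal (mean_conditional_entropy \<alpha> \<nu>) \<le> ereal s"
    and cb: "\<And>x. 0 < x \<Longrightarrow> c (b x) \<le> x"
begin

abbreviation "cell a \<equiv> measure \<alpha> (p -` {a})"

abbreviation "G \<equiv> cell_average \<alpha> V p"

lemma pA': "p x \<in> A" using pA by auto

lemma cell_meas[measurable]: "p -` X \<in> sets \<alpha>"
  using measurable_sets[OF p, of X] by (simp add: space_\<alpha>)

lemma step_expand: "F (p x) = (\<Sum>a\<in>A. F a * indicator (p -` {a}) x)" for F :: "nat \<Rightarrow> real"
proof -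
  have "(\<Sum>a\<in>A. F a * indicator (p -` {a}) x) = (\<Sum>a\<in>{p x}. F a * indicator (p -` {a}) x)"
    using pA' finA by (intro sum.mono_neutral_right) auto
  then show ?thesis by simp
qed

lemma integral_step: "(\<integral>x. F (p x) \<partial>\<alpha>) = (\<Sum>a\<in>A. F a * cell a)" for F :: "nat \<Rightarrow> real"
proof -
  have i: "integrable \<alpha> (\<lambda>x. F a * indicator (p -` {a}) x)" for a
    by (intro integrable_mult_right A.integrable_const_bound[where B=1]) auto
  have "(\<integral>x. F (p x) \<partial>\<alpha>) = (\<integral>x. (\<Sum>a\<in>A. F a * indicator (p -` {a}) x) \<partial>\<alpha>)"
    by (intro Bochner_Integration.integral_cong refl step_expand)
  also have "\<dots> = (\<Sum>a\<in>A. \<integral>x. F a * indicator (p -` {a}) x \<partial>\<alpha>)"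
    by (rule Bochner_Integration.integral_sum[OF i])
  also have "\<dots> = (\<Sum>a\<in>A. F a * cell a)"
    by (intro sum.cong refl) (simp add: space_\<alpha>)
  finally show ?thesis .
qed

lemma sum_cell: "(\<Sum>a\<in>A. cell a) = 1"
  using integral_step[of "\<lambda>_. 1"] A.prob_space by simp

definition stochastic :: "(nat \<Rightarrow> nat \<Rightarrow> real) \<Rightarrow> bool" where
  "stochastic q \<longleftrightarrow> (\<forall>k. (\<forall>a. 0 \<le> q k a) \<and> (\<Sum>a\<in>A. q k a) = 1)"

definition step_density :: "(nat \<Rightarrow> nat \<Rightarrow> real) \<Rightarrow> nat \<Rightarrow> 'a \<Rightarrow> real" where
  "step_density q k x = q k (p x) / cell (p x)"

definition step_pair :: "(nat \<Rightarrow> nat \<Rightarrow> real) \<Rightarrow> nat \<Rightarrow> nat \<Rightarrow> real" where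
  "step_pair q k l = (\<Sum>a\<in>A. \<Sum>a'\<in>A. q k a * q l a' * G a a')"

definition step_entropy :: "(nat \<Rightarrow> nat \<Rightarrow> real) \<Rightarrow> nat \<Rightarrow> real" where
  "step_entropy q k = (\<Sum>a\<in>A. q k a * ln (q k a / cell a))"

lemma stochastic_le_1: "stochastic q \<Longrightarrow> a \<in> A \<Longrightarrow> q k a \<le> 1"
  using member_le_sum[of a A "q k"] finA by (auto simp: stochastic_def)

lemma step_density_measurable[measurable]: "step_density q k \<in> borel_measurable \<alpha>"
  unfolding step_density_def by measurable

lemma step_density_nonneg: "stochastic q \<Longrightarrow> 0 \<le> step_density q k x"
  unfolding step_density_def stochastic_def by (intro divide_nonneg_nonneg) auto

lemma step_density_le:
  assumes q: "stochastic q" shows "step_density q k x \<le> (\<Sum>a\<in>A. 1 / cell a)"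
proof -
  have "step_density q k x \<le> 1 / cell (p x)"
    unfolding step_density_def by (rule divide_right_mono[OF stochastic_le_1[OF q pA']]) simp
  also have "\<dots> \<le> (\<Sum>a\<in>A. 1 / cell a)"
    using pA' finA by (intro member_le_sum) auto
  finally show ?thesis .
qed

lemma integral_step_density:
  assumes q: "stochastic q" shows "(\<integral>x. step_density q k x \<partial>\<alpha>) = 1"
proof -
  have "(\<integral>x. step_density q k x \<partial>\<alpha>) = (\<Sum>a\<in>A. q k a / cell a * cell a)"
    unfolding step_density_def by (rule integral_step)
  also have "\<dots> = (\<Sum>a\<in>A. q k a)"
    using ppos by (intro sum.cong refl) (simp add: less_imp_neq[symmetric])
  finally show ?thesis using q by (simp add: stochastic_def)
qed

text \<open>A step density weighs \<open>V\<close> through its integrals over rectangles only, and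
  these are expressed by \<open>G\<close>. So the variational bound, stated for the true kernel,
  controls the configurations of the averaged one.\<close>

lemma pair_mean_step: "pair_mean (step_density q) k l = step_pair q k l"
proof -
  let ?I = "\<lambda>a a' z. indicator (p -` {a}) (fst z) * indicator (p -` {a'}) (snd z) :: real"
  let ?f = "\<lambda>a a' z. (q k a / cell a) * (q l a' / cell a') * (V (fst z) (snd z) * ?I a a' z)"
  have i: "integrable (\<alpha> \<Otimes>\<^sub>M \<alpha>) (?f a a')" for a a'
    using V_nonneg V_le
    by (intro integrable_mult_right integrable_on_cell[OF A.prob_space_axioms space_\<alpha> V_pair V_nonneg V_le p, where L=K] V_fst_snd) auto
  have "pair_mean (step_density q) k l = (\<integral>z. (\<Sum>a\<in>A. \<Sum>a'\<in>A. ?f a a' z) \<partial>(\<alpha> \<Otimes>\<^sub>M \<alpha>))"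
    unfolding pair_mean_def
  proof (intro Bochner_Integration.integral_cong refl)
    fix z :: "'a \<times> 'a"
    have "step_density q k (fst z) * step_density q l (snd z) =
      (\<Sum>a\<in>A. q k a / cell a * indicator (p -` {a}) (fst z)) * (\<Sum>a'\<in>A. q l a' / cell a' * indicator (p -` {a'}) (snd z))"
      unfolding step_density_def step_expand[of "\<lambda>a. q k a / cell a"] step_expand[of "\<lambda>a. q l a / cell a"] ..
    then show "V (fst z) (snd z) * (step_density q k (fst z) * step_density q l (snd z)) = (\<Sum>a\<in>A. \<Sum>a'\<in>A. ?f a a' z)"
      by (simp only: sum_product, simp only: sum_distrib_left) (intro sum.cong refl, simp)
  qed
  also have "\<dots> = (\<Sum>a\<in>A. \<Sum>a'\<in>A. \<integral>z. ?f a a' z \<partial>(\<alpha> \<Otimes>\<^sub>M \<alpha>))"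
    by (rule trans[OF Bochner_Integration.integral_sum sum.cong[OF refl Bochner_Integration.integral_sum]])
      (rule Bochner_Integration.integrable_sum i)+
  also have "\<dots> = step_pair q k l"
    unfolding step_pair_def
  proof (intro sum.cong refl)
    fix a a' assume a: "a \<in> A" "a' \<in> A"
    have "(\<integral>z. ?f a a' z \<partial>(\<alpha> \<Otimes>\<^sub>M \<alpha>)) = (q k a / cell a) * (q l a' / cell a') * (G a a' * (cell a * cell a'))"
      unfolding cell_average_times[OF A.prob_space_axioms space_\<alpha> V_pair V_nonneg V_le p] by (rule integral_mult_right_zero)
    also have "\<dots> = q k a * q l a' * G a a'" using ppos[OF a(1)] ppos[OF a(2)] by simp
    finally show "(\<integral>z. ?f a a' z \<partial>(\<alpha> \<Otimes>\<^sub>M \<alpha>)) = q k a * q l a' * G a a'" .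
  qed
  finally show ?thesis .
qed

text \<open>The bound \<open>class_energy_le\<close>, read off for step densities: the entropy
  becomes that of the row \<open>q k\<close> relative to the cell masses, and only a
  finite-dimensional inequality remains.\<close>

lemma step_variational:
  assumes q: "stochastic q"
  shows "(\<Sum>k\<le>B. \<Sum>l\<le>B. c k * c l / (2 * mean) * (mass k * mass l) * step_pair q k l) - (\<Sum>k\<le>B. mass k * step_entropy q k) \<le> s"
proof -
  have "class_energy (step_density q) - (\<Sum>k\<le>B. mass k * (\<integral>x. step_density q k x * ln (step_density q k x) \<partial>\<alpha>)) \<le> s"
    by (rule class_energy_le[OF s cb step_density_measurable step_density_nonneg[OF q] step_density_le[OF q] integral_step_density[OF q]])
  moreover have "(\<integral>x. step_density q k x * ln (step_density q k x) \<partial>\<alpha>) = step_entropy q k" for k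
  proof -
    have "(\<integral>x. step_density q k x * ln (step_density q k x) \<partial>\<alpha>) = (\<Sum>a\<in>A. (q k a / cell a * ln (q k a / cell a)) * cell a)"
      unfolding step_density_def by (rule integral_step)
    also have "\<dots> = step_entropy q k"
      unfolding step_entropy_def using ppos by (intro sum.cong refl) (simp add: less_imp_neq[symmetric])
    finally show ?thesis .
  qed
  ultimately show ?thesis unfolding class_energy_pair_mean pair_mean_step by simp
qed

lemma G_bounds: "0 \<le> G a a'" "G a a' \<le> K"
  using cell_average_nonneg[OF A.prob_space_axioms space_\<alpha> V_pair V_nonneg V_le p]
    cell_average_le[OF A.prob_space_axioms space_\<alpha> V_pair V_nonneg V_le p] by auto

lemma step_pair_bounds:
  assumes q: "stochastic q" shows "0 \<le> step_pair q k l" "step_pair q k l \<le> K"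
proof -
  have q0: "0 \<le> q k a" for k a using q by (simp add: stochastic_def)
  have q1: "(\<Sum>a\<in>A. q k a) = 1" for k using q by (simp add: stochastic_def)
  show "0 \<le> step_pair q k l" unfolding step_pair_def using q0 G_bounds by (intro sum_nonneg mult_nonneg_nonneg) auto
  have "step_pair q k l \<le> (\<Sum>a\<in>A. \<Sum>a'\<in>A. q k a * q l a' * K)"
    unfolding step_pair_def using q0 G_bounds by (intro sum_mono mult_left_mono) auto
  also have "\<dots> = (\<Sum>a\<in>A. q k a) * (\<Sum>a'\<in>A. q l a') * K"
    by (simp only: sum_product, simp only: sum_distrib_right)
  finally show "step_pair q k l \<le> K" by (simp add: q1)
qed

definition entropy_bound :: real where "entropy_bound = (\<Sum>a\<in>A. 1 + \<bar>ln (cell a)\<bar>)"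

lemma step_entropy_abs_le:
  assumes q: "stochastic q" shows "\<bar>step_entropy q k\<bar> \<le> entropy_bound"
proof -
  have "\<bar>step_entropy q k\<bar> \<le> (\<Sum>a\<in>A. \<bar>q k a * ln (q k a / cell a)\<bar>)" unfolding step_entropy_def by (rule sum_abs)
  also have "\<dots> \<le> entropy_bound" unfolding entropy_bound_def
    using q stochastic_le_1[OF q] ppos by (intro sum_mono mult_ln_abs_le) (auto simp: stochastic_def)
  finally show ?thesis .
qed

text \<open>The cost of exchanging class frequencies for limiting masses in the finite-dimensional
  functional. It is uniform over all probability rows, because pair means are at most
  \<open>K\<close> and entropies at most \<open>entropy_bound\<close>.\<close>

definition freq_error :: "nat \<Rightarrow> real" where
  "freq_error N = (\<Sum>k\<le>B. \<Sum>l\<le>B. c k * c l / (2 * mean) * K * \<bar>class_freq N k * class_freq N l - mass k * mass l\<bar>)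
     + (\<Sum>k\<le>B. entropy_bound * \<bar>mass k - class_freq N k\<bar>)"

lemma freq_error_tendsto: "freq_error \<longlonglongrightarrow> 0"
proof -
  have "freq_error \<longlonglongrightarrow> (\<Sum>k\<le>B. \<Sum>l\<le>B. c k * c l / (2 * mean) * K * \<bar>mass k * mass l - mass k * mass l\<bar>)
     + (\<Sum>k\<le>B. entropy_bound * \<bar>mass k - mass k\<bar>)"
    unfolding freq_error_def by (intro tendsto_intros class_freq_tendsto)
  then show ?thesis by simp
qed

lemma freq_error_nonneg: "0 \<le> freq_error N"
  unfolding freq_error_def entropy_bound_def using c_nonneg mean_pos K_nonneg
  by (intro add_nonneg_nonneg sum_nonneg mult_nonneg_nonneg) auto

definition types :: "nat \<Rightarrow> (nat \<times> nat \<Rightarrow> nat) set" where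
  "types N = ({..B} \<times> A) \<rightarrow>\<^sub>E {0..N}"

text \<open>An empty class gets the cell masses themselves, that is the density 1 and the entropy 0,
  so that every row is a probability vector.\<close>

definition type_probs :: "(nat \<times> nat \<Rightarrow> nat) \<Rightarrow> nat \<Rightarrow> nat \<Rightarrow> real" where
  "type_probs n k a = (if (\<Sum>a\<in>A. n (k, a)) = 0 then cell a else n (k, a) / (\<Sum>a\<in>A. n (k, a)))"

lemma stochastic_type_probs: "stochastic (type_probs n)"
proof -
  have "(\<Sum>a\<in>A. type_probs n k a) = 1" for k
  proof (cases "(\<Sum>a\<in>A. n (k, a)) = 0")
    case True
    then show ?thesis by (simp add: type_probs_def sum_cell)
  next
    case False
    have "(\<Sum>a\<in>A. type_probs n k a) = (\<Sum>a\<in>A. real (n (k, a))) / real (\<Sum>a\<in>A. n (k, a))"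
      unfolding sum_divide_distrib type_probs_def if_not_P[OF False] by (simp only: of_nat_sum)
    also have "\<dots> = real (\<Sum>a\<in>A. n (k, a)) / real (\<Sum>a\<in>A. n (k, a))" by (simp only: of_nat_sum)
    also have "\<dots> = 1" using False by (intro divide_self) (simp only: of_nat_eq_0_iff not_False_eq_True)
    finally show ?thesis .
  qed
  moreover have "0 \<le> type_probs n k a" for k a by (simp add: type_probs_def sum_nonneg)
  ultimately show ?thesis by (simp add: stochastic_def)
qed

lemma card_types: "finite (types N)" "card (types N) = (N + 1) ^ (Suc B * card A)"
  unfolding types_def using finA by (auto intro!: finite_PiE simp: card_PiE)

definition step_energy :: "nat \<Rightarrow> (nat \<Rightarrow> 'a) \<Rightarrow> real" where
  "step_energy N \<sigma> = pair_energy class_weight (\<lambda>x y. G (p x) (p y)) N \<sigma> / (mean * N)"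

text \<open>The configuration \<open>\<sigma>\<close> is compared with the product density built from its own type, for which it is most likely.\<close>

lemma step_energy_pointwise:
  assumes N: "1 \<le> N"
  obtains n where "n \<in> types N" "exp (step_energy N \<sigma>) \<le> exp (N * (s + freq_error N)) * (\<Prod>i=1..N. step_density (type_probs n) (b (w i)) (\<sigma> i))"
proof -
  let ?I = "{1..N}" and ?T = "{..B} \<times> A"
  define \<beta> where "\<beta> i = (b (w i), p (\<sigma> i))" for i
  define n where "n = restrict (\<lambda>t. card {i \<in> ?I. \<beta> i = t}) ?T"
  define q where "q = type_probs n"
  let ?fr = "class_freq N"
  have q: "stochastic q" unfolding q_def by (rule stochastic_type_probs)
  have cart: "(\<Sum>t\<in>?T. F t) = (\<Sum>k\<le>B. \<Sum>a\<in>A. F (k, a))" for F :: "nat \<times> nat \<Rightarrow> real"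
    by (simp add: sum.cartesian_product split_beta)
  have \<beta>T: "\<beta> i \<in> ?T" for i using b_le pA' by (simp add: \<beta>_def)
  have nc: "n t = card {i \<in> ?I. \<beta> i = t}" if "t \<in> ?T" for t unfolding n_def using that by simp
  have nT: "n \<in> types N"
    unfolding types_def
  proof (rule PiE_I)
    fix t assume t: "t \<in> ?T"
    have "card {i \<in> ?I. \<beta> i = t} \<le> card ?I" by (intro card_mono) auto
    then show "n t \<in> {0..N}" using nc[OF t] by simp
  qed (simp add: n_def)
  have rowsum: "real (\<Sum>a\<in>A. n (k, a)) = N * ?fr k" if k: "k \<le> B" for k
  proof -
    have "(\<Sum>i\<in>{i \<in> ?I. b (w i) = k}. 1::real) = (\<Sum>a\<in>A. real (card {i \<in> {i \<in> ?I. b (w i) = k}. p (\<sigma> i) = a}) * 1)"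
      by (rule sum_over_fibres) (use finA pA' in auto)
    moreover have "{i \<in> {i \<in> ?I. b (w i) = k}. p (\<sigma> i) = a} = {i \<in> ?I. \<beta> i = (k, a)}" for a
      by (auto simp: \<beta>_def)
    ultimately have "real (card {i \<in> ?I. b (w i) = k}) = (\<Sum>a\<in>A. real (n (k, a)))"
      using k nc by simp
    then show ?thesis unfolding card_class by simp
  qed
  have nq: "real (n (k, a)) = N * ?fr k * q k a" if k: "k \<le> B" and a: "a \<in> A" for k a
  proof (cases "(\<Sum>a\<in>A. n (k, a)) = 0")
    case True
    then have "n (k, a) = 0" using a finA by simp
    then show ?thesis using rowsum[OF k] True by simp
  next
    case False
    then have "q k a = real (n (k, a)) / real (\<Sum>a\<in>A. n (k, a))" unfolding q_def type_probs_def by simp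
    then have "real (\<Sum>a\<in>A. n (k, a)) * q k a = real (n (k, a))" using False by (simp del: of_nat_sum)
    then show ?thesis unfolding rowsum[OF k] by simp
  qed
  \<comment> \<open>Vertex \<open>i\<close> is counted in its own type, so its cell has positive
    frequency and the logarithm of its density is meaningful.\<close>
  have dpos: "0 < step_density q (b (w i)) (\<sigma> i)" if i: "i \<in> ?I" for i
  proof -
    have "card {j \<in> ?I. \<beta> j = \<beta> i} \<noteq> 0" using i by auto
    then have "n (b (w i), p (\<sigma> i)) \<noteq> 0" using nc[OF \<beta>T[of i]] by (simp add: \<beta>_def)
    then have "q (b (w i)) (p (\<sigma> i)) \<noteq> 0" using nq[OF b_le pA', of "w i" "\<sigma> i"] by auto
    moreover have "0 \<le> q (b (w i)) (p (\<sigma> i))" using q by (simp add: stochastic_def)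
    ultimately show ?thesis unfolding step_density_def using ppos[OF pA'] by simp
  qed
  \<comment> \<open>The log-likelihood of a configuration under its own type is exactly N times the
    weighted entropy of the type; this is the term that the variational bound subtracts from the
    energy.\<close>
  have ent: "(\<Sum>i\<in>?I. ln (step_density q (b (w i)) (\<sigma> i))) = N * (\<Sum>k\<le>B. ?fr k * step_entropy q k)"
  proof -
    have "(\<Sum>i\<in>?I. (\<lambda>t. ln (q (fst t) (snd t) / cell (snd t))) (\<beta> i)) = (\<Sum>t\<in>?T. real (card {i \<in> ?I. \<beta> i = t}) * ln (q (fst t) (snd t) / cell (snd t)))"
      by (rule sum_over_fibres) (use finA \<beta>T in auto)
    also have "\<dots> = (\<Sum>t\<in>?T. real (n t) * ln (q (fst t) (snd t) / cell (snd t)))"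
      by (intro sum.cong refl) (simp add: nc)
    also have "\<dots> = (\<Sum>k\<le>B. \<Sum>a\<in>A. real (n (k, a)) * ln (q k a / cell a))"
      by (simp only: cart fst_conv snd_conv)
    also have "\<dots> = (\<Sum>k\<le>B. \<Sum>a\<in>A. N * (?fr k * (q k a * ln (q k a / cell a))))"
      by (intro sum.cong refl) (simp add: nq)
    also have "\<dots> = N * (\<Sum>k\<le>B. ?fr k * step_entropy q k)"
      by (simp add: sum_distrib_left step_entropy_def)
    finally show ?thesis by (simp add: step_density_def \<beta>_def)
  qed
  have en: "step_energy N \<sigma> \<le> N * (\<Sum>k\<le>B. \<Sum>l\<le>B. c k * c l / (2 * mean) * (?fr k * ?fr l) * step_pair q k l)"
  proof -
    let ?H = "\<lambda>t u. c (fst t) * c (fst u) * G (snd t) (snd u)"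
    have Gs: "G a a' = G a' a" for a a'
      by (rule cell_average_commute[OF A.prob_space_axioms space_\<alpha> V_pair V_nonneg V_le p]) (rule V_sym)
    have "pair_energy class_weight (\<lambda>x y. G (p x) (p y)) N \<sigma> \<le> (\<Sum>i\<in>?I. \<Sum>j\<in>?I. class_weight i * class_weight j * G (p (\<sigma> i)) (p (\<sigma> j))) / 2"
    proof -
      have "0 \<le> (\<Sum>i\<in>?I. (class_weight i)\<^sup>2 * G (p (\<sigma> i)) (p (\<sigma> i)))"
        using G_bounds by (intro sum_nonneg mult_nonneg_nonneg) auto
      then show ?thesis using Gs by (subst pair_energy_double_sum) auto
    qed
    also have "(\<Sum>i\<in>?I. \<Sum>j\<in>?I. class_weight i * class_weight j * G (p (\<sigma> i)) (p (\<sigma> j))) = (\<Sum>i\<in>?I. \<Sum>j\<in>?I. ?H (\<beta> i) (\<beta> j))"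
      by (simp add: class_weight_def \<beta>_def)
    also have "\<dots> = (\<Sum>t\<in>?T. \<Sum>u\<in>?T. real (card {i \<in> ?I. \<beta> i = t}) * real (card {i \<in> ?I. \<beta> i = u}) * ?H t u)"
      by (rule double_sum_over_fibres) (use finA \<beta>T in auto)
    also have "\<dots> = (\<Sum>t\<in>?T. \<Sum>u\<in>?T. real (n t) * real (n u) * ?H t u)"
      by (intro sum.cong refl) (simp add: nc)
    also have "\<dots> = (\<Sum>k\<le>B. \<Sum>a\<in>A. \<Sum>l\<le>B. \<Sum>a'\<in>A. real (n (k, a)) * real (n (l, a')) * (c k * c l * G a a'))"
      by (simp only: cart fst_conv snd_conv)
    also have "\<dots> = (\<Sum>k\<le>B. \<Sum>a\<in>A. \<Sum>l\<le>B. \<Sum>a'\<in>A. (real N)\<^sup>2 * (?fr k * ?fr l * c k * c l) * (q k a * q l a' * G a a'))"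
      by (intro sum.cong refl) (simp add: nq power2_eq_square)
    also have "\<dots> = (\<Sum>k\<le>B. \<Sum>l\<le>B. \<Sum>a\<in>A. \<Sum>a'\<in>A. (real N)\<^sup>2 * (?fr k * ?fr l * c k * c l) * (q k a * q l a' * G a a'))"
      by (intro sum.cong refl sum.swap)
    also have "\<dots> = (\<Sum>k\<le>B. \<Sum>l\<le>B. (real N)\<^sup>2 * (?fr k * ?fr l * c k * c l) * step_pair q k l)"
      by (simp add: step_pair_def sum_distrib_left)
    finally have "step_energy N \<sigma> \<le> (\<Sum>k\<le>B. \<Sum>l\<le>B. (real N)\<^sup>2 * (?fr k * ?fr l * c k * c l) * step_pair q k l) / 2 / (mean * N)"
      unfolding step_energy_def using mean_pos N by (intro divide_right_mono) auto
    also have "\<dots> = N * (\<Sum>k\<le>B. \<Sum>l\<le>B. c k * c l / (2 * mean) * (?fr k * ?fr l) * step_pair q k l)"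
      unfolding sum_divide_distrib sum_distrib_left using N mean_pos
      by (intro sum.cong refl) (simp add: power2_eq_square field_simps)
    finally show ?thesis .
  qed
  \<comment> \<open>The variational bound is available for the limiting masses; passing to the
    frequencies costs \<open>freq_error\<close>.\<close>
  have "(\<Sum>k\<le>B. \<Sum>l\<le>B. c k * c l / (2 * mean) * (?fr k * ?fr l) * step_pair q k l) - (\<Sum>k\<le>B. ?fr k * step_entropy q k) \<le> s + freq_error N"
  proof -
    have "(\<Sum>k\<le>B. \<Sum>l\<le>B. c k * c l / (2 * mean) * (?fr k * ?fr l) * step_pair q k l) - (\<Sum>k\<le>B. \<Sum>l\<le>B. c k * c l / (2 * mean) * (mass k * mass l) * step_pair q k l)
      = (\<Sum>k\<le>B. \<Sum>l\<le>B. c k * c l / (2 * mean) * step_pair q k l * (?fr k * ?fr l - mass k * mass l))"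
      unfolding sum_subtractf[symmetric] by (intro sum.cong refl) (simp add: algebra_simps diff_divide_distrib)
    also have "\<dots> \<le> (\<Sum>k\<le>B. \<Sum>l\<le>B. c k * c l / (2 * mean) * K * \<bar>?fr k * ?fr l - mass k * mass l\<bar>)"
    proof (intro sum_mono)
      fix k l
      have "c k * c l / (2 * mean) * step_pair q k l * (?fr k * ?fr l - mass k * mass l) \<le> c k * c l / (2 * mean) * step_pair q k l * \<bar>?fr k * ?fr l - mass k * mass l\<bar>"
        using c_nonneg mean_pos step_pair_bounds[OF q] by (intro mult_left_mono) auto
      also have "\<dots> \<le> c k * c l / (2 * mean) * K * \<bar>?fr k * ?fr l - mass k * mass l\<bar>"
        using c_nonneg mean_pos step_pair_bounds[OF q] by (intro mult_right_mono mult_left_mono) auto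
      finally show "c k * c l / (2 * mean) * step_pair q k l * (?fr k * ?fr l - mass k * mass l) \<le> c k * c l / (2 * mean) * K * \<bar>?fr k * ?fr l - mass k * mass l\<bar>" .
    qed
    finally have 1: "(\<Sum>k\<le>B. \<Sum>l\<le>B. c k * c l / (2 * mean) * (?fr k * ?fr l) * step_pair q k l) - (\<Sum>k\<le>B. \<Sum>l\<le>B. c k * c l / (2 * mean) * (mass k * mass l) * step_pair q k l)
      \<le> (\<Sum>k\<le>B. \<Sum>l\<le>B. c k * c l / (2 * mean) * K * \<bar>?fr k * ?fr l - mass k * mass l\<bar>)" .
    have "(\<Sum>k\<le>B. mass k * step_entropy q k) - (\<Sum>k\<le>B. ?fr k * step_entropy q k) = (\<Sum>k\<le>B. step_entropy q k * (mass k - ?fr k))"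
      unfolding sum_subtractf[symmetric] by (intro sum.cong refl) (simp add: algebra_simps)
    also have "\<dots> \<le> (\<Sum>k\<le>B. entropy_bound * \<bar>mass k - ?fr k\<bar>)"
    proof (intro sum_mono)
      fix k
      have "step_entropy q k * (mass k - ?fr k) \<le> \<bar>step_entropy q k\<bar> * \<bar>mass k - ?fr k\<bar>"
        unfolding abs_mult[symmetric] by (rule abs_ge_self)
      also have "\<dots> \<le> entropy_bound * \<bar>mass k - ?fr k\<bar>" using step_entropy_abs_le[OF q] by (intro mult_right_mono) auto
      finally show "step_entropy q k * (mass k - ?fr k) \<le> entropy_bound * \<bar>mass k - ?fr k\<bar>" .
    qed
    finally have 2: "(\<Sum>k\<le>B. mass k * step_entropy q k) - (\<Sum>k\<le>B. ?fr k * step_entropy q k) \<le> (\<Sum>k\<le>B. entropy_bound * \<bar>mass k - ?fr k\<bar>)" .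
    show ?thesis using 1 2 step_variational[OF q] unfolding freq_error_def by linarith
  qed
  then have "N * ((\<Sum>k\<le>B. \<Sum>l\<le>B. c k * c l / (2 * mean) * (?fr k * ?fr l) * step_pair q k l) - (\<Sum>k\<le>B. ?fr k * step_entropy q k)) \<le> N * (s + freq_error N)"
    by (rule mult_left_mono) simp
  then have "step_energy N \<sigma> \<le> N * (s + freq_error N) + (\<Sum>i\<in>?I. ln (step_density q (b (w i)) (\<sigma> i)))"
    using en unfolding ent right_diff_distrib by linarith
  then have "exp (step_energy N \<sigma>) \<le> exp (N * (s + freq_error N) + (\<Sum>i\<in>?I. ln (step_density q (b (w i)) (\<sigma> i))))" by simp
  also have "\<dots> = exp (N * (s + freq_error N)) * (\<Prod>i\<in>?I. step_density q (b (w i)) (\<sigma> i))"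
    unfolding exp_add by (subst exp_sum) (use dpos in \<open>auto intro!: prod.cong\<close>)
  finally show ?thesis by (intro that[OF nT]) (simp add: q_def)
qed

lemma step_energy_measurable: "step_energy N \<in> borel_measurable (PiM {1..N} (\<lambda>_. \<alpha>))"
proof -
  have "(\<lambda>z. G (p (fst z)) (p (snd z))) \<in> borel_measurable (\<alpha> \<Otimes>\<^sub>M \<alpha>)" by (rule measurable_step[OF p])
  then have "case_prod (\<lambda>x y. G (p x) (p y)) \<in> borel_measurable (borel :: ('a \<times> 'a) measure)"
    by (simp add: measurable_cong_sets[OF sets_\<alpha>\<alpha> refl] split_beta')
  then show ?thesis unfolding step_energy_def
    by (intro borel_measurable_divide borel_measurable_const measurable_pair_energy sets_\<alpha>)
qed

text \<open>The type belonging to the configuration is replaced by a sum over all types. Each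
  summand is a product of probability densities and integrates to 1, so only the number of types
  remains.\<close>

lemma step_partition_le:
  assumes N: "1 \<le> N"
  shows "(\<integral>\<^sup>+\<sigma>. ennreal (exp (step_energy N \<sigma>)) \<partial>PiM {1..N} (\<lambda>_. \<alpha>)) \<le> ennreal (exp (N * (s + freq_error N)) * (N + 1) ^ (Suc B * card A))"
proof -
  interpret PP: product_prob_space "\<lambda>_::nat. \<alpha>" "{1..N}" by (rule product_prob_spaceI) (rule A.prob_space_axioms)
  let ?M = "PiM {1..N} (\<lambda>_. \<alpha>)"
  let ?e = "exp (N * (s + freq_error N))"
  let ?d = "\<lambda>n \<sigma>. \<Prod>i=1..N. ennreal (step_density (type_probs n) (b (w i)) (\<sigma> i))"
  have d0: "0 \<le> step_density (type_probs n) k x" for n k x by (rule step_density_nonneg[OF stochastic_type_probs])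
  have dm: "?d n \<in> borel_measurable ?M" for n
    by (intro borel_measurable_prod_ennreal measurable_compose[OF measurable_component_singleton] measurable_compose[OF step_density_measurable measurable_ennreal]) auto
  have one: "(\<integral>\<^sup>+\<sigma>. ?d n \<sigma> \<partial>?M) = 1" for n
  proof -
    have "(\<integral>\<^sup>+\<sigma>. ?d n \<sigma> \<partial>?M) = (\<Prod>i=1..N. \<integral>\<^sup>+x. ennreal (step_density (type_probs n) (b (w i)) x) \<partial>\<alpha>)"
      by (rule PP.product_nn_integral_prod) auto
    also have "\<dots> = (\<Prod>i=1..N. 1)"
    proof (intro prod.cong refl)
      fix i
      let ?f = "step_density (type_probs n) (b (w i))"
      have "integrable \<alpha> ?f"
        using step_density_le[OF stochastic_type_probs] d0
        by (intro A.integrable_const_bound[where B="\<Sum>a\<in>A. 1 / cell a"]) auto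
      then show "(\<integral>\<^sup>+x. ennreal (?f x) \<partial>\<alpha>) = 1"
        using d0 integral_step_density[OF stochastic_type_probs] by (subst nn_integral_eq_integral) auto
    qed
    finally show ?thesis by simp
  qed
  have "(\<integral>\<^sup>+\<sigma>. ennreal (exp (step_energy N \<sigma>)) \<partial>?M) \<le> (\<integral>\<^sup>+\<sigma>. ennreal ?e * (\<Sum>n\<in>types N. ?d n \<sigma>) \<partial>?M)"
  proof (rule nn_integral_mono)
    fix \<sigma>
    obtain n where n: "n \<in> types N" "exp (step_energy N \<sigma>) \<le> ?e * (\<Prod>i=1..N. step_density (type_probs n) (b (w i)) (\<sigma> i))"
      using step_energy_pointwise[OF N] by blast
    have "ennreal (exp (step_energy N \<sigma>)) \<le> ennreal (?e * (\<Prod>i=1..N. step_density (type_probs n) (b (w i)) (\<sigma> i)))"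
      by (rule ennreal_leI[OF n(2)])
    also have "\<dots> = ennreal ?e * ?d n \<sigma>"
      using d0 by (subst ennreal_mult) (auto intro!: prod_nonneg simp: prod_ennreal)
    also have "\<dots> \<le> ennreal ?e * (\<Sum>n\<in>types N. ?d n \<sigma>)"
      using n(1) card_types(1) by (intro mult_left_mono member_le_sum) auto
    finally show "ennreal (exp (step_energy N \<sigma>)) \<le> ennreal ?e * (\<Sum>n\<in>types N. ?d n \<sigma>)" .
  qed
  also have "\<dots> = ennreal ?e * (\<Sum>n\<in>types N. \<integral>\<^sup>+\<sigma>. ?d n \<sigma> \<partial>?M)"
    using dm by (subst nn_integral_cmult) (auto simp: nn_integral_sum)
  also have "\<dots> = ennreal ?e * of_nat (card (types N))" by (simp only: one) simp
  also have "\<dots> = ennreal (?e * (real N + 1) ^ (Suc B * card A))"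
    by (simp only: card_types ennreal_of_nat_eq_real_of_nat) (simp add: ennreal_mult add.commute)
  finally show ?thesis .
qed

end

end

lemma ln_integral_exp_dist:
  fixes F H :: "'a \<Rightarrow> real"
  assumes M: "prob_space M" and F: "integrable M (\<lambda>x. exp (F x))" and H: "integrable M (\<lambda>x. exp (H x))"
    and d: "\<And>x. \<bar>F x - H x\<bar> \<le> e" and H0: "\<And>x. 0 \<le> H x" "\<And>x. 0 \<le> F x"
  shows "\<bar>ln (\<integral>x. exp (F x) \<partial>M) - ln (\<integral>x. exp (H x) \<partial>M)\<bar> \<le> e"
proof -
  interpret M: prob_space M by fact
  have *: "ln (\<integral>x. exp (F x) \<partial>M) \<le> ln (\<integral>x. exp (H x) \<partial>M) + e"
    if F: "integrable M (\<lambda>x. exp (F x))" and H: "integrable M (\<lambda>x. exp (H x))"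
      and d: "\<And>x. F x \<le> H x + e" and H0: "\<And>x. 0 \<le> H x" "\<And>x. 0 \<le> F x" for F H :: "'a \<Rightarrow> real"
  proof -
    have one: "1 \<le> (\<integral>x. exp (G x) \<partial>M)" if "integrable M (\<lambda>x. exp (G x))" "\<And>x. 0 \<le> G x" for G :: "'a \<Rightarrow> real"
    proof -
      have "(\<integral>x. 1 \<partial>M) \<le> (\<integral>x. exp (G x) \<partial>M)" by (rule integral_mono) (use that in auto)
      then show ?thesis by (simp add: M.prob_space)
    qed
    have F1: "1 \<le> (\<integral>x. exp (F x) \<partial>M)" using one[OF F H0(2)] .
    have H1: "1 \<le> (\<integral>x. exp (H x) \<partial>M)" using one[OF H H0(1)] .
    have "(\<integral>x. exp (F x) \<partial>M) \<le> (\<integral>x. exp e * exp (H x) \<partial>M)"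
    proof (rule integral_mono[OF F])
      show "exp (F x) \<le> exp e * exp (H x)" for x using d[of x] by (simp add: add.commute flip: exp_add)
    qed (use H in simp)
    also have "\<dots> = exp e * (\<integral>x. exp (H x) \<partial>M)" by simp
    finally have "ln (\<integral>x. exp (F x) \<partial>M) \<le> ln (exp e * (\<integral>x. exp (H x) \<partial>M))" using F1 by simp
    also have "\<dots> = e + ln (\<integral>x. exp (H x) \<partial>M)" using H1 by (subst ln_mult) auto
    finally show ?thesis by simp
  qed
  have "F x \<le> H x + e" "H x \<le> F x + e" for x using d[of x] by (auto simp: abs_le_iff)
  then have "ln (\<integral>x. exp (F x) \<partial>M) \<le> ln (\<integral>x. exp (H x) \<partial>M) + e" "ln (\<integral>x. exp (H x) \<partial>M) \<le> ln (\<integral>x. exp (F x) \<partial>M) + e"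
    using *[OF F H _ H0] *[OF H F _ H0(2,1)] by blast+
  then show ?thesis by (simp add: abs_le_iff)
qed

section \<open>Upper bound for the measurable interaction\<close>

context weighted_mean_field
begin

text \<open>Configurations are split according to the approximation error, at most C1 R. If it is at
  most \<eta> N, the step energy takes over. Otherwise the crude bound on the energy is absorbed
  into \<open>S N\<close>, a large multiple of R, and the exponential moment of \<open>S N\<close>
  is compensated by a factor exp (- N).\<close>

lemma log_partition_upper:
  assumes s: "\<And>\<nu>. admissible \<nu> \<Longrightarrow> ereal (energy (\<lambda>x. x) \<nu>) - enn2ereal (mean_conditional_entropy \<alpha> \<nu>) \<le> ereal s"
    and cb: "\<And>x. 0 < x \<Longrightarrow> c (b x) \<le> x" and s0: "0 \<le> s" and \<epsilon>: "0 < \<epsilon>"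
  shows "\<forall>\<^sub>F N in sequentially. log_partition N \<le> s + \<epsilon>"
proof -
  define C1 where "C1 = max_weight\<^sup>2 / mean"
  define \<eta> where "\<eta> = \<epsilon> / 2"
  \<comment> \<open>Chosen so that an error above \<eta> N forces \<open>S N\<close> to exceed the
    crude energy bound C1 K N by a further N.\<close>
  define \<theta> where "\<theta> = (C1 * K + 1) / \<eta>"
  define L where "L = \<theta> * C1"
  \<comment> \<open>\<open>L\<close> is fixed before the partition and does not depend on it, so the
    partition can be taken fine enough for the exponential moment of L f to be at most 2.\<close>
  define \<epsilon>' where "\<epsilon>' = 1 / (L * exp (L * K) + 1)"
  have C1: "0 \<le> C1" unfolding C1_def using mean_pos by simp
  have \<eta>: "0 < \<eta>" using \<epsilon> by (simp add: \<eta>_def)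
  have \<theta>: "0 \<le> \<theta>" "\<theta> * \<eta> = C1 * K + 1" unfolding \<theta>_def using \<eta> C1 K_nonneg by auto
  have L: "0 \<le> L" unfolding L_def using \<theta> C1 by simp
  have den: "0 < L * exp (L * K) + 1" using L by (simp add: add_nonneg_pos)
  then have \<epsilon>': "0 < \<epsilon>'" by (simp add: \<epsilon>'_def)
  have Le': "L * exp (L * K) * \<epsilon>' \<le> 1"
    unfolding \<epsilon>'_def using den by (simp add: field_simps)
  obtain p A where p[measurable]: "p \<in> \<alpha> \<rightarrow>\<^sub>M count_space UNIV" and finA: "finite A" and pA: "range p \<subseteq> A"
    and ppos: "\<And>a. a \<in> A \<Longrightarrow> 0 < measure \<alpha> (p -` {a})"
    and approx: "(\<integral>z. \<bar>V (fst z) (snd z) - cell_average \<alpha> V p (p (fst z)) (p (snd z))\<bar> \<partial>(\<alpha> \<Otimes>\<^sub>M \<alpha>)) \<le> \<epsilon>'"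
    using partition_approximation[OF A.prob_space_axioms space_\<alpha> V_pair V_nonneg V_le \<epsilon>'] by blast
  define f where "f x y = \<bar>V x y - cell_average \<alpha> V p (p x) (p y)\<bar>" for x y
  have Gm: "(\<lambda>z. cell_average \<alpha> V p (p (fst z)) (p (snd z))) \<in> borel_measurable (\<alpha> \<Otimes>\<^sub>M \<alpha>)" by (rule measurable_step[OF p])
  have fm[measurable]: "(\<lambda>z. f (fst z) (snd z)) \<in> borel_measurable (\<alpha> \<Otimes>\<^sub>M \<alpha>)"
    unfolding f_def by (intro borel_measurable_abs borel_measurable_diff V_fst_snd Gm)
  note Gb = G_bounds[OF p finA pA ppos s cb]
  have fK: "0 \<le> f x y" "f x y \<le> K" for x y
    using Gb[of "p x" "p y"] V_nonneg[of x y] V_le[of x y] by (auto simp: f_def)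
  define S where "S N \<sigma> = (\<Sum>(i, j)\<in>vertex_pairs N. L * f (\<sigma> i) (\<sigma> j)) / N" for N and \<sigma> :: "nat \<Rightarrow> 'a"
  define D where "D = Suc B * card A"
  let ?step = "step_energy p"
  let ?err = "freq_error p A"
  have step: "?step N \<sigma> = pair_energy class_weight (\<lambda>x y. cell_average \<alpha> V p (p x) (p y)) N \<sigma> / (mean * N)" for N \<sigma>
    by (rule step_energy_def[OF p finA pA ppos s cb])
  have point: "exp (scaled_energy N \<sigma>) \<le> exp (\<eta> * N) * exp (?step N \<sigma>) + exp (- real N) * exp (S N \<sigma>)" if N: "1 \<le> N" for N \<sigma>
  proof -
    define R where "R = (\<Sum>(i, j)\<in>vertex_pairs N. f (\<sigma> i) (\<sigma> j)) / N"
    have SR: "S N \<sigma> = L * R" unfolding S_def R_def by (simp add: sum_distrib_left split_beta)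
    have "scaled_energy N \<sigma> - ?step N \<sigma> = (\<Sum>(i, j)\<in>vertex_pairs N. class_weight i * class_weight j * (V (\<sigma> i) (\<sigma> j) - cell_average \<alpha> V p (p (\<sigma> i)) (p (\<sigma> j)))) / (mean * N)"
      unfolding scaled_energy_def step pair_energy_def
      by (simp add: diff_divide_distrib[symmetric] sum_subtractf[symmetric] split_beta right_diff_distrib)
    also have "\<dots> \<le> (\<Sum>(i, j)\<in>vertex_pairs N. max_weight * max_weight * f (\<sigma> i) (\<sigma> j)) / (mean * N)"
    proof (intro divide_right_mono sum_mono)
      fix e assume "e \<in> vertex_pairs N"
      obtain i j where e: "e = (i, j)" by (cases e)
      have "class_weight i * class_weight j * (V (\<sigma> i) (\<sigma> j) - cell_average \<alpha> V p (p (\<sigma> i)) (p (\<sigma> j))) \<le> class_weight i * class_weight j * f (\<sigma> i) (\<sigma> j)"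
        using class_weight_bounds(1) by (intro mult_left_mono) (auto simp: f_def)
      also have "\<dots> \<le> max_weight * max_weight * f (\<sigma> i) (\<sigma> j)"
        using class_weight_bounds max_weight_nonneg fK by (intro mult_right_mono mult_mono) auto
      finally show "(case e of (i, j) \<Rightarrow> class_weight i * class_weight j * (V (\<sigma> i) (\<sigma> j) - cell_average \<alpha> V p (p (\<sigma> i)) (p (\<sigma> j)))) \<le> (case e of (i, j) \<Rightarrow> max_weight * max_weight * f (\<sigma> i) (\<sigma> j))"
        by (simp add: e)
    qed (use mean_pos in simp)
    also have "\<dots> = C1 * R"
      unfolding C1_def R_def by (simp add: power2_eq_square split_beta flip: sum_distrib_left)
    finally have dif: "scaled_energy N \<sigma> \<le> ?step N \<sigma> + C1 * R" by simp
    \<comment> \<open>Either summand of the bound suffices in one of the two cases, the other one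
      being positive.\<close>
    show ?thesis
    proof (cases "C1 * R \<le> \<eta> * N")
      case True
      then have "exp (scaled_energy N \<sigma>) \<le> exp (\<eta> * N + ?step N \<sigma>)" using dif by simp
      also have "\<dots> \<le> exp (\<eta> * N) * exp (?step N \<sigma>) + exp (- real N) * exp (S N \<sigma>)" unfolding exp_add by simp
      finally show ?thesis .
    next
      case False
      then have "\<theta> * (\<eta> * N) \<le> \<theta> * (C1 * R)" using \<theta> by (intro mult_left_mono) auto
      then have "(C1 * K + 1) * N \<le> S N \<sigma>" using \<theta>(2) by (simp add: SR L_def mult.assoc[symmetric])
      moreover have "scaled_energy N \<sigma> \<le> N * (C1 * K)" using scaled_energy_bounds(2)[of N \<sigma>] by (simp add: C1_def)
      ultimately have "scaled_energy N \<sigma> \<le> - real N + S N \<sigma>" by (simp add: algebra_simps)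
      then have "exp (scaled_energy N \<sigma>) \<le> exp (- real N + S N \<sigma>)" by simp
      also have "\<dots> \<le> exp (\<eta> * N) * exp (?step N \<sigma>) + exp (- real N) * exp (S N \<sigma>)" unfolding exp_add by simp
      finally show ?thesis .
    qed
  qed
  have e2: "(\<integral>\<^sup>+z. ennreal (exp (L * f (fst z) (snd z))) \<partial>(\<alpha> \<Otimes>\<^sub>M \<alpha>)) \<le> 2"
  proof -
    have fi: "integrable (\<alpha> \<Otimes>\<^sub>M \<alpha>) (\<lambda>z. f (fst z) (snd z))"
      using fK by (intro AA.integrable_const_bound[where B=K]) auto
    have "(\<integral>\<^sup>+z. ennreal (exp (L * f (fst z) (snd z))) \<partial>(\<alpha> \<Otimes>\<^sub>M \<alpha>)) \<le> (\<integral>\<^sup>+z. ennreal (1 + L * exp (L * K) * f (fst z) (snd z)) \<partial>(\<alpha> \<Otimes>\<^sub>M \<alpha>))"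
    proof (intro nn_integral_mono ennreal_leI)
      fix z
      let ?x = "L * f (fst z) (snd z)"
      have x: "0 \<le> ?x" "?x \<le> L * K" using L fK by (auto intro: mult_left_mono)
      \<comment> \<open>This leads to exp x \<le> 1 + x exp x, so that closeness in L1 together with
        the bound \<open>K\<close> controls the exponential moment.\<close>
      have "1 - ?x \<le> exp (- ?x)" using exp_ge_add_one_self[of "- ?x"] by simp
      then have "exp ?x * (1 - ?x) \<le> exp ?x * exp (- ?x)" by (intro mult_left_mono) auto
      then have "exp ?x \<le> 1 + ?x * exp ?x" by (simp add: exp_minus algebra_simps)
      also have "\<dots> \<le> 1 + ?x * exp (L * K)" using x by (intro add_left_mono mult_left_mono) auto
      finally show "exp ?x \<le> 1 + L * exp (L * K) * f (fst z) (snd z)" by (simp add: mult_ac)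
    qed
    also have "\<dots> = ennreal (\<integral>z. 1 + L * exp (L * K) * f (fst z) (snd z) \<partial>(\<alpha> \<Otimes>\<^sub>M \<alpha>))"
      using fi L fK by (intro nn_integral_eq_integral) auto
    also have "(\<integral>z. 1 + L * exp (L * K) * f (fst z) (snd z) \<partial>(\<alpha> \<Otimes>\<^sub>M \<alpha>)) = 1 + L * exp (L * K) * (\<integral>z. f (fst z) (snd z) \<partial>(\<alpha> \<Otimes>\<^sub>M \<alpha>))"
      using fi by (simp add: AA.prob_space)
    also have "\<dots> \<le> 1 + L * exp (L * K) * \<epsilon>'"
      using approx L by (intro add_left_mono mult_left_mono) (auto simp: f_def)
    also have "\<dots> \<le> 2" using Le' by simp
    finally show ?thesis by (simp add: ennreal_leI)
  qed
  have part: "(\<integral>\<sigma>. exp (scaled_energy N \<sigma>) \<partial>PiM {1..N} (\<lambda>_. \<alpha>)) \<le> exp (\<eta> * N) * (exp (N * (s + ?err N)) * (real N + 1) ^ D) + 1" if N: "1 \<le> N" for N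
  proof -
    let ?M = "PiM {1..N} (\<lambda>_. \<alpha>)"
    have Sm: "S N \<in> borel_measurable ?M"
    proof -
      have "case_prod f \<in> borel_measurable (borel :: ('a \<times> 'a) measure)"
        using fm by (simp add: measurable_cong_sets[OF sets_\<alpha>\<alpha> refl] split_beta')
      then show ?thesis unfolding S_def split_beta using vertex_pairs_subset[of N]
        by (intro borel_measurable_divide borel_measurable_sum borel_measurable_times borel_measurable_const measurable_pair_component sets_\<alpha>) auto
    qed
    have stm: "?step N \<in> borel_measurable ?M" by (rule step_energy_measurable[OF p finA pA ppos s cb])
    have expS: "(\<integral>\<^sup>+\<sigma>. ennreal (exp (S N \<sigma>)) \<partial>?M) \<le> 2 ^ N"
    proof -
      have "(\<integral>\<^sup>+\<sigma>. ennreal (exp (S N \<sigma>)) \<partial>?M) \<le> (\<integral>\<^sup>+z. ennreal (exp (L * f (fst z) (snd z))) \<partial>(\<alpha> \<Otimes>\<^sub>M \<alpha>)) ^ N"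
        unfolding S_def
        by (rule nn_integral_exp_pair_sum_le[OF A.prob_space_axioms _ _ N]) (use L fK in \<open>auto simp: split_beta'\<close>)
      also have "\<dots> \<le> 2 ^ N" by (rule power_mono[OF e2]) simp
      finally show ?thesis .
    qed
    have "(\<integral>\<^sup>+\<sigma>. ennreal (exp (scaled_energy N \<sigma>)) \<partial>?M) \<le>
      (\<integral>\<^sup>+\<sigma>. ennreal (exp (\<eta> * N)) * ennreal (exp (?step N \<sigma>)) + ennreal (exp (- real N)) * ennreal (exp (S N \<sigma>)) \<partial>?M)"
    proof (rule nn_integral_mono)
      fix \<sigma>
      have "ennreal (exp (scaled_energy N \<sigma>)) \<le> ennreal (exp (\<eta> * N) * exp (?step N \<sigma>) + exp (- real N) * exp (S N \<sigma>))"
        by (rule ennreal_leI[OF point[OF N]])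
      then show "ennreal (exp (scaled_energy N \<sigma>)) \<le> ennreal (exp (\<eta> * N)) * ennreal (exp (?step N \<sigma>)) + ennreal (exp (- real N)) * ennreal (exp (S N \<sigma>))"
        by (simp add: ennreal_mult)
    qed
    also have "\<dots> = ennreal (exp (\<eta> * N)) * (\<integral>\<^sup>+\<sigma>. ennreal (exp (?step N \<sigma>)) \<partial>?M) + ennreal (exp (- real N)) * (\<integral>\<^sup>+\<sigma>. ennreal (exp (S N \<sigma>)) \<partial>?M)"
    proof -
      note [measurable] = Sm stm
      have m: "(\<lambda>\<sigma>. ennreal (exp (?step N \<sigma>))) \<in> borel_measurable ?M" "(\<lambda>\<sigma>. ennreal (exp (S N \<sigma>))) \<in> borel_measurable ?M"
        by measurable
      show ?thesis
        unfolding nn_integral_cmult[OF m(1), symmetric] nn_integral_cmult[OF m(2), symmetric]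
        by (rule nn_integral_add) (intro borel_measurable_times_ennreal borel_measurable_const m)+
    qed
    also have "\<dots> \<le> ennreal (exp (\<eta> * N)) * ennreal (exp (N * (s + ?err N)) * (real N + 1) ^ D) + ennreal (exp (- real N)) * 2 ^ N"
      unfolding D_def by (intro add_mono mult_left_mono expS step_partition_le[OF p finA pA ppos s cb N]) auto
    \<comment> \<open>The surplus factor exp (- N) beats the moment bound 2^N, since exp 1 is at
      least 2.\<close>
    also have "ennreal (exp (- real N)) * 2 ^ N \<le> 1"
    proof -
      have "exp (- real N) * 2 ^ N = (exp (- 1) * 2) ^ N"
        by (simp add: power_mult_distrib exp_of_nat_mult[symmetric])
      also have "\<dots> \<le> 1"
      proof (rule power_le_one)
        have "2 \<le> exp (1::real)" using exp_ge_add_one_self[of 1] by simp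
        then have "exp (- 1) * 2 \<le> exp (- 1) * exp (1::real)" by (intro mult_left_mono) auto
        then show "exp (- 1) * 2 \<le> (1::real)" by (simp flip: exp_add)
      qed simp
      finally have "ennreal (exp (- real N) * 2 ^ N) \<le> 1" by (simp add: ennreal_le_1)
      then show ?thesis by (simp add: ennreal_mult ennreal_power flip: ennreal_numeral)
    qed
    finally have "(\<integral>\<^sup>+\<sigma>. ennreal (exp (scaled_energy N \<sigma>)) \<partial>?M) \<le> ennreal (exp (\<eta> * N)) * ennreal (exp (N * (s + ?err N)) * (real N + 1) ^ D) + 1"
      by (simp add: add_left_mono)
    also have "\<dots> = ennreal (exp (\<eta> * N) * (exp (N * (s + ?err N)) * (real N + 1) ^ D) + 1)"
      by (simp add: ennreal_mult)
    finally have "(\<integral>\<^sup>+\<sigma>. ennreal (exp (scaled_energy N \<sigma>)) \<partial>?M) \<le> ennreal (exp (\<eta> * N) * (exp (N * (s + ?err N)) * (real N + 1) ^ D) + 1)" .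
    moreover have "(\<integral>\<^sup>+\<sigma>. ennreal (exp (scaled_energy N \<sigma>)) \<partial>?M) = ennreal (\<integral>\<sigma>. exp (scaled_energy N \<sigma>) \<partial>?M)"
      by (rule nn_integral_eq_integral[OF integrable_exp_scaled_energy]) simp
    ultimately have "ennreal (\<integral>\<sigma>. exp (scaled_energy N \<sigma>) \<partial>?M) \<le> ennreal (exp (\<eta> * N) * (exp (N * (s + ?err N)) * (real N + 1) ^ D) + 1)"
      by (simp only:)
    moreover have "0 \<le> exp (\<eta> * N) * (exp (N * (s + ?err N)) * (real N + 1) ^ D) + 1" by simp
    ultimately show ?thesis by (simp only: ennreal_le_iff)
  qed
  \<comment> \<open>The logarithm, per vertex, of twice the main term. The added 1 is absorbed into
    the factor 2, and ln (N + 1) \<le> ln 2 + ln N turns the number of types into a vanishing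
    term.\<close>
  define U where "U N = ln 2 / real N + \<eta> + (s + ?err N) + D * (ln 2 / real N + ln (real N) / real N)" for N
  have "U \<longlonglongrightarrow> 0 + \<eta> + (s + 0) + real D * (0 + 0)"
    unfolding U_def
    by (intro tendsto_intros lim_const_over_n lim_ln_over_n freq_error_tendsto[OF p finA pA ppos s cb])
  then have "U \<longlonglongrightarrow> s + \<eta>" by (simp add: add.commute)
  moreover have "s + \<eta> < s + \<epsilon>" using \<epsilon> by (simp add: \<eta>_def)
  ultimately have "\<forall>\<^sub>F N in sequentially. U N < s + \<epsilon>" by (rule order_tendstoD)
  then show ?thesis
    using eventually_ge_at_top[of "1::nat"]
  proof eventually_elim
    case (elim N)
    then have N: "1 \<le> N" by simp
    have err0: "0 \<le> ?err N"
      by (rule freq_error_nonneg[OF p finA pA ppos s cb])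
    let ?X = "exp (\<eta> * N) * (exp (N * (s + ?err N)) * (real N + 1) ^ D)"
    have X1: "1 \<le> ?X"
    proof -
      have "1 \<le> exp (\<eta> * N)" "1 \<le> exp (N * (s + ?err N))" "1 \<le> (real N + 1) ^ D"
        using \<eta> s0 err0 by (auto intro: one_le_power)
      then have "1 * (1 * 1) \<le> ?X" by (intro mult_mono) auto
      then show ?thesis by simp
    qed
    have Zpos: "0 < (\<integral>\<sigma>. exp (scaled_energy N \<sigma>) \<partial>PiM {1..N} (\<lambda>_. \<alpha>))"
    proof -
      interpret PI: prob_space "PiM {1..N} (\<lambda>_. \<alpha>)" by (rule prob_space_PiM) (rule A.prob_space_axioms)
      have "(\<integral>\<sigma>. 1 \<partial>PiM {1..N} (\<lambda>_. \<alpha>)) \<le> (\<integral>\<sigma>. exp (scaled_energy N \<sigma>) \<partial>PiM {1..N} (\<lambda>_. \<alpha>))"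
        by (intro integral_mono PI.integrable_const integrable_exp_scaled_energy) (simp add: scaled_energy_bounds(1))
      then show ?thesis by (simp add: PI.prob_space del: One_nat_def)
    qed
    have "ln (\<integral>\<sigma>. exp (scaled_energy N \<sigma>) \<partial>PiM {1..N} (\<lambda>_. \<alpha>)) \<le> ln (2 * ?X)"
      using part[OF N] X1 Zpos by (subst ln_le_cancel_iff) auto
    also have "\<dots> = ln 2 + (\<eta> * N + (N * (s + ?err N) + D * ln (real N + 1)))"
      by (simp add: ln_mult ln_realpow)
    also have "ln (real N + 1) \<le> ln 2 + ln (real N)"
    proof -
      have "ln (real N + 1) \<le> ln (2 * real N)" using N by (subst ln_le_cancel_iff) auto
      then show ?thesis using N by (simp add: ln_mult)
    qed
    finally have "ln (\<integral>\<sigma>. exp (scaled_energy N \<sigma>) \<partial>PiM {1..N} (\<lambda>_. \<alpha>)) \<le> ln 2 + (\<eta> * N + (N * (s + ?err N) + D * (ln 2 + ln (real N))))"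
      by (simp add: mult_left_mono)
    then have "log_partition N \<le> (ln 2 + (\<eta> * N + (N * (s + ?err N) + D * (ln 2 + ln (real N))))) / N"
      unfolding log_partition_def by (rule divide_right_mono) simp
    also have "\<dots> = U N" unfolding U_def using N by (simp add: add_divide_distrib distrib_left)
    finally show ?case using elim by simp
  qed
qed

end

section \<open>Lower bound on the supremum and near-optimal competitors\<close>

context mean_field
begin

text \<open>A single class with class value 0 and density 1 stands for the product of \<alpha> and
  \<open>P\<close>; its class energy and its entropy are 0. Hence the supremum is neither negative
  nor minus infinity.\<close>

lemma variational_upper_nonneg:
  assumes s: "\<And>\<nu>. admissible \<nu> \<Longrightarrow> ereal (energy (\<lambda>x. x) \<nu>) - enn2ereal (mean_conditional_entropy \<alpha> \<nu>) \<le> ereal s"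
  shows "0 \<le> s"
proof -
  interpret discretized_mean_field \<alpha> P V K "\<lambda>_. 0" 0 "\<lambda>_. 0" by unfold_locales auto
  have "class_energy (\<lambda>_ _. 1) - (\<Sum>k\<le>0. mass k * (\<integral>x. 1 * ln 1 \<partial>\<alpha>)) \<le> s"
    by (rule class_energy_le[OF s, where L=1]) (auto simp: A.prob_space)
  then show ?thesis by (simp add: class_energy_def)
qed

text \<open>The mean entropy is an infimum over versions of the conditional law. The strict
  inequality leaves room to pick one version, so no uniqueness of versions has to be
  invoked.\<close>

lemma trial_measure:
  assumes adm: "admissible \<nu>" and r: "ereal r < ereal (energy (\<lambda>x. x) \<nu>) - enn2ereal (mean_conditional_entropy \<alpha> \<nu>)"
  obtains \<kappa> where "regular_conditional_law \<nu> \<kappa>" "(\<integral>\<^sup>+x. relative_entropy (\<kappa> x) \<alpha> \<partial>P) < \<infinity>"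
    "r < energy (\<lambda>x. x) \<nu> - enn2real (\<integral>\<^sup>+x. relative_entropy (\<kappa> x) \<alpha> \<partial>P)"
proof -
  let ?E = "energy (\<lambda>x. x) \<nu>"
  let ?m = "mean_conditional_entropy \<alpha> \<nu>"
  have fin: "?m \<noteq> \<top>" using r by auto
  then obtain t where t: "?m = ennreal t" "0 \<le> t" by (cases ?m) auto
  have "r < ?E - t" using r t by simp
  then have "?m < ennreal (?E - r)" using t by (simp add: ennreal_less_iff)
  then obtain \<kappa> where reg: "regular_conditional_law \<nu> \<kappa>" and T: "(\<integral>\<^sup>+x. relative_entropy (\<kappa> x) \<alpha> \<partial>P) < ennreal (?E - r)"
    unfolding mean_conditional_entropy_def Inf_less_iff weight_marginal_def admissible_facts(5)[OF adm] by blast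
  have fin: "(\<integral>\<^sup>+x. relative_entropy (\<kappa> x) \<alpha> \<partial>P) < \<infinity>" using less_trans[OF T ennreal_less_top] by simp
  obtain u where u: "(\<integral>\<^sup>+x. relative_entropy (\<kappa> x) \<alpha> \<partial>P) = ennreal u" "0 \<le> u"
    using fin by (cases "\<integral>\<^sup>+x. relative_entropy (\<kappa> x) \<alpha> \<partial>P") auto
  have "u < ?E - r" using T u by (simp add: ennreal_less_iff)
  then have "r < ?E - enn2real (\<integral>\<^sup>+x. relative_entropy (\<kappa> x) \<alpha> \<partial>P)" using u by simp
  with reg fin show ?thesis by (rule that)
qed

end

section \<open>Passage to the limit\<close>

context weighted_mean_field
begin

text \<open>There are two exchanges, both uniform in \<sigma>. Class values for weights change the
  pair energy by at most K (l - cc) l, which after division by l is controlled by l - cc \<le>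
  \<delta> (N + q). Then the normalization \<open>mean * N\<close> replaces l, at a cost
  proportional to the relative error of the total weight.\<close>

lemma pair_energy_replacement:
  assumes w: "\<And>i. 1 \<le> i \<Longrightarrow> 0 < w i" and N: "1 \<le> N"
    and cb: "\<And>x. 0 < x \<Longrightarrow> c (b x) \<le> x" and cd: "\<And>x. 0 < x \<Longrightarrow> x - c (b x) \<le> \<delta> * (1 + x\<^sup>2)"
  defines "l \<equiv> \<Sum>i=1..N. w i" and "q \<equiv> \<Sum>i=1..N. (w i)\<^sup>2"
  shows "\<bar>pair_energy w V N \<sigma> / l - scaled_energy N \<sigma>\<bar> \<le> K * \<delta> * (N + q) + K * l * \<bar>1 - l / (mean * N)\<bar>"
    and "\<bar>l / N - (\<Sum>k\<le>B. class_freq N k * c k)\<bar> \<le> \<delta> * (1 + q / N)"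
proof -
  let ?I = "{1..N}"
  define cc where "cc = (\<Sum>i=1..N. class_weight i)"
  have wi: "0 < w i" if "i \<in> ?I" for i using w that by simp
  have cw: "class_weight i \<le> w i" if "i \<in> ?I" for i unfolding class_weight_def using cb wi[OF that] by simp
  note c0 = class_weight_bounds(1)
  have l: "0 < l" unfolding l_def using N wi by (intro sum_pos) auto
  have ccl: "0 \<le> cc" "cc \<le> l" unfolding cc_def l_def using c0 cw by (auto intro: sum_nonneg sum_mono)
  have lcc: "l - cc \<le> \<delta> * (N + q)"
  proof -
    have "l - cc = (\<Sum>i\<in>?I. w i - class_weight i)" unfolding l_def cc_def by (rule sum_subtractf[symmetric])
    also have "\<dots> \<le> (\<Sum>i\<in>?I. \<delta> * (1 + (w i)\<^sup>2))"
      unfolding class_weight_def using cd wi by (intro sum_mono) auto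
    also have "\<dots> = \<delta> * (N + q)" unfolding q_def by (simp add: sum_distrib_left[symmetric] sum.distrib)
    finally show ?thesis .
  qed
  have vp: "i \<in> ?I" "j \<in> ?I" if "(i, j) \<in> vertex_pairs N" for i j using that by (auto simp: vertex_pairs_def)
  have sums: "(\<Sum>(i, j)\<in>vertex_pairs N. d i * d j) = ((\<Sum>i=1..N. d i)\<^sup>2 - (\<Sum>i=1..N. (d i)\<^sup>2)) / 2" for d :: "nat \<Rightarrow> real"
    by (subst sum_vertex_pairs) (auto simp: mult.commute power2_eq_square sum_product)
  have d1: "0 \<le> pair_energy w V N \<sigma> - pair_energy class_weight V N \<sigma>"
    and d2: "pair_energy w V N \<sigma> - pair_energy class_weight V N \<sigma> \<le> K * ((l - cc) * l)"
  proof -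
    have eq: "pair_energy w V N \<sigma> - pair_energy class_weight V N \<sigma> = (\<Sum>(i, j)\<in>vertex_pairs N. (w i * w j - class_weight i * class_weight j) * V (\<sigma> i) (\<sigma> j))"
      unfolding pair_energy_def by (simp add: sum_subtractf[symmetric] split_beta left_diff_distrib)
    have nn: "class_weight i * class_weight j \<le> w i * w j" if "(i, j) \<in> vertex_pairs N" for i j
      using vp[OF that] cw c0 wi by (intro mult_mono) (auto intro: less_imp_le)
    show "0 \<le> pair_energy w V N \<sigma> - pair_energy class_weight V N \<sigma>"
      unfolding eq
    proof (rule sum_nonneg)
      fix e assume "e \<in> vertex_pairs N"
      then show "0 \<le> (case e of (i, j) \<Rightarrow> (w i * w j - class_weight i * class_weight j) * V (\<sigma> i) (\<sigma> j))"
        using nn[of "fst e" "snd e"] V_nonneg by (simp add: split_beta)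
    qed
    have "pair_energy w V N \<sigma> - pair_energy class_weight V N \<sigma> \<le> (\<Sum>(i, j)\<in>vertex_pairs N. (w i * w j - class_weight i * class_weight j) * K)"
      unfolding eq
    proof (rule sum_mono)
      fix e assume "e \<in> vertex_pairs N"
      then show "(case e of (i, j) \<Rightarrow> (w i * w j - class_weight i * class_weight j) * V (\<sigma> i) (\<sigma> j)) \<le> (case e of (i, j) \<Rightarrow> (w i * w j - class_weight i * class_weight j) * K)"
        using nn[of "fst e" "snd e"] V_le by (simp add: split_beta mult_left_mono)
    qed
    also have "\<dots> = ((\<Sum>(i, j)\<in>vertex_pairs N. w i * w j) - (\<Sum>(i, j)\<in>vertex_pairs N. class_weight i * class_weight j)) * K"
      by (simp add: sum_subtractf[symmetric] split_beta sum_distrib_right)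
    also have "\<dots> = ((l\<^sup>2 - q) / 2 - (cc\<^sup>2 - (\<Sum>i=1..N. (class_weight i)\<^sup>2)) / 2) * K"
      unfolding sums l_def q_def cc_def ..
    also have "\<dots> \<le> ((l - cc) * l) * K"
    proof (rule mult_right_mono)
      have "(\<Sum>i=1..N. (class_weight i)\<^sup>2) \<le> q" unfolding q_def using cw c0 by (intro sum_mono power_mono) auto
      moreover have "l\<^sup>2 - cc\<^sup>2 \<le> 2 * ((l - cc) * l)"
      proof -
        have "0 \<le> (l - cc) * (l - cc)" by simp
        then show ?thesis by (simp add: algebra_simps power2_eq_square)
      qed
      ultimately show "(l\<^sup>2 - q) / 2 - (cc\<^sup>2 - (\<Sum>i=1..N. (class_weight i)\<^sup>2)) / 2 \<le> (l - cc) * l"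
        unfolding diff_divide_distrib[symmetric] by (subst pos_divide_le_eq) simp_all
    qed (rule K_nonneg)
    finally show "pair_energy w V N \<sigma> - pair_energy class_weight V N \<sigma> \<le> K * ((l - cc) * l)" by (simp add: mult.commute)
  qed
  have e1: "\<bar>pair_energy w V N \<sigma> / l - pair_energy class_weight V N \<sigma> / l\<bar> \<le> K * \<delta> * (N + q)"
  proof -
    have "\<bar>pair_energy w V N \<sigma> / l - pair_energy class_weight V N \<sigma> / l\<bar> = (pair_energy w V N \<sigma> - pair_energy class_weight V N \<sigma>) / l"
      using d1 l by (simp add: diff_divide_distrib[symmetric])
    also have "\<dots> \<le> K * ((l - cc) * l) / l" using d2 l by (intro divide_right_mono) auto
    also have "\<dots> = K * (l - cc)" using l by simp
    also have "\<dots> \<le> K * (\<delta> * (N + q))" using lcc K_nonneg by (intro mult_left_mono)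
    finally show ?thesis by (simp add: mult.assoc)
  qed
  have pc: "0 \<le> pair_energy class_weight V N \<sigma>" "pair_energy class_weight V N \<sigma> \<le> K * l\<^sup>2"
  proof -
    show "0 \<le> pair_energy class_weight V N \<sigma>" by (intro pair_energy_nonneg c0 V_nonneg)
    have "pair_energy class_weight V N \<sigma> \<le> (\<Sum>(i, j)\<in>vertex_pairs N. (class_weight i * class_weight j) * K)"
      unfolding pair_energy_def
    proof (rule sum_mono)
      fix e
      show "(case e of (i, j) \<Rightarrow> class_weight i * class_weight j * V (\<sigma> i) (\<sigma> j)) \<le> (case e of (i, j) \<Rightarrow> class_weight i * class_weight j * K)"
        using c0 V_le by (simp add: split_beta mult_left_mono)
    qed
    also have "\<dots> = ((cc\<^sup>2 - (\<Sum>i=1..N. (class_weight i)\<^sup>2)) / 2) * K"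
      unfolding cc_def sums[symmetric] by (simp add: split_beta sum_distrib_right)
    also have "\<dots> \<le> l\<^sup>2 * K"
    proof (rule mult_right_mono)
      have aux: "(x - y) / 2 \<le> z" if "0 \<le> y" "x \<le> z" "0 \<le> z" for x y z :: real
      proof -
        have "(x - y) / 2 \<le> z / 2" using that by (intro divide_right_mono) auto
        also have "\<dots> \<le> z" using that by simp
        finally show ?thesis .
      qed
      have "cc\<^sup>2 \<le> l\<^sup>2" using ccl by (intro power_mono)
      then show "(cc\<^sup>2 - (\<Sum>i=1..N. (class_weight i)\<^sup>2)) / 2 \<le> l\<^sup>2" by (intro aux sum_nonneg) simp_all
    qed (rule K_nonneg)
    finally show "pair_energy class_weight V N \<sigma> \<le> K * l\<^sup>2" by (simp add: mult.commute)
  qed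
  have e2: "\<bar>pair_energy class_weight V N \<sigma> / l - scaled_energy N \<sigma>\<bar> \<le> K * l * \<bar>1 - l / (mean * N)\<bar>"
  proof -
    have "pair_energy class_weight V N \<sigma> / l - scaled_energy N \<sigma> = pair_energy class_weight V N \<sigma> * ((1 - l / (mean * N)) / l)"
      unfolding scaled_energy_def using l by (simp add: right_diff_distrib diff_divide_distrib)
    then have "\<bar>pair_energy class_weight V N \<sigma> / l - scaled_energy N \<sigma>\<bar> = pair_energy class_weight V N \<sigma> * (\<bar>1 - l / (mean * N)\<bar> / l)"
      using pc(1) l by (simp add: abs_mult)
    also have "\<dots> \<le> K * l\<^sup>2 * (\<bar>1 - l / (mean * N)\<bar> / l)"
      using pc(2) l by (intro mult_right_mono) auto
    also have "\<dots> = K * l * \<bar>1 - l / (mean * N)\<bar>" using l by (simp add: power2_eq_square)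
    finally show ?thesis .
  qed
  show "\<bar>pair_energy w V N \<sigma> / l - scaled_energy N \<sigma>\<bar> \<le> K * \<delta> * (N + q) + K * l * \<bar>1 - l / (mean * N)\<bar>"
    using e1 e2 by linarith
  have "cc = N * (\<Sum>k\<le>B. class_freq N k * c k)" unfolding cc_def class_weight_def by (rule sum_vertices)
  then have "l / N - (\<Sum>k\<le>B. class_freq N k * c k) = (l - cc) / N" using N by (simp add: diff_divide_distrib)
  then have "\<bar>l / N - (\<Sum>k\<le>B. class_freq N k * c k)\<bar> = (l - cc) / N" using ccl by simp
  also have "\<dots> \<le> \<delta> * (N + q) / N" using lcc by (intro divide_right_mono) auto
  also have "\<dots> = \<delta> * (1 + q / N)" using N by (simp add: field_simps)
  finally show "\<bar>l / N - (\<Sum>k\<le>B. class_freq N k * c k)\<bar> \<le> \<delta> * (1 + q / N)" .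
qed

lemma class_mean_dist:
  assumes cb: "\<And>x. 0 < x \<Longrightarrow> c (b x) \<le> x" and cd: "\<And>x. 0 < x \<Longrightarrow> x - c (b x) \<le> \<delta> * (1 + x\<^sup>2)"
  shows "\<bar>mean - (\<Sum>k\<le>B. mass k * c k)\<bar> \<le> \<delta> * (1 + second_moment)"
proof -
  have i: "integrable P (\<lambda>x. c k * indicator {x. b x = k} x)" for k
    by (intro integrable_mult_right P.integrable_const_bound[where B=1]) auto
  have eq: "c (b x) = (\<Sum>k\<le>B. c k * indicator {x. b x = k} x)" for x by (rule sum_classes)
  have ci: "integrable P (\<lambda>x. c (b x))" unfolding eq by (intro Bochner_Integration.integrable_sum i)
  have "(\<integral>x. c (b x) \<partial>P) = (\<Sum>k\<le>B. \<integral>x. c k * indicator {x. b x = k} x \<partial>P)"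
    unfolding eq by (rule Bochner_Integration.integral_sum[OF i])
  also have "\<dots> = (\<Sum>k\<le>B. mass k * c k)"
    by (intro sum.cong refl) (simp add: mass_def mult.commute)
  finally have "mean - (\<Sum>k\<le>B. mass k * c k) = (\<integral>x. x - c (b x) \<partial>P)"
    unfolding mean_def using integrable_id ci by simp
  moreover have "0 \<le> (\<integral>x. x - c (b x) \<partial>P)"
  proof (rule integral_nonneg_AE)
    show "AE x in P. 0 \<le> x - c (b x)" using P_pos by eventually_elim (use cb in simp)
  qed
  moreover have "(\<integral>x. x - c (b x) \<partial>P) \<le> (\<integral>x. \<delta> * (1 + x\<^sup>2) \<partial>P)"
  proof (rule integral_mono_AE)
    show "AE x in P. x - c (b x) \<le> \<delta> * (1 + x\<^sup>2)" using P_pos by eventually_elim (rule cd)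
  qed (use integrable_id ci P_square in auto)
  moreover have "(\<integral>x. \<delta> * (1 + x\<^sup>2) \<partial>P) = \<delta> * (1 + second_moment)"
    unfolding integral_mult_right_zero using P_square P.prob_space by (simp add: second_moment_def)
  ultimately show ?thesis by linarith
qed

end

context mean_field
begin

context
  fixes w :: "nat \<Rightarrow> real" and C2 :: real
  assumes w: "\<And>i. 1 \<le> i \<Longrightarrow> 0 < w i"
    and conv: "weak_conv_m (empirical_weight_law w) P"
    and C2: "\<And>N. (\<Sum>i=1..N. (w i)\<^sup>2) / real N \<le> C2"
begin

lemma C2_nonneg: "0 \<le> C2"
  using C2[of 0] by simp

text \<open>Convergence in distribution alone does not give convergence of means. The bounded second
  moments supply the missing uniform integrability: up to \<delta> (1 + C2) for the finite systems
  and \<delta> (1 + second moment) for \<open>P\<close>, the means are those of the class values,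
  which converge with the frequencies.\<close>

lemma mean_weight_tendsto: "(\<lambda>N. (\<Sum>i=1..N. w i) / real N) \<longlonglongrightarrow> mean"
proof (rule tendstoI)
  fix e :: real assume e: "0 < e"
  define D where "D = 2 + C2 + second_moment"
  define \<delta> where "\<delta> = e / (4 * D)"
  have D: "0 < D" unfolding D_def using C2_nonneg second_moment_nonneg by linarith
  then have \<delta>: "0 < \<delta>" using e by (simp add: \<delta>_def)
  have \<delta>e: "\<delta> * (2 + C2 + second_moment) = e / 4" unfolding D_def[symmetric] \<delta>_def using D by simp
  show "\<forall>\<^sub>F N in sequentially. dist ((\<Sum>i=1..N. w i) / real N) mean < e"
  proof (rule weight_discretization[OF P.real_distribution_axioms P_pos conv \<delta>])
    fix B :: nat and b :: "real \<Rightarrow> nat" and c :: "nat \<Rightarrow> real"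
    assume bc: "b \<in> borel \<rightarrow>\<^sub>M count_space UNIV" "\<And>x. b x \<le> B" "\<And>k. 0 \<le> c k"
    "\<And>x. 0 < x \<Longrightarrow> c (b x) \<le> x" "\<And>x. 0 < x \<Longrightarrow> x - c (b x) \<le> \<delta> * (1 + x\<^sup>2)"
    "\<And>k. (\<lambda>N. card {i \<in> {1..N}. b (w i) = k} / N) \<longlonglongrightarrow> measure P {x. b x = k}"
    interpret weighted_mean_field \<alpha> P V K b B c w by unfold_locales (fact bc)+
    have "(\<lambda>N. \<Sum>k\<le>B. class_freq N k * c k) \<longlonglongrightarrow> (\<Sum>k\<le>B. mass k * c k)"
      by (intro tendsto_intros class_freq_tendsto)
    then have "\<forall>\<^sub>F N in sequentially. dist (\<Sum>k\<le>B. class_freq N k * c k) (\<Sum>k\<le>B. mass k * c k) < e / 2"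
      by (rule tendstoD) (use e in simp)
    then show "\<forall>\<^sub>F N in sequentially. dist ((\<Sum>i=1..N. w i) / real N) mean < e"
      using eventually_ge_at_top[of "1::nat"]
    proof eventually_elim
      case (elim N)
      have "\<bar>(\<Sum>i=1..N. w i) / N - (\<Sum>k\<le>B. class_freq N k * c k)\<bar> \<le> \<delta> * (1 + (\<Sum>i=1..N. (w i)\<^sup>2) / N)"
        by (rule pair_energy_replacement(2)[OF w elim(2) bc(4,5)])
      also have "\<dots> \<le> \<delta> * (1 + C2)" using C2 \<delta> by (intro mult_left_mono) auto
      finally have 1: "\<bar>(\<Sum>i=1..N. w i) / N - (\<Sum>k\<le>B. class_freq N k * c k)\<bar> \<le> \<delta> * (1 + C2)" .
      have 2: "\<bar>mean - (\<Sum>k\<le>B. mass k * c k)\<bar> \<le> \<delta> * (1 + second_moment)" by (rule class_mean_dist[OF bc(4,5)])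
      have "\<delta> * (1 + C2) + \<delta> * (1 + second_moment) = e / 4" unfolding \<delta>e[symmetric] by (simp add: algebra_simps)
      then show ?case using 1 2 elim(1) e unfolding dist_real_def by linarith
    qed
  qed
qed

definition log_mean_field_partition :: "nat \<Rightarrow> real" where
  "log_mean_field_partition N = ln (\<integral>\<sigma>. exp (pair_energy w V N \<sigma> / (\<Sum>i=1..N. w i)) \<partial>PiM {1..N} (\<lambda>_. \<alpha>)) / N"

text \<open>The two energies are compared pointwise in \<sigma>, so the bound passes through the
  logarithm of the integrals unchanged. Its second term vanishes in the limit, because the average
  weight tends to \<open>mean\<close>.\<close>

lemma log_mean_field_partition_dist:
  assumes bc: "b \<in> borel \<rightarrow>\<^sub>M count_space UNIV" "\<And>x. b x \<le> B" "\<And>k. 0 \<le> c k"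
    "\<And>x. 0 < x \<Longrightarrow> c (b x) \<le> x" "\<And>x. 0 < x \<Longrightarrow> x - c (b x) \<le> \<delta> * (1 + x\<^sup>2)"
    "\<And>k. (\<lambda>N. card {i \<in> {1..N}. b (w i) = k} / N) \<longlonglongrightarrow> measure P {x. b x = k}"
    and \<delta>: "0 < \<delta>" and e: "K * \<delta> * (1 + C2) < e"
  shows "\<forall>\<^sub>F N in sequentially. \<bar>log_mean_field_partition N - weighted_mean_field.log_partition \<alpha> P V b c w N\<bar> < e"
proof -
  interpret W: weighted_mean_field \<alpha> P V K b B c w by unfold_locales (fact bc)+
  define err where "err N = K * \<delta> * (1 + C2) + K * ((\<Sum>i=1..N. w i) / N) * \<bar>1 - (\<Sum>i=1..N. w i) / N / mean\<bar>" for N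
  have "err \<longlonglongrightarrow> K * \<delta> * (1 + C2) + K * mean * \<bar>1 - mean / mean\<bar>"
    unfolding err_def by (intro tendsto_intros mean_weight_tendsto) (use mean_pos in simp)
  then have "err \<longlonglongrightarrow> K * \<delta> * (1 + C2)" using mean_pos by simp
  then have "\<forall>\<^sub>F N in sequentially. err N < e" by (rule order_tendstoD) (rule e)
  then show ?thesis
    using eventually_ge_at_top[of "1::nat"]
  proof eventually_elim
    case (elim N)
    let ?l = "\<Sum>i=1..N. w i" and ?q = "\<Sum>i=1..N. (w i)\<^sup>2"
    let ?M = "PiM {1..N} (\<lambda>_. \<alpha>)"
    have N: "1 \<le> N" using elim by simp
    have pM: "prob_space ?M" by (rule prob_space_PiM) (rule A.prob_space_axioms)
    interpret PI: prob_space ?M by (rule pM)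
    have l: "0 < ?l" using N w by (intro sum_pos) auto
    have d: "\<bar>pair_energy w V N \<sigma> / ?l - W.scaled_energy N \<sigma>\<bar> \<le> N * err N" for \<sigma>
    proof -
      have "\<bar>pair_energy w V N \<sigma> / ?l - W.scaled_energy N \<sigma>\<bar> \<le> K * \<delta> * (N + ?q) + K * ?l * \<bar>1 - ?l / (mean * N)\<bar>"
        by (rule W.pair_energy_replacement(1)[OF w N bc(4,5)])
      also have "?q \<le> N * C2" using C2[of N] N by (simp add: field_simps)
      then have "K * \<delta> * (N + ?q) \<le> K * \<delta> * (N + N * C2)" using K_nonneg \<delta> by (intro mult_left_mono) auto
      then have "K * \<delta> * (N + ?q) + K * ?l * \<bar>1 - ?l / (mean * N)\<bar> \<le> K * \<delta> * (N + N * C2) + K * ?l * \<bar>1 - ?l / (mean * N)\<bar>" by simp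
      also have "\<dots> = N * err N"
        unfolding err_def using N by (simp add: algebra_simps)
      finally show ?thesis .
    qed
    have E0: "0 \<le> pair_energy w V N \<sigma> / ?l" for \<sigma>
      using l w V_nonneg by (intro divide_nonneg_pos pair_energy_nonneg) (auto intro: less_imp_le)
    have iE: "integrable ?M (\<lambda>\<sigma>. exp (pair_energy w V N \<sigma> / ?l))"
    proof (rule PI.integrable_const_bound)
      show "AE \<sigma> in ?M. norm (exp (pair_energy w V N \<sigma> / ?l)) \<le> exp (N * err N + N * (W.max_weight\<^sup>2 * K / mean))"
      proof (rule AE_I2)
        fix \<sigma>
        have "pair_energy w V N \<sigma> / ?l \<le> N * err N + N * (W.max_weight\<^sup>2 * K / mean)"
          using d[of \<sigma>] W.scaled_energy_bounds(2)[of N \<sigma>] by linarith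
        then show "norm (exp (pair_energy w V N \<sigma> / ?l)) \<le> exp (N * err N + N * (W.max_weight\<^sup>2 * K / mean))" by simp
      qed
      show "(\<lambda>\<sigma>. exp (pair_energy w V N \<sigma> / ?l)) \<in> borel_measurable ?M"
        by (intro borel_measurable_exp[THEN measurable_compose[rotated]] borel_measurable_divide borel_measurable_const measurable_pair_energy sets_\<alpha> V_borel)
    qed
    have "\<bar>ln (\<integral>\<sigma>. exp (pair_energy w V N \<sigma> / ?l) \<partial>?M) - ln (\<integral>\<sigma>. exp (W.scaled_energy N \<sigma>) \<partial>?M)\<bar> \<le> N * err N"
      by (rule ln_integral_exp_dist[OF pM iE W.integrable_exp_scaled_energy d W.scaled_energy_bounds(1) E0])
    then have "\<bar>ln (\<integral>\<sigma>. exp (pair_energy w V N \<sigma> / ?l) \<partial>?M) - ln (\<integral>\<sigma>. exp (W.scaled_energy N \<sigma>) \<partial>?M)\<bar> / N \<le> err N"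
      using N by (simp add: field_simps)
    moreover have "\<bar>log_mean_field_partition N - W.log_partition N\<bar> = \<bar>ln (\<integral>\<sigma>. exp (pair_energy w V N \<sigma> / ?l) \<partial>?M) - ln (\<integral>\<sigma>. exp (W.scaled_energy N \<sigma>) \<partial>?M)\<bar> / N"
      unfolding log_mean_field_partition_def W.log_partition_def by (simp add: diff_divide_distrib[symmetric])
    ultimately show ?case using elim by simp
  qed
qed

text \<open>The discretized system stays within e / 4 of the true one. Its upper bound refers to the
  supremum for the true weights and loses another e / 4. For the lower bound, the choice of \<nu>,
  the truncation of its weights and the clipping cost at most e / 8 each, less than e / 2
  together.\<close>

lemma log_mean_field_partition_tendsto:
  assumes s: "ereal s = (SUP \<nu>\<in>Collect admissible. ereal (energy (\<lambda>x. x) \<nu>) - enn2ereal (mean_conditional_entropy \<alpha> \<nu>))"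
  shows "log_mean_field_partition \<longlonglongrightarrow> s"
proof (rule tendstoI)
  fix e :: real assume e: "0 < e"
  have sle: "ereal (energy (\<lambda>x. x) \<nu>) - enn2ereal (mean_conditional_entropy \<alpha> \<nu>) \<le> ereal s" if "admissible \<nu>" for \<nu>
    unfolding s using that by (intro SUP_upper) auto
  have s0: "0 \<le> s" by (rule variational_upper_nonneg[OF sle])
  define D where "D = 1 + C2 + (1 + second_moment)"
  have D: "0 < D" unfolding D_def using C2_nonneg second_moment_nonneg by linarith
  \<comment> \<open>\<open>K\<close> may be 0, so \<delta> is defined through a positive
    majorant.\<close>
  define K' where "K' = K + 1"
  define \<delta> where "\<delta> = e / (8 * K' * D)"
  have K': "0 < K'" "K \<le> K'" using K_nonneg by (auto simp: K'_def)
  have \<delta>: "0 < \<delta>" unfolding \<delta>_def using e D K' by simp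
  have KD: "K * \<delta> * D \<le> e / 8"
  proof -
    have "K * \<delta> * D \<le> K' * \<delta> * D" using \<delta> D K' by (intro mult_right_mono) auto
    also have "\<dots> = e / 8" unfolding \<delta>_def using D K' by simp
    finally show ?thesis .
  qed
  have "K * \<delta> * (1 + C2) \<le> K * \<delta> * D" "K * \<delta> * (1 + second_moment) \<le> K * \<delta> * D"
    unfolding D_def using K_nonneg \<delta> C2_nonneg second_moment_nonneg by (intro mult_left_mono; simp)+
  then have K1: "K * \<delta> * (1 + C2) < e / 4" and K2: "K * \<delta> * (1 + second_moment) \<le> e / 8" using KD e by linarith+
  show "\<forall>\<^sub>F N in sequentially. dist (log_mean_field_partition N) s < e"
  proof (rule weight_discretization[OF P.real_distribution_axioms P_pos conv \<delta>])
    fix B :: nat and b :: "real \<Rightarrow> nat" and c :: "nat \<Rightarrow> real"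
    assume bc: "b \<in> borel \<rightarrow>\<^sub>M count_space UNIV" "\<And>x. b x \<le> B" "\<And>k. 0 \<le> c k"
    "\<And>x. 0 < x \<Longrightarrow> c (b x) \<le> x" "\<And>x. 0 < x \<Longrightarrow> x - c (b x) \<le> \<delta> * (1 + x\<^sup>2)"
    "\<And>k. (\<lambda>N. card {i \<in> {1..N}. b (w i) = k} / N) \<longlonglongrightarrow> measure P {x. b x = k}"
    interpret W: weighted_mean_field \<alpha> P V K b B c w by unfold_locales (fact bc)+
    have near: "\<forall>\<^sub>F N in sequentially. \<bar>log_mean_field_partition N - W.log_partition N\<bar> < e / 4"
      by (rule log_mean_field_partition_dist[OF bc \<delta> K1])
    have up: "\<forall>\<^sub>F N in sequentially. W.log_partition N \<le> s + e / 4"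
      by (rule W.log_partition_upper[OF sle bc(4) s0]) (use e in auto)
    have "ereal (s - e / 8) < ereal s" using e by simp
    then obtain \<nu> where adm: "admissible \<nu>" and \<nu>: "ereal (s - e / 8) < ereal (energy (\<lambda>x. x) \<nu>) - enn2ereal (mean_conditional_entropy \<alpha> \<nu>)"
      unfolding s by (auto simp: less_SUP_iff)
    obtain \<kappa> where reg: "regular_conditional_law \<nu> \<kappa>" and fin: "(\<integral>\<^sup>+x. relative_entropy (\<kappa> x) \<alpha> \<partial>P) < \<infinity>"
      and T: "s - e / 8 < energy (\<lambda>x. x) \<nu> - enn2real (\<integral>\<^sup>+x. relative_entropy (\<kappa> x) \<alpha> \<partial>P)"
      by (rule trial_measure[OF adm \<nu>])
    have e8: "0 < e / 8" using e by simp
    show "\<forall>\<^sub>F N in sequentially. dist (log_mean_field_partition N) s < e"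
    proof (rule W.trial_densities[OF adm reg fin e8])
      fix g :: "nat \<Rightarrow> 'a \<Rightarrow> real" and lo hi
      assume g: "\<And>k. g k \<in> borel_measurable \<alpha>" "0 < lo" "\<And>k x. lo \<le> g k x" "\<And>k x. g k x \<le> hi" "\<And>k. (\<integral>x. g k x \<partial>\<alpha>) = 1"
      and en: "energy (\<lambda>x. c (b x)) \<nu> - enn2real (\<integral>\<^sup>+x. relative_entropy (\<kappa> x) \<alpha> \<partial>P) - e / 8 \<le> W.class_energy g - (\<Sum>k\<le>B. W.mass k * (\<integral>x. g k x * ln (g k x) \<partial>\<alpha>))"
      show "\<forall>\<^sub>F N in sequentially. dist (log_mean_field_partition N) s < e"
      proof (rule W.log_partition_lower[OF g])
        fix L assume L: "L \<longlonglongrightarrow> W.class_energy g - (\<Sum>k\<le>B. W.mass k * (\<integral>x. g k x * ln (g k x) \<partial>\<alpha>))"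
      and Lle: "\<And>N. 1 \<le> N \<Longrightarrow> L N \<le> W.log_partition N"
        have "energy (\<lambda>x. x) \<nu> \<le> energy (\<lambda>x. c (b x)) \<nu> + K * \<delta> * (1 + second_moment)"
          using bc by (intro energy_truncation adm) auto
        then have "s - e / 2 < W.class_energy g - (\<Sum>k\<le>B. W.mass k * (\<integral>x. g k x * ln (g k x) \<partial>\<alpha>))"
          using T en K2 e by linarith
        with L have "\<forall>\<^sub>F N in sequentially. s - e / 2 < L N" by (rule order_tendstoD)
        with near up show "\<forall>\<^sub>F N in sequentially. dist (log_mean_field_partition N) s < e"
          using eventually_ge_at_top[of "1::nat"]
        proof eventually_elim
          case (elim N)
          then show ?case using Lle[of N] e unfolding dist_real_def by linarith
        qed
      qed
    qed
  qed
qed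

end

end

text \<open>Infinite entropies are allowed under the supremum, which is therefore taken in the
  extended reals; that \<psi> is real expresses the finiteness of the limit.\<close>

theorem corollary3p4:
  fixes \<alpha> :: "'a :: polish_space measure"
    and \<Phi> :: "'a \<Rightarrow> 'a \<Rightarrow> real"
    and w :: "nat \<Rightarrow> real"
    and \<Omega> :: "'o measure"
    and W :: "'o \<Rightarrow> real"
    and P :: "real measure"
  assumes "compact (UNIV :: 'a set)"
    and "\<alpha> \<in> space (prob_algebra borel)"
    and "(\<lambda>(s, s'). \<Phi> s s') \<in> borel_measurable borel"
    and "bounded (range (\<lambda>(s, s'). \<Phi> s s'))"
    and "\<And>s s'. \<Phi> s s' = \<Phi> s' s"
    and "\<And>i. 1 \<le> i \<Longrightarrow> 0 < w i"
    and "prob_space \<Omega>" and "W \<in> borel_measurable \<Omega>" and "AE \<omega> in \<Omega>. 0 < W \<omega>"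
    and "P = distr \<Omega> borel W"
    and "weak_conv_m (empirical_weight_law w) P"
    and "integrable \<Omega> (\<lambda>\<omega>. (W \<omega>)\<^sup>2)"
    and "(\<lambda>N. (\<Sum>i=1..N. (w i)\<^sup>2) / real N) \<longlonglongrightarrow> prob_space.expectation \<Omega> (\<lambda>\<omega>. (W \<omega>)\<^sup>2)"
  shows "\<exists>\<psi>::real. annealed_pressure \<Phi> \<alpha> w \<longlonglongrightarrow> \<psi> \<and>
     ereal \<psi> =
       (SUP \<nu>\<in>{\<nu> \<in> space (prob_algebra borel). weight_marginal \<nu> = P}.
          ereal (tensor_integral (interaction_U (prob_space.expectation \<Omega> W) \<Phi>) \<nu>)
            - enn2ereal (mean_conditional_entropy \<alpha> \<nu>))
       - ereal (prob_space.expectation \<Omega> W / 2)"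
proof -
  note \<Phi>_meas = assms(3) and w = assms(6) and Wm[measurable] = assms(8) and P_def = assms(10)
    and conv = assms(11) and second = assms(13)
  have \<alpha>: "prob_space \<alpha>" "sets \<alpha> = sets borel" using assms(2) by (auto simp: space_prob_algebra)
  obtain K0 where K0: "\<And>s s'. \<bar>\<Phi> s s'\<bar> \<le> K0"
  proof -
    obtain K0 where "\<forall>x\<in>range (\<lambda>(s, s'). \<Phi> s s'). norm x \<le> K0" using assms(4) by (auto simp: bounded_iff)
    then have "\<bar>\<Phi> s s'\<bar> \<le> K0" for s s' by (auto simp: image_iff)
    then show ?thesis by (rule that)
  qed
  interpret \<Omega>: prob_space \<Omega> by fact
  define V where "V s s' = exp (\<Phi> s s')" for s s'
  have Vm: "case_prod V \<in> borel_measurable borel"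
    using measurable_compose[OF \<Phi>_meas borel_measurable_exp] by (simp add: V_def split_beta')
  have rd: "real_distribution P" unfolding P_def by (rule \<Omega>.real_distribution_distr) (rule Wm)
  interpret P: real_distribution P by (rule rd)
  interpret A: prob_space \<alpha> by (rule \<alpha>)
  interpret mean_field \<alpha> P V "exp K0"
  proof
    show "AE x in P. 0 < x" unfolding P_def using assms(9) by (subst AE_distr_iff) auto
    show "integrable P (\<lambda>x. x\<^sup>2)" unfolding P_def using assms(12) by (subst integrable_distr_eq) auto
    show "V s s' \<le> exp K0" for s s' using K0[of s s'] by (simp add: V_def abs_le_iff)
    show "V s s' = V s' s" for s s' by (simp add: V_def assms(5)[of s s'])
  qed (use \<alpha> Vm in \<open>auto simp: V_def\<close>)
  have mean: "mean = \<Omega>.expectation W" unfolding mean_def unfolding P_def by (subst integral_distr) auto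
  have tensor: "tensor_integral (interaction_U (\<Omega>.expectation W) \<Phi>) \<nu> = energy (\<lambda>x. x) \<nu>" for \<nu>
    unfolding tensor_integral_def energy_def interaction_U_def mean[symmetric] V_def split_beta' ..
  have adm: "{\<nu> \<in> space (prob_algebra borel). weight_marginal \<nu> = P} = Collect admissible"
    by (intro set_eqI) (simp only: mem_Collect_eq admissible_def)
  let ?F = "\<lambda>\<nu>. ereal (energy (\<lambda>x. x) \<nu>) - enn2ereal (mean_conditional_entropy \<alpha> \<nu>)"
  define S where "S = (SUP \<nu>\<in>Collect admissible. ?F \<nu>)"
  have "S \<le> ereal (exp K0 * mean / 2)"
    unfolding S_def
  proof (rule SUP_least)
    fix \<nu> assume "\<nu> \<in> Collect admissible"
    then have "energy (\<lambda>x. x) \<nu> \<le> exp K0 * mean / 2" using energy_le by simp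
    moreover have "?F \<nu> \<le> ereal (energy (\<lambda>x. x) \<nu>) - 0" by (intro ereal_minus_mono order_refl enn2ereal_nonneg)
    ultimately show "?F \<nu> \<le> ereal (exp K0 * mean / 2)" by (simp add: order.trans)
  qed
  \<comment> \<open>Otherwise -1 would bound the functional from above, although every upper bound
    is nonnegative.\<close>
  moreover have "S \<noteq> - \<infinity>"
  proof
    assume "S = - \<infinity>"
    then have "?F \<nu> \<le> ereal (- 1)" if "admissible \<nu>" for \<nu>
      using SUP_upper[of \<nu> "Collect admissible" ?F] that by (simp add: S_def)
    from variational_upper_nonneg[OF this] show False by simp
  qed
  ultimately obtain s where s: "S = ereal s" by (cases S) auto
  obtain C2 where C2: "\<And>N. (\<Sum>i=1..N. (w i)\<^sup>2) / real N \<le> C2"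
  proof -
    obtain C where C: "\<And>N. norm ((\<Sum>i=1..N. (w i)\<^sup>2) / real N) \<le> C"
      using convergent_imp_Bseq[OF convergentI[OF second]] by (auto simp: Bseq_def)
    have "(\<Sum>i=1..N. (w i)\<^sup>2) / real N \<le> C" for N
      using C[of N] unfolding real_norm_def by (rule order_trans[OF abs_ge_self])
    then show ?thesis by (rule that)
  qed
  let ?l = "\<lambda>N. \<Sum>i=1..N. w i" and ?q = "\<lambda>N. \<Sum>i=1..N. (w i)\<^sup>2"
  have a: "log_mean_field_partition w \<longlonglongrightarrow> s"
    by (rule log_mean_field_partition_tendsto[OF w conv C2]) (simp_all add: s[symmetric] S_def)
  have lN: "(\<lambda>N. ?l N / N) \<longlonglongrightarrow> mean" by (rule mean_weight_tendsto[OF w conv C2])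
  define m2 where "m2 = \<Omega>.expectation (\<lambda>\<omega>. (W \<omega>)\<^sup>2)"
  have qN: "(\<lambda>N. ?q N / N) \<longlonglongrightarrow> m2" unfolding m2_def by (rule second)
  have inv: "(\<lambda>N. 1 / real N) \<longlonglongrightarrow> 0" by (rule lim_1_over_n)
  \<comment> \<open>The sum of the y per vertex, written in averages that converge. The diagonal
    part carries an extra factor 1 / N, so the limit is half the mean.\<close>
  define t where "t N = ?l N / N / 2 - (?q N / N) / (?l N / N) / 2 * (1 / real N)" for N
  define r where "r N = 2 * exp (3 * K0) * ((?q N / N) / (?l N / N))\<^sup>2 * (1 / real N)" for N
  have "t \<longlonglongrightarrow> mean / 2 - m2 / mean / 2 * 0"
    unfolding t_def by (intro tendsto_intros lN qN inv) (use mean_pos in auto)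
  then have t: "t \<longlonglongrightarrow> mean / 2" by simp
  have "r \<longlonglongrightarrow> 2 * exp (3 * K0) * (m2 / mean)\<^sup>2 * 0"
    unfolding r_def by (intro tendsto_intros lN qN inv) (use mean_pos in auto)
  then have r: "r \<longlonglongrightarrow> 0" by simp
  have close: "\<bar>annealed_pressure \<Phi> \<alpha> w N - (log_mean_field_partition w N - t N)\<bar> \<le> r N" if N: "1 \<le> N" for N
  proof -
    have "log_mean_field_partition w N = ln (\<integral>\<sigma>. exp (pair_energy w V N \<sigma> / ?l N) \<partial>PiM {1..N} (\<lambda>_. \<alpha>)) / N"
      by (rule log_mean_field_partition_def[OF w conv C2])
    moreover have "(\<lambda>s s'. exp (\<Phi> s s')) = V" by (intro ext) (simp add: V_def)
    moreover have "t N = (?l N / 2 - ?q N / (2 * ?l N)) / N"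
      unfolding t_def using N by (simp add: diff_divide_distrib)
    moreover have "r N = 2 * exp (3 * K0) * (?q N / ?l N)\<^sup>2 / N"
      unfolding r_def using N by simp
    ultimately show ?thesis
      using annealed_pressure_approx[OF \<alpha> \<Phi>_meas K0 w N] by (simp only:)
  qed
  have "(\<lambda>N. annealed_pressure \<Phi> \<alpha> w N - (log_mean_field_partition w N - t N)) \<longlonglongrightarrow> 0"
  proof (rule Lim_null_comparison[OF _ r])
    show "\<forall>\<^sub>F N in sequentially. norm (annealed_pressure \<Phi> \<alpha> w N - (log_mean_field_partition w N - t N)) \<le> r N"
      using eventually_ge_at_top[of "1::nat"] by eventually_elim (use close in simp)
  qed
  from tendsto_add[OF this tendsto_diff[OF a t]]
  have "annealed_pressure \<Phi> \<alpha> w \<longlonglongrightarrow> s - mean / 2" by simp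
  moreover have "ereal (s - mean / 2) = S - ereal (\<Omega>.expectation W / 2)" by (simp add: s mean)
  ultimately show ?thesis
    unfolding adm tensor S_def by blast
qed

end
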